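(* Let $0<\theta<1$, $1<r_i\le p_i<\infty$ ($i=0,1$), $1\le q_0,q_1\le\infty$ (except the case $q_0=q_1=\infty$) and $a_0,a_1\in\mathbb R$. Then $$\left[HL^{p_0,r_0}_{a_0,q_0},HL^{p_1,r_1}_{a_1,q_1}\right]_\theta=HL^{p,r}_{a,q}$$ (complex interpolation, with equivalent norms), where $\frac1p=\frac{1-\theta}{p_0}+\frac\theta{p_1}$, $\frac1q=\frac{1-\theta}{q_0}+\frac\theta{q_1}$, $\frac1r=\frac{1-\theta}{r_0}+\frac\theta{r_1}$ and $a=(1-\theta)a_0+\theta a_1$.
   Context: All spaces here are complex (complex-valued functions). Let $\Omega\subset\mathbb R^N$ be measurable, $\mu$ Lebesgue measure. For measurable $f$ let $f^*(t)=\inf\{\lambda>0:\mu(\{|f|>\lambda\})\le t\}$, $\|f\|_{p,r}=\left(\int_0^\infty(t^{1/p}f^*(t))^r\frac{dt}t\right)^{1/r}$ for $0<p,r<\infty$; $L^{p,r}(A)$ is the space of measurable functions on $A$ with finite $\|\cdot\|_{p,r}$. Let $I=\{-1,0,1,2,\dots\}$, $\Omega_{-1}=\{\omega\in\Omega:|\omega|<1/2\}$, $\Omega_k=\{\omega\in\Omega:2^{k-1}\le|\omega|<2^k\}$ for $k\ge0$. $HL^{p,r}_{a,q}$ consists of the measurable $f$ on $\Omega$ with $f\chi_{\Omega_k}\in L^{p,r}(\Omega_k)$ for all $k\in I$ and $\|f\|_{HL^{p,r}_{a,q}}=\left(\sum_{k\in I}2^{kaq}\|f\chi_{\Omega_k}\|_{p,r}^q\right)^{1/q}<\infty$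 ($\sup_k2^{ka}\|f\chi_{\Omega_k}\|_{p,r}$ if $q=\infty$). $[A_0,A_1]_\theta$ is Calderón's complex interpolation space: the space of $x=f(\theta)$ with $f\in\mathcal F(A_0,A_1)$, normed by $\inf\{\|f\|_{\mathcal F}:f(\theta)=x\}$, where $\mathcal F(A_0,A_1)$ is the space of bounded continuous functions $f:\{0\le\mathrm{Re}\,z\le1\}\to A_0+A_1$, analytic in $0<\mathrm{Re}\,z<1$, such that $t\mapsto f(s+it)$ is continuous from $\mathbb R$ into $A_s$ and tends to $0$ as $|t|\to\infty$ ($s=0,1$), with norm $\max\left(\sup_t\|f(it)\|_{A_0},\sup_t\|f(1+it)\|_{A_1}\right)$. *)

theory Defs
  imports "HOL-Analysis.Analysis"
begin

text \<open>
  A space of complex functions on (a subset of) \<^typ>\<open>'a\<close>, with its norm.  Elements are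
  functions rather than classes modulo equality almost everywhere, so \<open>nrm\<close> is in general only a
  seminorm; all constructions below are invariant under changing a function on a null set (or
  outside the domain \<open>\<Omega>\<close>), and they yield the usual spaces of classes after identification.  The
  value of \<open>nrm\<close> is only meaningful on \<open>carr\<close>.
\<close>

record 'a fspace =
  carr :: "('a \<Rightarrow> complex) set"
  nrm :: "('a \<Rightarrow> complex) \<Rightarrow> real"

definition equivalent_fspaces :: "'a fspace \<Rightarrow> 'a fspace \<Rightarrow> bool" where
  "equivalent_fspaces A B \<longleftrightarrow>
     carr A = carr B \<and>
     (\<exists>C>0. \<forall>x\<in>carr A. nrm A x \<le> C * nrm B x \<and> nrm B x \<le> C * nrm A x)"


section \<open>Lorentz spaces and the spaces HL\<close>

text \<open>The power \<open>x powr s\<close> of an extended nonnegative number, for exponents \<open>s > 0\<close>.\<close>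

definition epowr :: "ennreal \<Rightarrow> real \<Rightarrow> ennreal" where
  "epowr x s = (if x = \<infinity> then \<infinity> else ennreal (enn2real x powr s))"

definition decreasing_rearrangement ::
    "'a::euclidean_space set \<Rightarrow> ('a \<Rightarrow> complex) \<Rightarrow> real \<Rightarrow> ennreal" where
  "decreasing_rearrangement A f t =
     Inf {ennreal l | l. 0 < l \<and> emeasure lebesgue {x\<in>A. l < cmod (f x)} \<le> ennreal t}"

definition lorentz_norm ::
    "'a::euclidean_space set \<Rightarrow> real \<Rightarrow> real \<Rightarrow> ('a \<Rightarrow> complex) \<Rightarrow> ennreal" where
  "lorentz_norm A p r f =
     epowr (\<integral>\<^sup>+t\<in>{0<..}. epowr (ennreal (t powr (1/p)) * decreasing_rearrangement A f t) r
                            * ennreal (1/t) \<partial>lborel) (1/r)"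

definition lorentz_space ::
    "'a::euclidean_space set \<Rightarrow> real \<Rightarrow> real \<Rightarrow> ('a \<Rightarrow> complex) set" where
  "lorentz_space A p r = {f \<in> borel_measurable (lebesgue_on A). lorentz_norm A p r f < \<infinity>}"

definition dyadic_shell :: "'a::euclidean_space set \<Rightarrow> int \<Rightarrow> 'a set" where
  "dyadic_shell \<Omega> k =
     (if k = -1 then {x\<in>\<Omega>. norm x < 1/2}
      else {x\<in>\<Omega>. 2 powi (k - 1) \<le> norm x \<and> norm x < 2 powi k})"

text \<open>
  \<^term>\<open>lorentz_norm A p r f\<close> only depends on \<open>f\<close> on \<open>A\<close>, so \<open>\<parallel>f \<chi>\<^sub>A\<parallel>\<close> is written without the
  characteristic function.  The parameter \<open>q \<in> [1,\<infinity>]\<close> is an \<^typ>\<open>ennreal\<close>.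
\<close>

definition HL_norm ::
    "'a::euclidean_space set \<Rightarrow> real \<Rightarrow> real \<Rightarrow> real \<Rightarrow> ennreal \<Rightarrow> ('a \<Rightarrow> complex) \<Rightarrow> ennreal" where
  "HL_norm \<Omega> p r a q f =
     (if q = \<infinity>
      then (SUP k\<in>{-1..}. ennreal (2 powr (of_int k * a)) * lorentz_norm (dyadic_shell \<Omega> k) p r f)
      else epowr (\<Sum>\<^sub>\<infinity>k\<in>{-1..}. ennreal (2 powr (of_int k * a * enn2real q)) *
                     epowr (lorentz_norm (dyadic_shell \<Omega> k) p r f) (enn2real q))
             (1 / enn2real q))"

definition HL ::
    "'a::euclidean_space set \<Rightarrow> real \<Rightarrow> real \<Rightarrow> real \<Rightarrow> ennreal \<Rightarrow> 'a fspace" where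
  "HL \<Omega> p r a q =
     \<lparr>carr = {f \<in> borel_measurable (lebesgue_on \<Omega>).
               (\<forall>k\<ge>-1. f \<in> lorentz_space (dyadic_shell \<Omega> k) p r) \<and> HL_norm \<Omega> p r a q f < \<infinity>},
      nrm = (\<lambda>f. enn2real (HL_norm \<Omega> p r a q f))\<rparr>"


section \<open>Complex interpolation\<close>

definition sum_fspace :: "'a fspace \<Rightarrow> 'a fspace \<Rightarrow> 'a fspace" where
  "sum_fspace A\<^sub>0 A\<^sub>1 =
     \<lparr>carr = {(\<lambda>u. x\<^sub>0 u + x\<^sub>1 u) | x\<^sub>0 x\<^sub>1. x\<^sub>0 \<in> carr A\<^sub>0 \<and> x\<^sub>1 \<in> carr A\<^sub>1},
      nrm = (\<lambda>x. Inf {nrm A\<^sub>0 x\<^sub>0 + nrm A\<^sub>1 x\<^sub>1 | x\<^sub>0 x\<^sub>1.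
                        x\<^sub>0 \<in> carr A\<^sub>0 \<and> x\<^sub>1 \<in> carr A\<^sub>1 \<and> x = (\<lambda>u. x\<^sub>0 u + x\<^sub>1 u)})\<rparr>"

definition closed_strip :: "complex set" where
  "closed_strip = {z. 0 \<le> Re z \<and> Re z \<le> 1}"

definition open_strip :: "complex set" where
  "open_strip = {z. 0 < Re z \<and> Re z < 1}"

text \<open>Continuity and complex differentiability are with respect to the norm \<^term>\<open>nrm A\<close>.\<close>

definition fspace_continuous_on ::
    "'a fspace \<Rightarrow> 'b::topological_space set \<Rightarrow> ('b \<Rightarrow> 'a \<Rightarrow> complex) \<Rightarrow> bool" where
  "fspace_continuous_on A S f \<longleftrightarrow>
     (\<forall>z\<in>S. f z \<in> carr A) \<and>
     (\<forall>z\<in>S. ((\<lambda>w. nrm A (\<lambda>u. f w u - f z u)) \<longlongrightarrow> 0) (at z within S))"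

definition fspace_analytic_on ::
    "'a fspace \<Rightarrow> complex set \<Rightarrow> (complex \<Rightarrow> 'a \<Rightarrow> complex) \<Rightarrow> bool" where
  "fspace_analytic_on A S f \<longleftrightarrow>
     (\<forall>z\<in>S. f z \<in> carr A) \<and>
     (\<forall>z\<in>S. \<exists>g\<in>carr A.
        ((\<lambda>w. nrm A (\<lambda>u. (f w u - f z u) / (w - z) - g u)) \<longlongrightarrow> 0) (at z within S))"

definition boundary_admissible :: "'a fspace \<Rightarrow> (real \<Rightarrow> 'a \<Rightarrow> complex) \<Rightarrow> bool" where
  "boundary_admissible A h \<longleftrightarrow>
     fspace_continuous_on A UNIV h \<and> ((\<lambda>t. nrm A (h t)) \<longlongrightarrow> 0) at_infinity"

definition calderon_F :: "'a fspace \<Rightarrow> 'a fspace \<Rightarrow> (complex \<Rightarrow> 'a \<Rightarrow> complex) set" where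
  "calderon_F A\<^sub>0 A\<^sub>1 = {f.
     fspace_continuous_on (sum_fspace A\<^sub>0 A\<^sub>1) closed_strip f \<and>
     (\<exists>M. \<forall>z\<in>closed_strip. nrm (sum_fspace A\<^sub>0 A\<^sub>1) (f z) \<le> M) \<and>
     fspace_analytic_on (sum_fspace A\<^sub>0 A\<^sub>1) open_strip f \<and>
     boundary_admissible A\<^sub>0 (\<lambda>t. f (Complex 0 t)) \<and>
     boundary_admissible A\<^sub>1 (\<lambda>t. f (Complex 1 t))}"

definition calderon_F_norm ::
    "'a fspace \<Rightarrow> 'a fspace \<Rightarrow> (complex \<Rightarrow> 'a \<Rightarrow> complex) \<Rightarrow> real" where
  "calderon_F_norm A\<^sub>0 A\<^sub>1 f =
     max (SUP t. nrm A\<^sub>0 (f (Complex 0 t))) (SUP t. nrm A\<^sub>1 (f (Complex 1 t)))"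

definition complex_interpolation :: "'a fspace \<Rightarrow> 'a fspace \<Rightarrow> real \<Rightarrow> 'a fspace" where
  "complex_interpolation A\<^sub>0 A\<^sub>1 \<theta> =
     \<lparr>carr = {f (of_real \<theta>) | f. f \<in> calderon_F A\<^sub>0 A\<^sub>1},
      nrm = (\<lambda>x. Inf {calderon_F_norm A\<^sub>0 A\<^sub>1 f | f. f \<in> calderon_F A\<^sub>0 A\<^sub>1 \<and> f (of_real \<theta>) = x})\<rparr>"

end

theory Submission
  imports Defs "HOL-Complex_Analysis.Conformal_Mappings"
begin

text \<open>
  The rearrangement \<open>f\<^sup>*\<close> is decreasing, so the Lorentz norm of \<open>f\<close> with exponents \<open>p\<close>, \<open>r\<close> is equivalent to the \<open>l\<^sup>r\<close> norm
  of the sequence \<open>2 powr (n/p) * f\<^sup>*(2\<^sup>n)\<close>, \<open>n \<in> \<int>\<close> (\<open>lorentz_lower\<close>, \<open>lorentz_upper\<close>).  Consequently the norm of \<open>HL\<close> is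
  equivalent to the norm in \<open>l\<^sup>q(l\<^sup>r)\<close> of the sequence \<open>2 powr (k a) * 2 powr (n/p) * f\<^sub>k\<^sup>*(2\<^sup>n)\<close>, where \<open>f\<^sub>k\<close> is the part of \<open>f\<close> on
  the \<open>k\<close>-th shell, and the theorem is the function space version of the fact that a sequence in \<open>l\<^sup>q(l\<^sup>r)\<close>
  is \<open>e0 powr (1-\<theta>) * e1 powr \<theta>\<close> with \<open>e0\<close>, \<open>e1\<close> in the two endpoint spaces.  This factorization is used once for
  the sequence itself and once for a functional that norms it.
  
  The interpolation space is contained in \<open>HL\<close> (\<open>interpolation_into_HL\<close>).  Let \<open>h = f \<theta>\<close> with \<open>f\<close> admissible.  In the \<open>k\<close>-th
  shell, the average of \<open>h\<close> over the set \<open>{|h| > h\<^sub>k\<^sup>*(2\<^sup>n)/2}\<close> against the conjugate phase of \<open>h\<close> is at least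
  \<open>h\<^sub>k\<^sup>*(2\<^sup>n)/2\<close>.  On the other hand these sets have measure at least \<open>2\<^sup>n\<close>, and the averages of any function \<open>u\<close> over such
  sets are controlled by the norm of \<open>u\<close> in either endpoint space (\<open>lorentz_averages\<close>, a form of Hardy's inequality
  that needs \<open>p > 1\<close>).  So one pairs the averages of \<open>f z\<close> with the analytic family of sequences \<open>e0\<^sup>1\<^sup>-\<^sup>z e1\<^sup>z\<close> obtained from the
  factored norming functional (\<open>mixed_dual_factorization\<close>).  This is a scalar analytic function on the strip,
  bounded on the two boundary lines by Hoelder's inequality, and the maximum principle bounds its value at \<open>\<theta>\<close>,
  which is at least half the norm of the sequence of \<open>h\<close>.  Only finite sums occur, and the bound does not depend on
  their length.
  
  Conversely, let \<open>h\<close> be in \<open>HL\<close> (\<open>HL_into_interpolation\<close>).  One cuts \<open>h\<close> into the pieces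
  \<open>{h\<^sub>k\<^sup>*(2\<^sup>n\<^sup>+\<^sup>1) < |h| \<le> h\<^sub>k\<^sup>*(2\<^sup>n)}\<close> and multiplies \<open>h\<close> on the piece with index \<open>(k, n)\<close> by \<open>exp ((z - \<theta>) \<lambda> + z\<^sup>2 - \<theta>\<^sup>2)\<close>, with \<open>\<lambda>\<close>
  depending on \<open>(k, n)\<close> and chosen from the factorization such that on the line \<open>Re z = i\<close> the sequence of \<open>h\<close> becomes
  \<open>ei\<close> up to the weights.  Since the pieces have measure at most \<open>2\<^sup>n\<^sup>+\<^sup>1\<close>, the norms on the two lines are bounded by
  those of \<open>e0\<close> and \<open>e1\<close> (\<open>lorentz_norm_atomic\<close>).  On the part with \<open>\<lambda> \<le> 0\<close> the family stays bounded in \<open>A\<^sub>0\<close> throughout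
  the strip, and on the part with \<open>\<lambda> > 0\<close> in \<open>A\<^sub>1\<close>; continuity and analyticity follow from dominated convergence in
  the sequence spaces.
  
  Dominated convergence requires that the tails of \<open>e0\<close> and \<open>e1\<close> are small in norm.  If one of \<open>q\<^sub>0\<close>, \<open>q\<^sub>1\<close> is infinite this does not come
  for free, and the factor in \<open>l\<^sup>\<infinity>\<close> has to be taken from \<open>c\<^sub>0\<close>.  This is possible because the other exponent
  is finite: a summable sequence remains summable after division by the square roots of its tails
  (\<open>tail_majorant\<close>, \<open>ell_ball_factorization\<close>).
\<close>

section \<open>Balls of sequence spaces\<close>

text \<open>
  The nonnegative sequences in the ball of radius \<open>B\<close> of \<open>l\<^sup>s(I)\<close>, where \<open>\<kappa> = 1/s\<close>; for \<open>\<kappa> = 0\<close>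
  this is the ball of \<open>l\<^sup>\<infinity>\<close>.  With reciprocal exponents the relations between the interpolation
  parameters are affine and the endpoint \<open>s = \<infinity>\<close> needs no separate notation; with finite sums there
  are no summability side conditions.
\<close>

definition ell_ball :: "real \<Rightarrow> 'i set \<Rightarrow> real \<Rightarrow> ('i \<Rightarrow> real) \<Rightarrow> bool" where
  "ell_ball \<kappa> I B b \<longleftrightarrow> 0 \<le> B \<and> (\<forall>i\<in>I. 0 \<le> b i \<and> b i \<le> B) \<and>
     (\<kappa> > 0 \<longrightarrow> (\<forall>F. finite F \<longrightarrow> F \<subseteq> I \<longrightarrow> (\<Sum>i\<in>F. b i powr (1/\<kappa>)) \<le> B powr (1/\<kappa>)))"

lemma ell_ballD:
  assumes "ell_ball \<kappa> I B b"
  shows "0 \<le> B" "i \<in> I \<Longrightarrow> 0 \<le> b i" "i \<in> I \<Longrightarrow> b i \<le> B"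
    "\<kappa> > 0 \<Longrightarrow> finite F \<Longrightarrow> F \<subseteq> I \<Longrightarrow> (\<Sum>i\<in>F. b i powr (1/\<kappa>)) \<le> B powr (1/\<kappa>)"
  using assms unfolding ell_ball_def by auto

lemma ell_ballI_sum:
  assumes "\<kappa> > 0" "0 \<le> B" "\<And>i. i \<in> I \<Longrightarrow> 0 \<le> b i"
    and "\<And>F. finite F \<Longrightarrow> F \<subseteq> I \<Longrightarrow> (\<Sum>i\<in>F. b i powr (1/\<kappa>)) \<le> B powr (1/\<kappa>)"
  shows "ell_ball \<kappa> I B b"
proof -
  have "b i \<le> B" if "i \<in> I" for i
  proof (rule ccontr)
    assume "\<not> b i \<le> B"
    then have "B powr (1/\<kappa>) < b i powr (1/\<kappa>)"
      using assms(1,2) by (intro powr_less_mono2) auto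
    moreover have "b i powr (1/\<kappa>) \<le> B powr (1/\<kappa>)"
      using assms(4)[of "{i}"] that by simp
    ultimately show False by simp
  qed
  then show ?thesis unfolding ell_ball_def using assms by auto
qed

lemma ell_ball_mono:
  assumes "ell_ball \<kappa> I B b" "J \<subseteq> I" "B \<le> B'" "\<And>i. i \<in> J \<Longrightarrow> 0 \<le> c i" "\<And>i. i \<in> J \<Longrightarrow> c i \<le> b i"
  shows "ell_ball \<kappa> J B' c"
  unfolding ell_ball_def
proof (intro conjI allI impI ballI)
  show "0 \<le> B'" using ell_ballD(1)[OF assms(1)] assms(3) by simp
next
  fix i assume "i \<in> J"
  then show "0 \<le> c i" using assms by auto
  show "c i \<le> B'" using ell_ballD(3)[OF assms(1), of i] assms(2,3) assms(5)[OF \<open>i \<in> J\<close>] \<open>i \<in> J\<close> by auto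
next
  fix F assume *: "\<kappa> > 0" "finite F" "F \<subseteq> J"
  have "(\<Sum>i\<in>F. c i powr (1/\<kappa>)) \<le> (\<Sum>i\<in>F. b i powr (1/\<kappa>))"
    using * assms by (intro sum_mono powr_mono2) auto
  also have "\<dots> \<le> B powr (1/\<kappa>)"
    using * assms(2) by (intro ell_ballD(4)[OF assms(1)]) auto
  also have "\<dots> \<le> B' powr (1/\<kappa>)"
    using * assms(3) ell_ballD(1)[OF assms(1)] by (intro powr_mono2) auto
  finally show "(\<Sum>i\<in>F. c i powr (1/\<kappa>)) \<le> B' powr (1/\<kappa>)" .
qed

lemma ell_ball_scale:
  assumes "ell_ball \<kappa> I B b" "0 \<le> c"
  shows "ell_ball \<kappa> I (c * B) (\<lambda>i. c * b i)"
  unfolding ell_ball_def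
proof (intro conjI allI impI ballI)
  fix F assume *: "\<kappa> > 0" "finite F" "F \<subseteq> I"
  have "(\<Sum>i\<in>F. (c * b i) powr (1/\<kappa>)) = c powr (1/\<kappa>) * (\<Sum>i\<in>F. b i powr (1/\<kappa>))"
    unfolding sum_distrib_left using * assms ell_ballD(2)[OF assms(1)]
    by (intro sum.cong refl powr_mult)
  also have "\<dots> \<le> c powr (1/\<kappa>) * B powr (1/\<kappa>)"
    using * by (intro mult_left_mono ell_ballD(4)[OF assms(1)]) auto
  also have "\<dots> = (c * B) powr (1/\<kappa>)"
    using assms ell_ballD(1)[OF assms(1)] by (intro powr_mult[symmetric])
  finally show "(\<Sum>i\<in>F. (c * b i) powr (1/\<kappa>)) \<le> (c * B) powr (1/\<kappa>)" .
qed (use assms ell_ballD[OF assms(1)] in \<open>auto intro: mult_left_mono\<close>)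

text \<open>
  From \<open>b + c \<le> 2 max b c\<close>.  The constant is not sharp, but it holds for all exponents at once, and
  only equivalence of norms is at stake.
\<close>

lemma ell_ball_add:
  assumes b: "ell_ball \<kappa> I B b" and c: "ell_ball \<kappa> I C c" and "\<kappa> \<le> 1"
  shows "ell_ball \<kappa> I (4 * (B + C)) (\<lambda>i. b i + c i)"
  unfolding ell_ball_def
proof (intro conjI allI impI ballI)
  have BC: "0 \<le> B" "0 \<le> C" using ell_ballD(1)[OF b] ell_ballD(1)[OF c] by auto
  then show "0 \<le> 4 * (B + C)" by simp
  fix i assume i: "i \<in> I"
  show "0 \<le> b i + c i" "b i + c i \<le> 4 * (B + C)"
    using ell_ballD(2,3)[OF b i] ell_ballD(2,3)[OF c i] BC by auto
next
  fix F assume *: "\<kappa> > 0" "finite F" "F \<subseteq> I"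
  define s where "s = 1/\<kappa>"
  have s: "s \<ge> 1" using * assms(3) by (simp add: s_def)
  have BC: "0 \<le> B" "0 \<le> C" using ell_ballD(1)[OF b] ell_ballD(1)[OF c] by auto
  have pt: "(b i + c i) powr s \<le> 2 powr s * (b i powr s + c i powr s)" if "i \<in> F" for i
  proof -
    have nn: "0 \<le> b i" "0 \<le> c i" using that * ell_ballD(2)[OF b] ell_ballD(2)[OF c] by auto
    have "(b i + c i) powr s \<le> (2 * max (b i) (c i)) powr s"
      using nn s by (intro powr_mono2) auto
    also have "\<dots> = 2 powr s * max (b i) (c i) powr s"
      using nn by (intro powr_mult)
    also have "\<dots> \<le> 2 powr s * (b i powr s + c i powr s)"
      by (intro mult_left_mono) (auto simp: max_def)
    finally show ?thesis .
  qed
  have "(\<Sum>i\<in>F. (b i + c i) powr s) \<le> 2 powr s * ((\<Sum>i\<in>F. b i powr s) + (\<Sum>i\<in>F. c i powr s))"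
    unfolding sum_distrib_left sum.distrib[symmetric] by (intro sum_mono pt)
  also have "\<dots> \<le> 2 powr s * (B powr s + C powr s)"
    unfolding s_def using * by (intro mult_left_mono add_mono ell_ballD(4)[OF b] ell_ballD(4)[OF c]) auto
  also have "\<dots> \<le> 2 powr s * ((B + C) powr s + (B + C) powr s)"
    using BC s by (intro mult_left_mono add_mono powr_mono2) auto
  also have "\<dots> = 2 powr s * 2 powr 1 * (B + C) powr s"
    by simp
  also have "\<dots> \<le> 2 powr s * 2 powr s * (B + C) powr s"
    using s by (intro mult_right_mono mult_left_mono powr_mono) auto
  also have "\<dots> = (4 * (B + C)) powr s"
    using BC by (simp add: powr_mult flip: powr_mult)
  finally show "(\<Sum>i\<in>F. (b i + c i) powr (1/\<kappa>)) \<le> (4 * (B + C)) powr (1/\<kappa>)"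
    unfolding s_def .
qed

lemma ell_ball_indicator:
  assumes "ell_ball \<kappa> J B b" "J \<subseteq> I"
  shows "ell_ball \<kappa> I B (\<lambda>i. if i \<in> J then b i else 0)"
  unfolding ell_ball_def
proof (intro conjI allI impI ballI)
  fix F assume *: "\<kappa> > 0" "finite F" "F \<subseteq> I"
  have "(\<Sum>i\<in>F. (if i \<in> J then b i else 0) powr (1/\<kappa>)) = (\<Sum>i\<in>F \<inter> J. b i powr (1/\<kappa>))"
    using * by (intro sum.mono_neutral_cong_right) auto
  also have "\<dots> \<le> B powr (1/\<kappa>)"
    using * by (intro ell_ballD(4)[OF assms(1)]) auto
  finally show "(\<Sum>i\<in>F. (if i \<in> J then b i else 0) powr (1/\<kappa>)) \<le> B powr (1/\<kappa>)" .
qed (use ell_ballD[OF assms(1)] in auto)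

lemma ell_ball_split:
  assumes "ell_ball \<kappa> (I - J) B b" "ell_ball \<kappa> (I \<inter> J) C b" "\<kappa> \<le> 1"
  shows "ell_ball \<kappa> I (4 * (B + C)) b"
proof -
  have "ell_ball \<kappa> I (4 * (B + C))
      (\<lambda>i. (if i \<in> I - J then b i else 0) + (if i \<in> I \<inter> J then b i else 0))"
    by (intro ell_ball_add ell_ball_indicator assms) auto
  then show ?thesis
    by (rule ell_ball_mono) (use ell_ballD(2)[OF assms(1)] ell_ballD(2)[OF assms(2)] in auto)
qed

text \<open>
  Hoelder's inequality: the exponent dual to \<open>\<kappa>\<close> is \<open>1 - \<kappa>\<close>.  Strictly between the endpoints it follows
  from Young's inequality for the normalised entries.
\<close>

lemma ell_ball_Holder:
  assumes b: "ell_ball \<kappa> I B b" and c: "ell_ball (1 - \<kappa>) I C c"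
    and \<kappa>: "0 \<le> \<kappa>" "\<kappa> \<le> 1" and F: "finite F" "F \<subseteq> I"
  shows "(\<Sum>i\<in>F. b i * c i) \<le> B * C"
proof -
  have BC: "0 \<le> B" "0 \<le> C" using ell_ballD(1)[OF b] ell_ballD(1)[OF c] by auto
  have nn: "0 \<le> b i" "0 \<le> c i" if "i \<in> F" for i
    using that F ell_ballD(2)[OF b] ell_ballD(2)[OF c] by auto
  have le: "b i \<le> B" "c i \<le> C" if "i \<in> F" for i
    using that F ell_ballD(3)[OF b] ell_ballD(3)[OF c] by auto
  consider "\<kappa> = 0" | "\<kappa> = 1" | "B = 0 \<or> C = 0" | "0 < \<kappa>" "\<kappa> < 1" "B > 0" "C > 0"
    using \<kappa> BC by linarith
  then show ?thesis
  proof cases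
    case 1
    have "(\<Sum>i\<in>F. b i * c i) \<le> (\<Sum>i\<in>F. B * c i)"
      using nn le by (intro sum_mono mult_right_mono) auto
    also have "\<dots> = B * (\<Sum>i\<in>F. c i)" by (simp add: sum_distrib_left)
    also have "\<dots> \<le> B * C"
      using ell_ballD(4)[OF c _ F] 1 BC nn by (intro mult_left_mono) auto
    finally show ?thesis .
  next
    case 2
    have "(\<Sum>i\<in>F. b i * c i) \<le> (\<Sum>i\<in>F. b i * C)"
      using nn le by (intro sum_mono mult_left_mono) auto
    also have "\<dots> = (\<Sum>i\<in>F. b i) * C" by (simp add: sum_distrib_right)
    also have "\<dots> \<le> B * C"
      using ell_ballD(4)[OF b _ F] 2 BC nn by (intro mult_right_mono) auto
    finally show ?thesis .
  next
    case 3
    then have "b i * c i = 0" if "i \<in> F" for i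
      using nn[OF that] le[OF that] by auto
    then have "(\<Sum>i\<in>F. b i * c i) = 0" by (intro sum.neutral) blast
    then show ?thesis using 3 by auto
  next
    case 4
    have Y: "b i * c i \<le> B * C * (\<kappa> * (b i powr (1/\<kappa>) / B powr (1/\<kappa>))
              + (1 - \<kappa>) * (c i powr (1/(1-\<kappa>)) / C powr (1/(1-\<kappa>))))" if "i \<in> F" for i
    proof -
      have "(b i / B) * (c i / C) \<le> (b i / B) powr (1/\<kappa>) / (1/\<kappa>) + (c i / C) powr (1/(1-\<kappa>)) / (1/(1-\<kappa>))"
        using 4 nn[OF that] by (intro Youngs_inequality) auto
      then have "(b i / B) * (c i / C) \<le> \<kappa> * (b i powr (1/\<kappa>) / B powr (1/\<kappa>))
              + (1 - \<kappa>) * (c i powr (1/(1-\<kappa>)) / C powr (1/(1-\<kappa>)))"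
        using nn[OF that] 4 by (simp add: powr_divide mult.commute)
      then have "B * C * ((b i / B) * (c i / C)) \<le> B * C * (\<kappa> * (b i powr (1/\<kappa>) / B powr (1/\<kappa>))
              + (1 - \<kappa>) * (c i powr (1/(1-\<kappa>)) / C powr (1/(1-\<kappa>))))"
        using 4 by (intro mult_left_mono) auto
      then show ?thesis using 4 by simp
    qed
    have "(\<Sum>i\<in>F. b i * c i) \<le> (\<Sum>i\<in>F. B * C * (\<kappa> * (b i powr (1/\<kappa>) / B powr (1/\<kappa>))
              + (1 - \<kappa>) * (c i powr (1/(1-\<kappa>)) / C powr (1/(1-\<kappa>)))))"
      by (intro sum_mono Y)
    also have "\<dots> = B * C * (\<kappa> * ((\<Sum>i\<in>F. b i powr (1/\<kappa>)) / B powr (1/\<kappa>))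
              + (1 - \<kappa>) * ((\<Sum>i\<in>F. c i powr (1/(1-\<kappa>))) / C powr (1/(1-\<kappa>))))"
      by (simp only: sum_divide_distrib sum_distrib_left sum.distrib distrib_left)
    also have "\<dots> \<le> B * C * (\<kappa> * 1 + (1 - \<kappa>) * 1)"
      using 4 ell_ballD(4)[OF b _ F] ell_ballD(4)[OF c _ F]
      by (intro mult_left_mono add_mono) (auto simp: divide_le_eq_1)
    finally show ?thesis by simp
  qed
qed

text \<open>
  Order continuity of the norm at \<open>b\<close>.  For \<open>\<kappa> = 0\<close> this singles out \<open>c\<^sub>0\<close> in \<open>l\<^sup>\<infinity>\<close>; for \<open>\<kappa> > 0\<close> it holds
  on every ball.
\<close>

definition ell_tail_small :: "real \<Rightarrow> 'i set \<Rightarrow> ('i \<Rightarrow> real) \<Rightarrow> bool" where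
  "ell_tail_small \<kappa> I b \<longleftrightarrow> (\<forall>\<epsilon>>0. \<exists>J. finite J \<and> J \<subseteq> I \<and> ell_ball \<kappa> (I - J) \<epsilon> b)"

text \<open>
  Choose a finite set whose partial sum almost attains the supremum of all partial sums.
\<close>

lemma ell_ball_imp_tail_small:
  assumes b: "ell_ball \<kappa> I B b" and \<kappa>: "\<kappa> > 0"
  shows "ell_tail_small \<kappa> I b"
  unfolding ell_tail_small_def
proof (intro allI impI)
  fix \<epsilon> :: real assume \<epsilon>: "\<epsilon> > 0"
  define S where "S = {(\<Sum>i\<in>F. b i powr (1/\<kappa>)) | F. finite F \<and> F \<subseteq> I}"
  have bdd: "bdd_above S"
    using ell_ballD(4)[OF b \<kappa>] unfolding S_def bdd_above_def by blast
  have ne: "S \<noteq> {}" unfolding S_def by blast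
  have "Sup S - \<epsilon> powr (1/\<kappa>) < Sup S" using \<epsilon> by simp
  then obtain x where "x \<in> S" "Sup S - \<epsilon> powr (1/\<kappa>) < x"
    using less_cSup_iff[OF ne bdd] by blast
  then obtain J where J: "finite J" "J \<subseteq> I" "Sup S - \<epsilon> powr (1/\<kappa>) < (\<Sum>i\<in>J. b i powr (1/\<kappa>))"
    unfolding S_def by blast
  have "ell_ball \<kappa> (I - J) \<epsilon> b"
  proof (rule ell_ballI_sum[OF \<kappa>])
    fix F assume F: "finite F" "F \<subseteq> I - J"
    have "(\<Sum>i\<in>F. b i powr (1/\<kappa>)) + (\<Sum>i\<in>J. b i powr (1/\<kappa>)) = (\<Sum>i\<in>F \<union> J. b i powr (1/\<kappa>))"
      using F J by (intro sum.union_disjoint[symmetric]) auto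
    also have "\<dots> \<le> Sup S"
      using F J by (intro cSup_upper[OF _ bdd]) (auto simp: S_def)
    finally show "(\<Sum>i\<in>F. b i powr (1/\<kappa>)) \<le> \<epsilon> powr (1/\<kappa>)" using J(3) by linarith
  qed (use \<epsilon> ell_ballD[OF b] in auto)
  then show "\<exists>J. finite J \<and> J \<subseteq> I \<and> ell_ball \<kappa> (I - J) \<epsilon> b" using J by blast
qed

lemma ell_ball_finite:
  assumes "finite J" "\<delta> > 0" "0 \<le> \<kappa>"
  shows "\<exists>\<eta>>0. \<forall>b. (\<forall>i\<in>J. 0 \<le> b i \<and> b i \<le> \<eta>) \<longrightarrow> ell_ball \<kappa> J \<delta> b"
proof (cases "\<kappa> = 0")
  case True
  then show ?thesis using assms by (intro exI[of _ \<delta>]) (auto simp: ell_ball_def)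
next
  case False
  then have \<kappa>: "\<kappa> > 0" using assms by simp
  define \<eta> where "\<eta> = (\<delta> powr (1/\<kappa>) / (real (card J) + 1)) powr \<kappa>"
  have \<eta>: "\<eta> > 0" unfolding \<eta>_def using assms by simp
  have \<eta>': "\<eta> powr (1/\<kappa>) = \<delta> powr (1/\<kappa>) / (real (card J) + 1)"
    unfolding \<eta>_def using \<kappa> assms by (simp add: powr_powr)
  have "ell_ball \<kappa> J \<delta> b" if b: "\<forall>i\<in>J. 0 \<le> b i \<and> b i \<le> \<eta>" for b
  proof (rule ell_ballI_sum[OF \<kappa>])
    fix F assume F: "finite F" "F \<subseteq> J"
    have "(\<Sum>i\<in>F. b i powr (1/\<kappa>)) \<le> (\<Sum>i\<in>F. \<eta> powr (1/\<kappa>))"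
      using b F \<kappa> by (intro sum_mono powr_mono2) auto
    also have "\<dots> = real (card F) * \<eta> powr (1/\<kappa>)" by simp
    also have "\<dots> \<le> (real (card J) + 1) * \<eta> powr (1/\<kappa>)"
      using card_mono[OF assms(1) F(2)] by (intro mult_right_mono) auto
    also have "\<dots> = \<delta> powr (1/\<kappa>)" unfolding \<eta>' by (simp add: field_simps)
    finally show "(\<Sum>i\<in>F. b i powr (1/\<kappa>)) \<le> \<delta> powr (1/\<kappa>)" .
  qed (use assms b in auto)
  then show ?thesis using \<eta> by blast
qed

text \<open>
  Dominated convergence: since \<open>\<omega>\<close> is bounded, the tails of \<open>b \<cdot> \<omega>\<close> are small uniformly in \<open>w\<close>, and on the
  remaining finitely many indices \<open>\<omega>\<close> tends to \<open>0\<close>.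
\<close>

lemma ell_ball_dominated:
  assumes b: "ell_tail_small \<kappa> I b" and bnn: "\<And>i. i \<in> I \<Longrightarrow> 0 \<le> b i"
    and \<kappa>: "0 \<le> \<kappa>" "\<kappa> \<le> 1"
    and \<omega>: "eventually (\<lambda>w. \<forall>i\<in>I. 0 \<le> \<omega> w i \<and> \<omega> w i \<le> C) F"
    and lim: "\<And>i. i \<in> I \<Longrightarrow> ((\<lambda>w. \<omega> w i) \<longlongrightarrow> 0) F"
    and \<epsilon>: "\<epsilon> > 0"
  shows "eventually (\<lambda>w. ell_ball \<kappa> I \<epsilon> (\<lambda>i. b i * \<omega> w i)) F"
proof -
  define D where "D = max C 1"
  have D: "D > 0" "C \<le> D" by (auto simp: D_def)
  obtain J where J: "finite J" "J \<subseteq> I" "ell_ball \<kappa> (I - J) (\<epsilon>/8/D) b"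
    using b \<epsilon> D unfolding ell_tail_small_def by (meson divide_pos_pos zero_less_numeral)
  obtain \<eta> where \<eta>: "\<eta> > 0" "\<And>c. (\<forall>i\<in>J. 0 \<le> c i \<and> c i \<le> \<eta>) \<Longrightarrow> ell_ball \<kappa> J (\<epsilon>/8) c"
    using ell_ball_finite[OF J(1), of "\<epsilon>/8" \<kappa>] \<kappa> \<epsilon> by auto
  have "eventually (\<lambda>w. b i * \<omega> w i < \<eta>) F" if "i \<in> J" for i
  proof -
    have "((\<lambda>w. b i * \<omega> w i) \<longlongrightarrow> b i * 0) F"
      using that J by (intro tendsto_mult_left lim) auto
    then show ?thesis using \<eta>(1) by (auto dest: order_tendstoD(2))
  qed
  then have "eventually (\<lambda>w. \<forall>i\<in>J. b i * \<omega> w i < \<eta>) F"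
    using J(1) by (simp add: eventually_ball_finite)
  then show ?thesis using \<omega>
  proof eventually_elim
    case (elim w)
    have 1: "ell_ball \<kappa> (I - J) (\<epsilon>/8) (\<lambda>i. b i * \<omega> w i)"
    proof (rule ell_ball_mono[OF ell_ball_scale[OF J(3), of D]])
      fix i assume "i \<in> I - J"
      then have "0 \<le> \<omega> w i" "\<omega> w i \<le> D" "0 \<le> b i" using elim D bnn by force+
      then have "\<omega> w i * b i \<le> D * b i" by (intro mult_right_mono)
      then show "b i * \<omega> w i \<le> D * b i" by (simp add: mult.commute)
    qed (use D elim bnn in auto)
    have 2: "ell_ball \<kappa> J (\<epsilon>/8) (\<lambda>i. b i * \<omega> w i)"
      using elim bnn J by (intro \<eta>) (meson less_imp_le mult_nonneg_nonneg subsetD)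
    have "ell_ball \<kappa> I (4 * (\<epsilon>/8 + \<epsilon>/8)) (\<lambda>i. b i * \<omega> w i)"
      by (rule ell_ball_split[OF 1]) (use 2 J \<kappa> in \<open>auto simp: Int_absorb1\<close>)
    then show ?case by simp
  qed
qed

section \<open>Mixed norms and factorization\<close>

text \<open>
  The ball of \<open>l\<^sup>s(K; l\<^sup>t)\<close> with \<open>\<kappa> = 1/s\<close>, \<open>\<rho> = 1/t\<close>.  The inner norms are only asked to have a majorant
  \<open>b\<close>, so that they never have to be computed.
\<close>

definition mixed_ball :: "real \<Rightarrow> real \<Rightarrow> 'k set \<Rightarrow> real \<Rightarrow> ('k \<Rightarrow> 'n \<Rightarrow> real) \<Rightarrow> bool" where
  "mixed_ball \<kappa> \<rho> K B s \<longleftrightarrow>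
     (\<exists>b. ell_ball \<kappa> K B b \<and> (\<forall>k\<in>K. ell_ball \<rho> UNIV (b k) (s k)))"

lemma mixed_ball_mono:
  assumes "mixed_ball \<kappa> \<rho> K B s" "B \<le> B'"
    and "\<And>k n. k \<in> K \<Longrightarrow> 0 \<le> t k n" "\<And>k n. k \<in> K \<Longrightarrow> t k n \<le> s k n"
  shows "mixed_ball \<kappa> \<rho> K B' t"
proof -
  obtain b where b: "ell_ball \<kappa> K B b" "\<forall>k\<in>K. ell_ball \<rho> UNIV (b k) (s k)"
    using assms(1) unfolding mixed_ball_def by blast
  have "ell_ball \<kappa> K B' b"
    by (rule ell_ball_mono[OF b(1)]) (use assms(2) ell_ballD[OF b(1)] in auto)
  moreover have "ell_ball \<rho> UNIV (b k) (t k)" if "k \<in> K" for k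
    by (rule ell_ball_mono[OF b(2)[rule_format, OF that]]) (use assms that in auto)
  ultimately show ?thesis unfolding mixed_ball_def by blast
qed

lemma mixed_ball_scale:
  assumes "mixed_ball \<kappa> \<rho> K B s" "0 \<le> c"
  shows "mixed_ball \<kappa> \<rho> K (c * B) (\<lambda>k n. c * s k n)"
  proof -
  obtain b where b: "ell_ball \<kappa> K B b" "\<forall>k\<in>K. ell_ball \<rho> UNIV (b k) (s k)"
    using assms(1) unfolding mixed_ball_def by blast
  have "ell_ball \<kappa> K (c * B) (\<lambda>k. c * b k)" by (rule ell_ball_scale[OF b(1) assms(2)])
  moreover have "\<forall>k\<in>K. ell_ball \<rho> UNIV (c * b k) (\<lambda>n. c * s k n)"
    using b(2) assms(2) by (auto intro: ell_ball_scale)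
  ultimately show ?thesis unfolding mixed_ball_def by (intro exI[of _ "\<lambda>k. c * b k"]) auto
qed

lemma mixed_ball_prod:
  assumes "ell_ball \<kappa> K B \<beta>" "\<And>k. k \<in> K \<Longrightarrow> ell_ball \<rho> UNIV 1 (\<tau> k)"
  shows "mixed_ball \<kappa> \<rho> K B (\<lambda>k n. \<beta> k * \<tau> k n)"
proof -
  have "ell_ball \<rho> UNIV (\<beta> k) (\<lambda>n. \<beta> k * \<tau> k n)" if "k \<in> K" for k
    using ell_ball_scale[OF assms(2)[OF that], of "\<beta> k"] ell_ballD(2)[OF assms(1) that] by simp
  then show ?thesis using assms(1) unfolding mixed_ball_def by blast
qed

text \<open>
  Up to a small error the norm is carried by finitely many outer indices, and in each of them
  dominated convergence applies to the inner sequence.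
\<close>

lemma mixed_ball_dominated:
  assumes \<beta>: "ell_tail_small \<kappa> K \<beta>" "\<And>k. k \<in> K \<Longrightarrow> 0 \<le> \<beta> k"
    and \<tau>: "\<And>k. k \<in> K \<Longrightarrow> ell_ball \<rho> UNIV 1 (\<tau> k)"
    and \<kappa>: "0 \<le> \<kappa>" "\<kappa> \<le> 1" and \<rho>: "0 < \<rho>" "\<rho> \<le> 1"
    and \<omega>: "eventually (\<lambda>w. \<forall>k\<in>K. \<forall>n. 0 \<le> \<omega> w k n \<and> \<omega> w k n \<le> C) F"
    and lim: "\<And>k n. k \<in> K \<Longrightarrow> ((\<lambda>w. \<omega> w k n) \<longlongrightarrow> 0) F"
    and \<epsilon>: "\<epsilon> > 0"
  shows "eventually (\<lambda>w. mixed_ball \<kappa> \<rho> K \<epsilon> (\<lambda>k n. \<beta> k * \<tau> k n * \<omega> w k n)) F"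
proof -
  define D where "D = max C 1"
  have D: "D > 0" "C \<le> D" by (auto simp: D_def)
  obtain J where J: "finite J" "J \<subseteq> K" "ell_ball \<kappa> (K - J) (\<epsilon>/8/D) \<beta>"
    using \<beta> \<epsilon> D unfolding ell_tail_small_def by (meson divide_pos_pos zero_less_numeral)
  obtain \<eta> where \<eta>: "\<eta> > 0" "\<And>c. (\<forall>i\<in>J. 0 \<le> c i \<and> c i \<le> \<eta>) \<Longrightarrow> ell_ball \<kappa> J (\<epsilon>/8) c"
    using ell_ball_finite[OF J(1), of "\<epsilon>/8" \<kappa>] \<kappa> \<epsilon> by auto
  define M where "M = (\<Sum>k\<in>J. \<beta> k) + 1"
  have M: "M > 0" "\<And>k. k \<in> J \<Longrightarrow> \<beta> k \<le> M"
  proof -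
    have nn: "\<And>k. k \<in> J \<Longrightarrow> 0 \<le> \<beta> k" using J \<beta> by auto
    show "M > 0" unfolding M_def using sum_nonneg[of J \<beta>] nn by fastforce
    fix k assume "k \<in> J"
    then have "\<beta> k \<le> (\<Sum>k\<in>J. \<beta> k)" using J(1) nn by (intro member_le_sum) auto
    then show "\<beta> k \<le> M" by (simp add: M_def)
  qed
  have "eventually (\<lambda>w. ell_ball \<rho> UNIV (\<eta>/M) (\<lambda>n. \<tau> k n * \<omega> w k n)) F" if k: "k \<in> J" for k
  proof (rule ell_ball_dominated[where C = C])
    have kK: "k \<in> K" using k J by auto
    show "ell_tail_small \<rho> UNIV (\<tau> k)" using \<tau>[OF kK] \<rho>(1) by (rule ell_ball_imp_tail_small)
    show "\<And>i. 0 \<le> \<tau> k i" using ell_ballD(2)[OF \<tau>[OF kK]] by simp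
    show "eventually (\<lambda>w. \<forall>i\<in>UNIV. 0 \<le> \<omega> w k i \<and> \<omega> w k i \<le> C) F"
      using \<omega> by eventually_elim (use kK in auto)
    show "\<And>i. ((\<lambda>w. \<omega> w k i) \<longlongrightarrow> 0) F" using lim[OF kK] .
  qed (use \<rho> \<eta> M in auto)
  then have "eventually (\<lambda>w. \<forall>k\<in>J. ell_ball \<rho> UNIV (\<eta>/M) (\<lambda>n. \<tau> k n * \<omega> w k n)) F"
    using J(1) by (simp add: eventually_ball_finite)
  then show ?thesis using \<omega>
  proof eventually_elim
    case (elim w)
    define b where "b = (\<lambda>k. if k \<in> J then \<beta> k * (\<eta>/M) else D * \<beta> k)"
    have 1: "ell_ball \<kappa> (K - J) (\<epsilon>/8) b"
      by (rule ell_ball_mono[OF ell_ball_scale[OF J(3), of D]]) (use D \<beta> in \<open>auto simp: b_def\<close>)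
    have 2: "ell_ball \<kappa> J (\<epsilon>/8) b"
    proof (intro \<eta> ballI conjI)
      fix i assume i: "i \<in> J"
      show "0 \<le> b i" using i J \<beta> \<eta> M by (auto simp: b_def)
      have "\<beta> i * (\<eta>/M) \<le> M * (\<eta>/M)" using i M \<eta> by (intro mult_right_mono) auto
      then show "b i \<le> \<eta>" using i M by (simp add: b_def)
    qed
    have "ell_ball \<kappa> K (4 * (\<epsilon>/8 + \<epsilon>/8)) b"
      by (rule ell_ball_split[OF 1]) (use 2 J \<kappa> in \<open>auto simp: Int_absorb1\<close>)
    then have b: "ell_ball \<kappa> K \<epsilon> b" by simp
    have "ell_ball \<rho> UNIV (b k) (\<lambda>n. \<beta> k * \<tau> k n * \<omega> w k n)" if k: "k \<in> K" for k
    proof (cases "k \<in> J")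
      case True
      then show ?thesis
        using ell_ball_scale[OF elim(1)[rule_format, OF True], of "\<beta> k"] \<beta>(2)[OF k]
        by (simp add: b_def mult_ac)
    next
      case False
      show ?thesis
      proof (rule ell_ball_mono[OF ell_ball_scale[OF \<tau>[OF k], of "D * \<beta> k"]])
        fix n
        have nn: "0 \<le> \<tau> k n" "0 \<le> \<omega> w k n" "\<omega> w k n \<le> D" "0 \<le> \<beta> k"
          using ell_ballD(2)[OF \<tau>[OF k]] elim(2) k D(2) \<beta>(2)[OF k] order_trans[OF _ D(2)] by auto
        then show "0 \<le> \<beta> k * \<tau> k n * \<omega> w k n" by simp
        have "\<beta> k * \<tau> k n * \<omega> w k n \<le> \<beta> k * \<tau> k n * D" using nn by (intro mult_left_mono) auto
        then show "\<beta> k * \<tau> k n * \<omega> w k n \<le> D * \<beta> k * \<tau> k n" by (simp add: mult_ac)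
      qed (use False D \<beta> k in \<open>auto simp: b_def\<close>)
    qed
    then show ?case using b unfolding mixed_ball_def by blast
  qed
qed

text \<open>
  Take for \<open>T k\<close> the tail \<open>x k + x (k+1) + \<dots>\<close>.  As \<open>x k = T k - T (k+1)\<close>, the quotient \<open>x k / sqrt (T k)\<close> is at
  most \<open>2 (sqrt (T k) - sqrt (T (k+1)))\<close>, and the sum telescopes.  So a summable sequence stays
  summable after division by a sequence that tends to \<open>0\<close>.
\<close>

lemma tail_majorant:
  fixes x :: "int \<Rightarrow> real"
  assumes x: "ell_ball 1 {m..} 1 x"
  obtains T where "\<And>k. k \<ge> m \<Longrightarrow> 0 \<le> T k" "\<And>k. k \<ge> m \<Longrightarrow> T k \<le> 1" "\<And>k. k \<ge> m \<Longrightarrow> x k \<le> T k"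
    "\<And>F. finite F \<Longrightarrow> F \<subseteq> {m..} \<Longrightarrow> (\<Sum>k\<in>F. x k / sqrt (T k)) \<le> 2"
    "\<And>\<epsilon>. \<epsilon> > 0 \<Longrightarrow> \<exists>J. finite J \<and> J \<subseteq> {m..} \<and> (\<forall>k\<in>{m..} - J. T k \<le> \<epsilon>)"
proof -
  have nn: "0 \<le> x k" if "k \<ge> m" for k using ell_ballD(2)[OF x] that by auto
  have S: "(\<Sum>k\<in>F. x k) \<le> 1" if "finite F" "F \<subseteq> {m..}" for F
  proof -
    have "(\<Sum>k\<in>F. x k) = (\<Sum>k\<in>F. x k powr (1/1))"
      using that nn by (intro sum.cong) auto
    then show ?thesis using ell_ballD(4)[OF x _ that] by simp
  qed
  have summ: "x summable_on {k..}" if "k \<ge> m" for k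
  proof (rule nonneg_bdd_above_summable_on)
    show "bdd_above (sum x ` {F. F \<subseteq> {k..} \<and> finite F})"
      unfolding bdd_above_def
    proof (intro exI[of _ 1] ballI)
      fix y assume "y \<in> sum x ` {F. F \<subseteq> {k..} \<and> finite F}"
      then obtain F where F: "y = sum x F" "F \<subseteq> {k..}" "finite F" by blast
      then have "F \<subseteq> {m..}" using that by (meson atLeast_subset_iff subset_trans)
      then show "y \<le> 1" using S F by simp
    qed
  qed (use nn that in auto)
  define T where "T = (\<lambda>k. infsum x {k..})"
  have step: "T k = x k + T (k + 1)" if "k \<ge> m" for k
  proof -
    have eq: "{k..} = insert k {k+1..}" by auto
    show ?thesis unfolding T_def eq
      using summ[of "k+1"] that by (subst infsum_insert) auto
  qed
  have T0: "0 \<le> T k" if "k \<ge> m" for k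
    unfolding T_def using nn that by (intro infsum_nonneg) auto
  have T1: "T k \<le> B" if "k \<ge> m" "\<And>F. finite F \<Longrightarrow> F \<subseteq> {k..} \<Longrightarrow> (\<Sum>k\<in>F. x k) \<le> B" for k B
    unfolding T_def using that summ by (intro infsum_le_finite_sums) auto
  have T_le_1: "T k \<le> 1" if k: "k \<ge> m" for k
  proof (rule T1[OF k])
    fix F assume "finite F" "F \<subseteq> {k..}"
    moreover from this have "F \<subseteq> {m..}" using k by (meson atLeast_subset_iff subset_trans)
    ultimately show "(\<Sum>k\<in>F. x k) \<le> 1" by (intro S)
  qed
  show ?thesis
  proof (rule that[of T])
    show "0 \<le> T k" if "k \<ge> m" for k using T0[OF that] .
    show "T k \<le> 1" if "k \<ge> m" for k using T_le_1[OF that] .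
    show "x k \<le> T k" if "k \<ge> m" for k using step[OF that] T0[of "k+1"] that by simp
  next
    fix F assume F: "finite F" "F \<subseteq> {m..}"
    have pt: "x k / sqrt (T k) \<le> 2 * sqrt (T k) - 2 * sqrt (T (k + 1))" if "k \<ge> m" for k
    proof (cases "T k = 0")
      case True
      then show ?thesis using step[OF that] T0[of "k+1"] T0[of k] nn[OF that] that by auto
    next
      case False
      define a b where "a = sqrt (T k)" and "b = sqrt (T (k + 1))"
      have ab: "a > 0" "b \<ge> 0" "a\<^sup>2 = T k" "b\<^sup>2 = T (k+1)"
        using False T0[of k] T0[of "k+1"] that by (auto simp: a_def b_def)
      have "x k = a\<^sup>2 - b\<^sup>2" using step[OF that] ab by simp
      also have "\<dots> \<le> (2 * a - 2 * b) * a"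
        using zero_le_power2[of "a - b"] by (simp add: power2_eq_square algebra_simps)
      finally have "x k / a \<le> 2 * a - 2 * b" using ab by (simp add: divide_le_eq)
      then show ?thesis by (simp add: a_def b_def)
    qed
    have tel: "(\<Sum>k\<in>{m..<m + int j}. x k / sqrt (T k)) \<le> 2 * sqrt (T m) - 2 * sqrt (T (m + int j))" for j
    proof (induction j)
      case (Suc j)
      have "{m..<m + int (Suc j)} = insert (m + int j) {m..<m + int j}" by auto
      then have 1: "(\<Sum>k\<in>{m..<m + int (Suc j)}. x k / sqrt (T k))
          = x (m + int j) / sqrt (T (m + int j)) + (\<Sum>k\<in>{m..<m + int j}. x k / sqrt (T k))"
        by (simp del: of_nat_Suc)
      have "m + int (Suc j) = m + int j + 1" by simp
      then have 2: "T (m + int (Suc j)) = T (m + int j + 1)" by (rule arg_cong)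
      show ?case unfolding 1 2 using Suc pt[of "m + int j"] by simp
    qed simp
    obtain j where j: "F \<subseteq> {m..<m + int j}"
    proof (cases "F = {}")
      case False
      have "F \<subseteq> {m..<m + int (nat (Max F - m + 1))}"
      proof
        fix k assume "k \<in> F"
        then have "k \<le> Max F" "m \<le> k" using F by auto
        then show "k \<in> {m..<m + int (nat (Max F - m + 1))}" by auto
      qed
      then show ?thesis by (rule that)
    qed (use that in auto)
    have "(\<Sum>k\<in>F. x k / sqrt (T k)) \<le> (\<Sum>k\<in>{m..<m + int j}. x k / sqrt (T k))"
      using j nn T0 by (intro sum_mono2) auto
    also have "\<dots> \<le> 2 * sqrt (T m) - 2 * sqrt (T (m + int j))" by (rule tel)
    also have "\<dots> \<le> 2 * sqrt 1 - 0"
    proof (intro diff_mono mult_left_mono real_sqrt_le_mono)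
      show "T m \<le> 1" by (rule T_le_1) simp
    qed (use T0 in auto)
    finally show "(\<Sum>k\<in>F. x k / sqrt (T k)) \<le> 2" by simp
  next
    fix \<epsilon> :: real assume \<epsilon>: "\<epsilon> > 0"
    have "ell_tail_small 1 {m..} x" using x by (rule ell_ball_imp_tail_small) simp
    then obtain J where J: "finite J" "J \<subseteq> {m..}" "ell_ball 1 ({m..} - J) \<epsilon> x"
      using \<epsilon> unfolding ell_tail_small_def by blast
    define J' where "J' = {m..Max (insert m J)}"
    have "T k \<le> \<epsilon>" if "k \<in> {m..} - J'" for k
    proof (rule T1)
      fix F assume F: "finite F" "F \<subseteq> {k..}"
      have "F \<subseteq> {m..} - J"
      proof
        fix i assume "i \<in> F"
        then have i: "i \<ge> k" using F by auto
        have k: "k \<ge> m" "k > Max (insert m J)" using that by (auto simp: J'_def)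
        have "i \<notin> J"
        proof
          assume "i \<in> J"
          then have "i \<le> Max (insert m J)" using J(1) by simp
          then show False using i k by linarith
        qed
        then show "i \<in> {m..} - J" using i k by auto
      qed
      have "(\<Sum>k\<in>F. x k) = (\<Sum>k\<in>F. x k powr (1/1))"
        using \<open>F \<subseteq> {m..} - J\<close> nn by (intro sum.cong) auto
      then show "(\<Sum>k\<in>F. x k) \<le> \<epsilon>" using ell_ballD(4)[OF J(3) _ F(1) \<open>F \<subseteq> {m..} - J\<close>] \<epsilon> by simp
    qed (use that in auto)
    then show "\<exists>J. finite J \<and> J \<subseteq> {m..} \<and> (\<forall>k\<in>{m..} - J. T k \<le> \<epsilon>)"
      by (intro exI[of _ J']) (auto simp: J'_def)
  qed
qed

text \<open>
  The obvious factor in \<open>l\<^sup>\<infinity>\<close> is the constant \<open>1\<close>, which is not in \<open>c\<^sub>0\<close>.  Therefore a small power of the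
  tails of \<open>x powr (1/\<kappa>)\<close> is moved from \<open>\<beta>1\<close> to \<open>\<beta>0\<close>: the factor \<open>\<beta>0\<close> then tends to \<open>0\<close>, and \<open>\<beta>1\<close> remains in its
  ball by the majorant above.
\<close>

lemma ell_ball_factorization_endpoint:
  fixes x :: "int \<Rightarrow> real"
  assumes x: "ell_ball \<kappa> {m..} 1 x" and \<theta>: "0 < \<theta>" "\<theta> < 1"
    and \<kappa>1: "0 < \<kappa>1" "\<kappa>1 \<le> 1" and \<kappa>: "\<kappa> = \<theta> * \<kappa>1"
  obtains \<beta>0 \<beta>1 where "ell_ball 0 {m..} 2 \<beta>0" "ell_ball \<kappa>1 {m..} 2 \<beta>1" "ell_tail_small 0 {m..} \<beta>0"
    "\<And>k. k \<ge> m \<Longrightarrow> x k = \<beta>0 k powr (1 - \<theta>) * \<beta>1 k powr \<theta>"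
    "\<And>k. k \<ge> m \<Longrightarrow> x k > 0 \<Longrightarrow> \<beta>0 k > 0 \<and> \<beta>1 k > 0"
proof -
  have \<kappa>0: "\<kappa> > 0" using \<theta> \<kappa>1 \<kappa> by simp
  define X where "X = (\<lambda>k. x k powr (1/\<kappa>))"
  have nn: "0 \<le> x k" if "k \<ge> m" for k using ell_ballD(2)[OF x] that by auto
  have "ell_ball 1 {m..} 1 X"
    by (rule ell_ballI_sum) (use ell_ballD(4)[OF x \<kappa>0] in \<open>auto simp: X_def\<close>)
  then obtain T where
    T: "\<And>k. k \<ge> m \<Longrightarrow> 0 \<le> T k" "\<And>k. k \<ge> m \<Longrightarrow> T k \<le> 1" "\<And>k. k \<ge> m \<Longrightarrow> X k \<le> T k"
    "\<And>F. finite F \<Longrightarrow> F \<subseteq> {m..} \<Longrightarrow> (\<Sum>k\<in>F. X k / sqrt (T k)) \<le> 2"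
    "\<And>\<epsilon>. \<epsilon> > 0 \<Longrightarrow> \<exists>J. finite J \<and> J \<subseteq> {m..} \<and> (\<forall>k\<in>{m..} - J. T k \<le> \<epsilon>)"
    by (rule tail_majorant) (rule that; assumption)
  \<comment> \<open>Then \<open>\<beta>0 powr (1 - \<theta>)\<close> is \<open>T powr (\<kappa>/2)\<close>, the factor that is split off.\<close>
  define a where "a = \<kappa> / (2 * (1 - \<theta>))"
  have a: "a > 0" using \<theta> \<kappa>0 by (simp add: a_def)
  define \<beta>0 where "\<beta>0 = (\<lambda>k. T k powr a)"
  define \<beta>1 where "\<beta>1 = (\<lambda>k. (X k / sqrt (T k)) powr \<kappa>1)"
  show ?thesis
  proof (rule that[of \<beta>0 \<beta>1])
    have "T k powr a \<le> 2" if "k \<ge> m" for k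
      using powr_mono2[OF less_imp_le[OF a] T(1)[OF that] T(2)[OF that]] by simp
    then show "ell_ball 0 {m..} 2 \<beta>0"
      unfolding ell_ball_def \<beta>0_def by auto
    show "ell_ball \<kappa>1 {m..} 2 \<beta>1"
    proof (rule ell_ballI_sum[OF \<kappa>1(1)])
      fix F assume F: "finite F" "F \<subseteq> {m..}"
      have "(\<Sum>k\<in>F. \<beta>1 k powr (1/\<kappa>1)) = (\<Sum>k\<in>F. X k / sqrt (T k))"
        using F T(1) \<kappa>1 by (intro sum.cong) (auto simp: \<beta>1_def powr_powr X_def)
      also have "\<dots> \<le> 2 powr 1" using T(4)[OF F] by simp
      also have "\<dots> \<le> 2 powr (1/\<kappa>1)" using \<kappa>1 by (intro powr_mono) auto
      finally show "(\<Sum>k\<in>F. \<beta>1 k powr (1/\<kappa>1)) \<le> 2 powr (1/\<kappa>1)" .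
    qed (auto simp: \<beta>1_def)
    show "ell_tail_small 0 {m..} \<beta>0"
      unfolding ell_tail_small_def
    proof (intro allI impI)
      fix \<epsilon> :: real assume \<epsilon>: "\<epsilon> > 0"
      obtain J where J: "finite J" "J \<subseteq> {m..}" "\<forall>k\<in>{m..} - J. T k \<le> \<epsilon> powr (1/a)"
        using T(5)[of "\<epsilon> powr (1/a)"] \<epsilon> by auto
      have "\<beta>0 k \<le> \<epsilon>" if "k \<in> {m..} - J" for k
      proof -
        have "\<beta>0 k \<le> (\<epsilon> powr (1/a)) powr a"
          unfolding \<beta>0_def using a J(3) T(1) that by (intro powr_mono2) auto
        then show ?thesis using a \<epsilon> by (simp add: powr_powr)
      qed
      then have "ell_ball 0 ({m..} - J) \<epsilon> \<beta>0"
        using \<epsilon> by (auto simp: ell_ball_def \<beta>0_def)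
      then show "\<exists>J. finite J \<and> J \<subseteq> {m..} \<and> ell_ball 0 ({m..} - J) \<epsilon> \<beta>0" using J by blast
    qed
  next
    fix k assume k: "k \<ge> m"
    show "x k = \<beta>0 k powr (1 - \<theta>) * \<beta>1 k powr \<theta>"
    proof (cases "x k = 0")
      case True
      then show ?thesis by (simp add: \<beta>1_def X_def)
    next
      case False
      then have xk: "x k > 0" using nn[OF k] by simp
      then have X: "X k > 0" by (simp add: X_def)
      then have Tk: "T k > 0" using T(3)[OF k] by simp
      have "a * (1 - \<theta>) = \<kappa>/2" using \<theta> by (simp add: a_def field_simps)
      then have "\<beta>0 k powr (1 - \<theta>) = T k powr (\<kappa>/2)"
        by (simp only: \<beta>0_def powr_powr)
      moreover have "\<beta>1 k powr \<theta> = X k powr \<kappa> / T k powr (\<kappa>/2)"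
        using X Tk by (simp add: \<beta>1_def powr_powr \<kappa> mult.commute powr_divide powr_half_sqrt[symmetric])
      moreover have "X k powr \<kappa> = x k" using xk \<kappa>0 by (simp add: X_def powr_powr)
      ultimately show ?thesis using Tk by simp
    qed
    show "\<beta>0 k > 0 \<and> \<beta>1 k > 0" if "x k > 0"
    proof -
      have X: "X k > 0" using that by (simp add: X_def)
      then have "T k > 0" using T(3)[OF k] by simp
      then show ?thesis using X by (simp add: \<beta>0_def \<beta>1_def)
    qed
  qed
qed

text \<open>
  The Calderon product of two sequence spaces, with both factors order continuous.  The hypothesis
  \<open>\<kappa> > 0\<close> says that the two exponents are not both infinite; without it a nonzero constant sequence
  would have to be a product of null sequences.
\<close>

lemma ell_ball_factorization:
  fixes x :: "int \<Rightarrow> real"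
  assumes x: "ell_ball \<kappa> {m..} 1 x" and \<theta>: "0 < \<theta>" "\<theta> < 1"
    and \<kappa>0: "0 \<le> \<kappa>0" "\<kappa>0 \<le> 1" and \<kappa>1: "0 \<le> \<kappa>1" "\<kappa>1 \<le> 1"
    and \<kappa>: "\<kappa> = (1 - \<theta>) * \<kappa>0 + \<theta> * \<kappa>1" "\<kappa> > 0"
  obtains \<beta>0 \<beta>1 where "ell_ball \<kappa>0 {m..} 2 \<beta>0" "ell_ball \<kappa>1 {m..} 2 \<beta>1"
    "ell_tail_small \<kappa>0 {m..} \<beta>0" "ell_tail_small \<kappa>1 {m..} \<beta>1"
    "\<And>k. k \<ge> m \<Longrightarrow> x k = \<beta>0 k powr (1 - \<theta>) * \<beta>1 k powr \<theta>"
    "\<And>k. k \<ge> m \<Longrightarrow> x k > 0 \<Longrightarrow> \<beta>0 k > 0 \<and> \<beta>1 k > 0"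
proof -
  consider "\<kappa>0 = 0" "\<kappa>1 > 0" | "\<kappa>1 = 0" "\<kappa>0 > 0" | "\<kappa>0 > 0" "\<kappa>1 > 0"
    using \<kappa> \<kappa>0 \<kappa>1 by fastforce
  then show ?thesis
  proof cases
    case 1
    obtain \<beta>0 \<beta>1 where "ell_ball 0 {m..} 2 \<beta>0" "ell_ball \<kappa>1 {m..} 2 \<beta>1" "ell_tail_small 0 {m..} \<beta>0"
    "\<And>k. k \<ge> m \<Longrightarrow> x k = \<beta>0 k powr (1 - \<theta>) * \<beta>1 k powr \<theta>"
    "\<And>k. k \<ge> m \<Longrightarrow> x k > 0 \<Longrightarrow> \<beta>0 k > 0 \<and> \<beta>1 k > 0"
      using ell_ball_factorization_endpoint[OF x \<theta> 1(2) \<kappa>1(2)] \<kappa>(1) 1(1) by auto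
    then show ?thesis using 1 ell_ball_imp_tail_small by (intro that[of \<beta>0 \<beta>1]) blast+
  next
    case 2
    have \<theta>': "0 < 1 - \<theta>" "1 - \<theta> < 1" using \<theta> by auto
    obtain \<beta>0 \<beta>1 where "ell_ball 0 {m..} 2 \<beta>0" "ell_ball \<kappa>0 {m..} 2 \<beta>1" "ell_tail_small 0 {m..} \<beta>0"
    "\<And>k. k \<ge> m \<Longrightarrow> x k = \<beta>0 k powr (1 - (1 - \<theta>)) * \<beta>1 k powr (1 - \<theta>)"
    "\<And>k. k \<ge> m \<Longrightarrow> x k > 0 \<Longrightarrow> \<beta>0 k > 0 \<and> \<beta>1 k > 0"
      using ell_ball_factorization_endpoint[OF x \<theta>' 2(2) \<kappa>0(2)] \<kappa>(1) 2(1) by auto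
    then show ?thesis using 2 ell_ball_imp_tail_small
      by (intro that[of \<beta>1 \<beta>0]) (auto simp: mult.commute)
  next
    case 3
    define \<beta> where "\<beta> = (\<lambda>l k. x k powr (l/\<kappa>))"
    have nn: "0 \<le> x k" if "k \<ge> m" for k using ell_ballD(2)[OF x] that by auto
    have ball: "ell_ball l {m..} 2 (\<beta> l)" if l: "l > 0" for l
    proof (rule ell_ballI_sum[OF l])
      fix F assume F: "finite F" "F \<subseteq> {m..}"
      have "(\<Sum>i\<in>F. \<beta> l i powr (1/l)) = (\<Sum>i\<in>F. x i powr (1/\<kappa>))"
        using l by (intro sum.cong) (auto simp: \<beta>_def powr_powr)
      also have "\<dots> \<le> 1" using ell_ballD(4)[OF x \<kappa>(2) F] by simp
      also have "\<dots> \<le> 2 powr (1/l)" using l by (intro ge_one_powr_ge_zero) auto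
      finally show "(\<Sum>i\<in>F. \<beta> l i powr (1/l)) \<le> 2 powr (1/l)" .
    qed (auto simp: \<beta>_def)
    show ?thesis
    proof (rule that[of "\<beta> \<kappa>0" "\<beta> \<kappa>1"])
      fix k assume k: "k \<ge> m"
      have "\<beta> \<kappa>0 k powr (1 - \<theta>) * \<beta> \<kappa>1 k powr \<theta> = x k powr (\<kappa>0/\<kappa> * (1 - \<theta>) + \<kappa>1/\<kappa> * \<theta>)"
        by (simp add: \<beta>_def powr_powr powr_add)
      also have "\<kappa>0/\<kappa> * (1 - \<theta>) + \<kappa>1/\<kappa> * \<theta> = \<kappa> / \<kappa>"
        by (subst (3) \<kappa>(1)) (simp add: add_divide_distrib mult.commute)
      also have "x k powr (\<kappa> / \<kappa>) = x k" using \<kappa> nn[OF k] by simp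
      finally show "x k = \<beta> \<kappa>0 k powr (1 - \<theta>) * \<beta> \<kappa>1 k powr \<theta>" by simp
    qed (use 3 ball ell_ball_imp_tail_small[OF ball] in \<open>auto simp: \<beta>_def\<close>)
  qed
qed

text \<open>
  After division by their norms, the sequences \<open>b powr (1/\<kappa>)\<close> and \<open>y k powr (1/\<rho>)\<close> have sum at most
  \<open>1\<close>.  Hence their powers with exponents \<open>1 - \<kappa>0\<close> and \<open>1 - \<rho>0\<close> are unit vectors of the dual spaces, and
  Hoelder's inequality applies first in \<open>n\<close> and then in \<open>k\<close>.
\<close>

lemma mixed_dual_weight:
  fixes y :: "'k \<Rightarrow> 'n \<Rightarrow> real"
  assumes fin: "finite K" "finite N" and y: "\<And>k n. 0 \<le> y k n"
    and \<kappa>: "\<kappa> > 0" and \<rho>: "\<rho> > 0"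
    and \<kappa>0: "0 \<le> \<kappa>0" "\<kappa>0 \<le> 1" and \<rho>0: "0 \<le> \<rho>0" "\<rho>0 < 1"
    and b: "\<And>k. b k = (\<Sum>n\<in>N. y k n powr (1/\<rho>)) powr \<rho>"
    and Y: "Y = (\<Sum>k\<in>K. b k powr (1/\<kappa>)) powr \<kappa>"
    and v: "mixed_ball \<kappa>0 \<rho>0 K B v"
  shows "(\<Sum>k\<in>K. \<Sum>n\<in>N. (if y k n = 0 then 0 else (b k / Y) powr ((1-\<kappa>0)/\<kappa>) * (y k n / b k) powr ((1-\<rho>0)/\<rho>)) * v k n) \<le> B"
proof -
  obtain c where c: "ell_ball \<kappa>0 K B c" "\<forall>k\<in>K. ell_ball \<rho>0 UNIV (c k) (v k)"
    using v unfolding mixed_ball_def by blast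
  have b0: "0 \<le> b k" for k by (simp add: b)
  have Y0: "0 \<le> Y" by (simp add: Y)
  define t where "t = (\<lambda>k n. (y k n / b k) powr ((1-\<rho>0)/\<rho>))"
  have t: "ell_ball (1-\<rho>0) N 1 (t k)" for k
  proof (rule ell_ballI_sum)
    fix F assume F: "finite F" "F \<subseteq> N"
    have S0: "0 \<le> (\<Sum>n\<in>N. y k n powr (1/\<rho>))" by (intro sum_nonneg) auto
    have "(\<Sum>n\<in>F. t k n powr (1/(1-\<rho>0))) = (\<Sum>n\<in>F. y k n powr (1/\<rho>) / b k powr (1/\<rho>))"
      unfolding t_def using \<rho>0 y b0 by (intro sum.cong) (auto simp: powr_powr powr_divide)
    also have "\<dots> = (\<Sum>n\<in>F. y k n powr (1/\<rho>)) / (\<Sum>n\<in>N. y k n powr (1/\<rho>))"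
      using \<rho> S0 by (simp add: sum_divide_distrib b powr_powr)
    also have "\<dots> \<le> 1"
      using S0 sum_mono2[OF fin(2) F(2), of "\<lambda>n. y k n powr (1/\<rho>)"] by (auto simp: divide_le_eq_1)
    finally show "(\<Sum>n\<in>F. t k n powr (1/(1-\<rho>0))) \<le> 1 powr (1/(1-\<rho>0))" by simp
  qed (use \<rho>0 in \<open>auto simp: t_def\<close>)
  define s where "s = (\<lambda>k. (b k / Y) powr ((1-\<kappa>0)/\<kappa>))"
  have bY: "(\<Sum>k\<in>F. b k powr (1/\<kappa>)) \<le> Y powr (1/\<kappa>)" if "F \<subseteq> K" for F
  proof -
    have S0: "0 \<le> (\<Sum>k\<in>K. b k powr (1/\<kappa>))" by (intro sum_nonneg) auto
    have "(\<Sum>k\<in>F. b k powr (1/\<kappa>)) \<le> (\<Sum>k\<in>K. b k powr (1/\<kappa>))"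
      using fin(1) that by (intro sum_mono2) auto
    then show ?thesis using \<kappa> S0 by (simp add: Y powr_powr)
  qed
  have s: "ell_ball (1-\<kappa>0) K 1 s"
  proof (cases "\<kappa>0 = 1")
    case True
    then show ?thesis by (auto simp: ell_ball_def s_def)
  next
    case False
    show ?thesis
    proof (rule ell_ballI_sum)
      fix F assume F: "finite F" "F \<subseteq> K"
      have "(\<Sum>n\<in>F. s n powr (1/(1-\<kappa>0))) = (\<Sum>n\<in>F. b n powr (1/\<kappa>) / Y powr (1/\<kappa>))"
        unfolding s_def using \<kappa>0 b0 Y0 False by (intro sum.cong) (auto simp: powr_powr powr_divide)
      also have "\<dots> = (\<Sum>n\<in>F. b n powr (1/\<kappa>)) / Y powr (1/\<kappa>)"
        by (simp add: sum_divide_distrib)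
      also have "\<dots> \<le> 1" using bY[OF F(2)] by (auto simp: divide_le_eq_1)
      finally show "(\<Sum>n\<in>F. s n powr (1/(1-\<kappa>0))) \<le> 1 powr (1/(1-\<kappa>0))" by simp
    qed (use False \<kappa>0 in \<open>auto simp: s_def\<close>)
  qed
  have "(\<Sum>k\<in>K. \<Sum>n\<in>N. (if y k n = 0 then 0 else s k * t k n) * v k n) \<le> (\<Sum>k\<in>K. c k * s k)"
  proof (rule sum_mono)
    fix k assume k: "k \<in> K"
    have vk: "ell_ball \<rho>0 N (c k) (v k)"
      by (rule ell_ball_mono[OF c(2)[rule_format, OF k]]) (use ell_ballD(2)[OF c(2)[rule_format, OF k]] in auto)
    have "(\<Sum>n\<in>N. (if y k n = 0 then 0 else s k * t k n) * v k n) \<le> (\<Sum>n\<in>N. s k * (v k n * t k n))"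
      using ell_ballD(2)[OF vk] by (intro sum_mono) (auto simp: mult_ac s_def t_def)
    also have "\<dots> = s k * (\<Sum>n\<in>N. v k n * t k n)" by (simp add: sum_distrib_left)
    also have "\<dots> \<le> s k * (c k * 1)"
      by (intro mult_left_mono ell_ball_Holder[OF vk t]) (use \<rho>0 fin in \<open>auto simp: s_def\<close>)
    finally show "(\<Sum>n\<in>N. (if y k n = 0 then 0 else s k * t k n) * v k n) \<le> c k * s k"
      by (simp add: mult_ac)
  qed
  also have "\<dots> \<le> B * 1" by (intro ell_ball_Holder[OF c(1) s]) (use \<kappa>0 fin in auto)
  finally show ?thesis unfolding s_def t_def by simp
qed

text \<open>
  With the inner norms \<open>b k\<close> and the norm \<open>Y\<close> of \<open>y\<close>, the norming functional of \<open>y\<close> is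
  \<open>(b k / Y) powr ((1-\<kappa>)/\<kappa>) * (y k n / b k) powr ((1-\<rho>)/\<rho>)\<close>.  Its exponents are affine in \<open>(\<kappa>, \<rho>)\<close> apart from
  the common denominators, so it is the product of powers of the functionals \<open>e0\<close>, \<open>e1\<close> that have
  \<open>\<kappa>0, \<rho>0\<close> and \<open>\<kappa>1, \<rho>1\<close> in the numerators; each of these lies in the dual ball of its endpoint.
\<close>

lemma mixed_dual_factorization:
  fixes y :: "'k \<Rightarrow> 'n \<Rightarrow> real"
  assumes fin: "finite K" "finite N" and y: "\<And>k n. 0 \<le> y k n"
    and \<theta>: "0 < \<theta>" "\<theta> < 1"
    and \<kappa>0: "0 \<le> \<kappa>0" "\<kappa>0 \<le> 1" and \<kappa>1: "0 \<le> \<kappa>1" "\<kappa>1 \<le> 1"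
    and \<kappa>: "\<kappa> = (1 - \<theta>) * \<kappa>0 + \<theta> * \<kappa>1" "\<kappa> > 0"
    and \<rho>0: "0 < \<rho>0" "\<rho>0 < 1" and \<rho>1: "0 < \<rho>1" "\<rho>1 < 1"
    and \<rho>: "\<rho> = (1 - \<theta>) * \<rho>0 + \<theta> * \<rho>1"
  obtains e0 e1 where "\<And>k n. 0 \<le> e0 k n" "\<And>k n. 0 \<le> e1 k n"
    "(\<Sum>k\<in>K. \<Sum>n\<in>N. y k n * (e0 k n powr (1 - \<theta>) * e1 k n powr \<theta>)) =
       (\<Sum>k\<in>K. (\<Sum>n\<in>N. y k n powr (1/\<rho>)) powr (\<rho>/\<kappa>)) powr \<kappa>"
    "\<And>B v. mixed_ball \<kappa>0 \<rho>0 K B v \<Longrightarrow> (\<Sum>k\<in>K. \<Sum>n\<in>N. e0 k n * v k n) \<le> B"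
    "\<And>B v. mixed_ball \<kappa>1 \<rho>1 K B v \<Longrightarrow> (\<Sum>k\<in>K. \<Sum>n\<in>N. e1 k n * v k n) \<le> B"
    "\<And>k n. y k n = 0 \<Longrightarrow> e0 k n = 0 \<and> e1 k n = 0"
proof -
  have \<rho>p: "\<rho> > 0" using \<theta> \<rho>0 \<rho>1 \<rho> by (simp add: add_pos_pos)
  define b where "b = (\<lambda>k. (\<Sum>n\<in>N. y k n powr (1/\<rho>)) powr \<rho>)"
  define Y where "Y = (\<Sum>k\<in>K. b k powr (1/\<kappa>)) powr \<kappa>"
  define e where "e = (\<lambda>l \<sigma> k n. if y k n = 0 then 0 else
     (b k / Y) powr ((1-l)/\<kappa>) * (y k n / b k) powr ((1-\<sigma>)/\<rho>))"
  have b0: "0 \<le> b k" for k by (simp add: b_def)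
  have Y0: "0 \<le> Y" by (simp add: Y_def)
  have bpow: "b k powr (1/\<rho>) = (\<Sum>n\<in>N. y k n powr (1/\<rho>))" for k
    using \<rho>p sum_nonneg[of N "\<lambda>n. y k n powr (1/\<rho>)"] by (simp add: b_def powr_powr)
  have Ypow: "Y powr (1/\<kappa>) = (\<Sum>k\<in>K. b k powr (1/\<kappa>))"
    using \<kappa> sum_nonneg[of K "\<lambda>k. b k powr (1/\<kappa>)"] by (simp add: Y_def powr_powr)
  have trm: "y k n * (e \<kappa>0 \<rho>0 k n powr (1 - \<theta>) * e \<kappa>1 \<rho>1 k n powr \<theta>)
      = (b k / Y) powr ((1-\<kappa>)/\<kappa>) * (y k n powr (1/\<rho>) / b k powr ((1-\<rho>)/\<rho>))" if "n \<in> N" for k n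
  proof (cases "y k n = 0")
    case False
    then have yp: "y k n > 0" using y[of k n] by simp
    have ex1: "(1-\<kappa>0)/\<kappa> * (1-\<theta>) + (1-\<kappa>1)/\<kappa> * \<theta> = (1-\<kappa>)/\<kappa>"
    proof -
      have "(1-\<kappa>0) * (1-\<theta>) + (1-\<kappa>1) * \<theta> = 1 - \<kappa>" by (simp add: \<kappa>(1) algebra_simps)
      then show ?thesis by (metis add_divide_distrib times_divide_eq_left)
    qed
    have ex2: "(1-\<rho>0)/\<rho> * (1-\<theta>) + (1-\<rho>1)/\<rho> * \<theta> = (1-\<rho>)/\<rho>"
    proof -
      have "(1-\<rho>0) * (1-\<theta>) + (1-\<rho>1) * \<theta> = 1 - \<rho>" by (simp add: \<rho> algebra_simps)
      then show ?thesis by (metis add_divide_distrib times_divide_eq_left)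
    qed
    have "e \<kappa>0 \<rho>0 k n powr (1 - \<theta>) * e \<kappa>1 \<rho>1 k n powr \<theta>
        = (b k / Y) powr ((1-\<kappa>0)/\<kappa> * (1-\<theta>) + (1-\<kappa>1)/\<kappa> * \<theta>)
          * (y k n / b k) powr ((1-\<rho>0)/\<rho> * (1-\<theta>) + (1-\<rho>1)/\<rho> * \<theta>)"
      using False by (simp add: e_def powr_mult powr_powr powr_add)
    also have "\<dots> = (b k / Y) powr ((1-\<kappa>)/\<kappa>) * (y k n / b k) powr ((1-\<rho>)/\<rho>)"
      unfolding ex1 ex2 ..
    finally have "y k n * (e \<kappa>0 \<rho>0 k n powr (1 - \<theta>) * e \<kappa>1 \<rho>1 k n powr \<theta>)
        = (b k / Y) powr ((1-\<kappa>)/\<kappa>) * (y k n powr 1 * y k n powr ((1-\<rho>)/\<rho>) / b k powr ((1-\<rho>)/\<rho>))"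
      using yp b0 by (simp add: powr_divide)
    also have "y k n powr 1 * y k n powr ((1-\<rho>)/\<rho>) = y k n powr (1/\<rho>)"
      unfolding powr_add[symmetric] using \<rho>p by (simp add: field_simps)
    finally show ?thesis .
  qed (simp add: e_def)
  have inner: "(\<Sum>n\<in>N. (b k / Y) powr ((1-\<kappa>)/\<kappa>) * (y k n powr (1/\<rho>) / b k powr ((1-\<rho>)/\<rho>)))
      = b k powr (1/\<kappa>) / Y powr ((1-\<kappa>)/\<kappa>)" for k
  proof (cases "b k = 0")
    case False
    then have bp: "b k > 0" using b0[of k] by simp
    have "(\<Sum>n\<in>N. (b k / Y) powr ((1-\<kappa>)/\<kappa>) * (y k n powr (1/\<rho>) / b k powr ((1-\<rho>)/\<rho>)))
       = (b k / Y) powr ((1-\<kappa>)/\<kappa>) * (b k powr (1/\<rho>) / b k powr ((1-\<rho>)/\<rho>))"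
      unfolding bpow sum_divide_distrib sum_distrib_left ..
    also have "b k powr (1/\<rho>) / b k powr ((1-\<rho>)/\<rho>) = b k powr 1"
      unfolding powr_diff[symmetric] using \<rho>p by (simp add: field_simps)
    also have "(b k / Y) powr ((1-\<kappa>)/\<kappa>) * b k powr 1 = b k powr ((1-\<kappa>)/\<kappa> + 1) / Y powr ((1-\<kappa>)/\<kappa>)"
      using bp Y0 by (simp add: powr_divide powr_add)
    also have "(1-\<kappa>)/\<kappa> + 1 = 1/\<kappa>" using \<kappa> by (simp add: field_simps)
    finally show ?thesis .
  qed simp
  have "(\<Sum>k\<in>K. \<Sum>n\<in>N. y k n * (e \<kappa>0 \<rho>0 k n powr (1 - \<theta>) * e \<kappa>1 \<rho>1 k n powr \<theta>))
     = (\<Sum>k\<in>K. b k powr (1/\<kappa>) / Y powr ((1-\<kappa>)/\<kappa>))"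
    unfolding inner[symmetric] by (intro sum.cong refl trm)
  also have "\<dots> = Y powr (1/\<kappa>) / Y powr ((1-\<kappa>)/\<kappa>)"
    unfolding Ypow sum_divide_distrib ..
  also have "\<dots> = Y powr (1/\<kappa> - (1-\<kappa>)/\<kappa>)" by (simp add: powr_diff)
  also have "1/\<kappa> - (1-\<kappa>)/\<kappa> = 1" using \<kappa> by (simp add: field_simps)
  finally have eq: "(\<Sum>k\<in>K. \<Sum>n\<in>N. y k n * (e \<kappa>0 \<rho>0 k n powr (1 - \<theta>) * e \<kappa>1 \<rho>1 k n powr \<theta>)) = Y"
    using Y0 by simp
  show ?thesis
  proof (rule that[of "e \<kappa>0 \<rho>0" "e \<kappa>1 \<rho>1"])
    show "(\<Sum>k\<in>K. \<Sum>n\<in>N. y k n * (e \<kappa>0 \<rho>0 k n powr (1 - \<theta>) * e \<kappa>1 \<rho>1 k n powr \<theta>)) =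
       (\<Sum>k\<in>K. (\<Sum>n\<in>N. y k n powr (1/\<rho>)) powr (\<rho>/\<kappa>)) powr \<kappa>"
      unfolding eq by (simp add: Y_def b_def powr_powr)
  next
    fix B and v :: "'k \<Rightarrow> 'n \<Rightarrow> real" assume v: "mixed_ball \<kappa>0 \<rho>0 K B v"
    show "(\<Sum>k\<in>K. \<Sum>n\<in>N. e \<kappa>0 \<rho>0 k n * v k n) \<le> B"
      unfolding e_def
      by (rule mixed_dual_weight[OF fin y \<kappa>(2) \<rho>p \<kappa>0 _ _ _ _ v]) (use \<rho>0 in \<open>auto simp: b_def Y_def\<close>)
  next
    fix B and v :: "'k \<Rightarrow> 'n \<Rightarrow> real" assume v: "mixed_ball \<kappa>1 \<rho>1 K B v"
    show "(\<Sum>k\<in>K. \<Sum>n\<in>N. e \<kappa>1 \<rho>1 k n * v k n) \<le> B"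
      unfolding e_def
      by (rule mixed_dual_weight[OF fin y \<kappa>(2) \<rho>p \<kappa>1 _ _ _ _ v]) (use \<rho>1 in \<open>auto simp: b_def Y_def\<close>)
  qed (auto simp: e_def)
qed

section \<open>The decreasing rearrangement at dyadic points\<close>

lemma epowr_ennreal [simp]: "0 \<le> x \<Longrightarrow> epowr (ennreal x) s = ennreal (x powr s)"
  by (simp add: epowr_def)

lemma epowr_mono: "0 < s \<Longrightarrow> x \<le> y \<Longrightarrow> epowr x s \<le> epowr y s"
  by (cases x; cases y) (auto simp: epowr_def top_unique intro!: powr_mono2)

lemma epowr_mult_ennreal:
  assumes "0 < c" "0 < s"
  shows "epowr (ennreal c * x) s = ennreal (c powr s) * epowr x s"
proof (cases x)
  case (real r)
  then show ?thesis using assms by (simp add: powr_mult flip: ennreal_mult)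
next
  case top
  then show ?thesis using assms by (simp add: epowr_def ennreal_mult_top)
qed

lemma epowr_le_ennreal_iff:
  assumes "0 < s" "0 \<le> V"
  shows "epowr x s \<le> ennreal V \<longleftrightarrow> x \<le> ennreal (V powr (1/s))"
proof (cases x)
  case (real r)
  have "r powr s \<le> V \<longleftrightarrow> r \<le> V powr (1/s)"
  proof
    assume "r powr s \<le> V"
    then have "(r powr s) powr (1/s) \<le> V powr (1/s)" using assms by (intro powr_mono2) auto
    then show "r \<le> V powr (1/s)" using assms real by (simp add: powr_powr)
  next
    assume "r \<le> V powr (1/s)"
    then have "r powr s \<le> (V powr (1/s)) powr s" using assms real by (intro powr_mono2) auto
    then show "r powr s \<le> V" using assms by (simp add: powr_powr)
  qed
  then show ?thesis using real assms by simp
qed (use assms in \<open>simp add: epowr_def top_unique\<close>)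

lemma superlevel_sets:
  assumes "A \<in> sets lebesgue" "f \<in> borel_measurable (lebesgue_on A)"
  shows "{x\<in>A. l < cmod (f x)} \<in> sets lebesgue" "{x\<in>A. cmod (f x) \<le> l} \<in> sets lebesgue"
proof -
  have "{x \<in> space (lebesgue_on A). l < cmod (f x)} \<in> sets (lebesgue_on A)"
    "{x \<in> space (lebesgue_on A). cmod (f x) \<le> l} \<in> sets (lebesgue_on A)"
    using assms(2) by measurable
  then show "{x\<in>A. l < cmod (f x)} \<in> sets lebesgue" "{x\<in>A. cmod (f x) \<le> l} \<in> sets lebesgue"
    using assms(1) by (auto simp: sets_restrict_space_iff)
qed

lemma dr_antimono:
  assumes "s \<le> t"
  shows "decreasing_rearrangement A f t \<le> decreasing_rearrangement A f s"
  unfolding decreasing_rearrangement_def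
  by (rule Inf_superset_mono) (use assms ennreal_leI[OF assms] in \<open>auto intro: order_trans\<close>)

text \<open>
  The rearrangement is the generalised inverse of the distribution function.  The direction from
  left to right uses that \<open>{|f| > l}\<close> is the increasing union of the superlevel sets above \<open>l\<close>.
\<close>

lemma dr_le_iff:
  assumes A: "A \<in> sets lebesgue" and f: "f \<in> borel_measurable (lebesgue_on A)" and l: "0 \<le> l"
  shows "decreasing_rearrangement A f t \<le> ennreal l \<longleftrightarrow>
    emeasure lebesgue {x\<in>A. l < cmod (f x)} \<le> ennreal t"
proof
  assume le: "decreasing_rearrangement A f t \<le> ennreal l"
  define S where "S = (\<lambda>n::nat. {x\<in>A. l + 1 / real (Suc n) < cmod (f x)})"
  have "emeasure lebesgue (S n) \<le> ennreal t" for n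
  proof -
    have "decreasing_rearrangement A f t < ennreal (l + 1 / real (Suc n))"
      using le by (rule order.strict_trans1) (use l in \<open>simp add: ennreal_lessI\<close>)
    then obtain l' where l': "0 < l'" "emeasure lebesgue {x\<in>A. l' < cmod (f x)} \<le> ennreal t"
      "ennreal l' < ennreal (l + 1 / real (Suc n))"
      unfolding decreasing_rearrangement_def Inf_less_iff by blast
    then have "l' < l + 1 / real (Suc n)" using l by (subst (asm) ennreal_less_iff) auto
    then have "S n \<subseteq> {x\<in>A. l' < cmod (f x)}" by (auto simp: S_def)
    then have "emeasure lebesgue (S n) \<le> emeasure lebesgue {x\<in>A. l' < cmod (f x)}"
      by (intro emeasure_mono superlevel_sets A f)
    then show ?thesis using l'(2) by (rule order_trans)
  qed
  moreover have "{x\<in>A. l < cmod (f x)} = (\<Union>n. S n)"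
  proof -
    have "\<exists>n. l + 1 / real (Suc n) < c" if "l < c" for c
      using reals_Archimedean[of "c - l"] that by (auto simp: field_simps)
    moreover have "l < c" if "l + 1 / real (Suc n) < c" for c n
      using that by (rule less_trans[rotated]) simp
    ultimately show ?thesis unfolding S_def by blast
  qed
  moreover have "(SUP n. emeasure lebesgue (S n)) = emeasure lebesgue (\<Union>n. S n)"
  proof (rule SUP_emeasure_incseq)
    show "range S \<subseteq> sets lebesgue" unfolding S_def using superlevel_sets[OF A f] by blast
    show "incseq S"
    proof (rule incseq_SucI)
      fix n
      have "1 / real (Suc (Suc n)) \<le> 1 / real (Suc n)" by (simp add: frac_le)
      then show "S n \<subseteq> S (Suc n)" unfolding S_def by force
    qed
  qed
  ultimately show "emeasure lebesgue {x\<in>A. l < cmod (f x)} \<le> ennreal t"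
    by (metis (mono_tags, lifting) SUP_least)
next
  assume le: "emeasure lebesgue {x\<in>A. l < cmod (f x)} \<le> ennreal t"
  show "decreasing_rearrangement A f t \<le> ennreal l"
  proof (rule ennreal_le_epsilon)
    fix e :: real assume "0 < e"
    have "emeasure lebesgue {x\<in>A. l + e < cmod (f x)} \<le> emeasure lebesgue {x\<in>A. l < cmod (f x)}"
      using \<open>0 < e\<close> by (intro emeasure_mono superlevel_sets A f) auto
    then have "emeasure lebesgue {x\<in>A. l + e < cmod (f x)} \<le> ennreal t"
      using le by (rule order_trans)
    moreover have "0 < l + e" using l \<open>0 < e\<close> by simp
    ultimately have "decreasing_rearrangement A f t \<le> ennreal (l + e)"
      unfolding decreasing_rearrangement_def by (intro Inf_lower) blast
    then show "decreasing_rearrangement A f t \<le> ennreal l + ennreal e"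
      using l \<open>0 < e\<close> by simp
  qed
qed

text \<open>
  Where \<open>|h|\<close> exceeds \<open>a l + b m\<close>, either \<open>|f| > l\<close> or \<open>|g| > m\<close>; the union of these two sets has
  measure at most \<open>2 t\<close>.
\<close>

lemma dr_dominated:
  assumes A: "A \<in> sets lebesgue" and f: "f \<in> borel_measurable (lebesgue_on A)"
    and g: "g \<in> borel_measurable (lebesgue_on A)" and h: "h \<in> borel_measurable (lebesgue_on A)"
    and le: "\<And>x. x \<in> A \<Longrightarrow> cmod (h x) \<le> a * cmod (f x) + b * cmod (g x)"
    and ab: "0 \<le> a" "0 \<le> b" and l: "0 \<le> l" "0 \<le> m" and t: "0 \<le> t"
    and df: "decreasing_rearrangement A f t \<le> ennreal l"
    and dg: "decreasing_rearrangement A g t \<le> ennreal m"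
  shows "decreasing_rearrangement A h (2 * t) \<le> ennreal (a * l + b * m)"
proof -
  let ?F = "{x\<in>A. l < cmod (f x)}" and ?G = "{x\<in>A. m < cmod (g x)}"
  have "{x\<in>A. a * l + b * m < cmod (h x)} \<subseteq> ?F \<union> ?G"
  proof
    fix x assume x: "x \<in> {x\<in>A. a * l + b * m < cmod (h x)}"
    then have "a * l + b * m < a * cmod (f x) + b * cmod (g x)" using le[of x] by simp
    moreover have "a * cmod (f x) + b * cmod (g x) \<le> a * l + b * m"
      if "cmod (f x) \<le> l" "cmod (g x) \<le> m"
      using that ab by (intro add_mono mult_left_mono)
    ultimately have "l < cmod (f x) \<or> m < cmod (g x)" by linarith
    then show "x \<in> ?F \<union> ?G" using x by blast
  qed
  then have "emeasure lebesgue {x\<in>A. a * l + b * m < cmod (h x)} \<le> emeasure lebesgue (?F \<union> ?G)"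
    by (rule emeasure_mono) (intro sets.Un superlevel_sets A f g)
  also have "\<dots> \<le> emeasure lebesgue ?F + emeasure lebesgue ?G"
    by (intro emeasure_subadditive superlevel_sets A f g)
  also have "\<dots> \<le> ennreal t + ennreal t"
    using df dg dr_le_iff[OF A f l(1)] dr_le_iff[OF A g l(2)] by (intro add_mono) auto
  also have "\<dots> = ennreal (2 * t)" using t by (simp flip: ennreal_plus)
  finally show ?thesis using ab l by (subst dr_le_iff[OF A h]) auto
qed

abbreviation dyadic_dr :: "'a::euclidean_space set \<Rightarrow> ('a \<Rightarrow> complex) \<Rightarrow> int \<Rightarrow> ennreal" where
  "dyadic_dr A f n \<equiv> decreasing_rearrangement A f (2 powr real_of_int n)"

text \<open>
  Its \<open>l\<^sup>r\<close> norm is equivalent to the Lorentz norm of \<open>f\<close> with exponents \<open>p\<close>, \<open>r\<close>.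
\<close>

definition dyadic_seq :: "'a::euclidean_space set \<Rightarrow> real \<Rightarrow> ('a \<Rightarrow> complex) \<Rightarrow> int \<Rightarrow> real" where
  "dyadic_seq A p f n = 2 powr (real_of_int n / p) * enn2real (dyadic_dr A f n)"

definition lorentz_lower_const :: "real \<Rightarrow> real \<Rightarrow> real" where
  "lorentz_lower_const p r = (2 * 2 powr (r/p)) powr (1/r)"

lemma lorentz_lower_const_pos: "lorentz_lower_const p r > 0"
  by (simp add: lorentz_lower_const_def)

text \<open>
  On \<open>(2\<^sup>n\<^sup>-\<^sup>1, 2\<^sup>n]\<close> the rearrangement is at least its value at \<open>2\<^sup>n\<close>, so each term of the sum is at most a
  constant times the integral over this interval, and the intervals are disjoint.
\<close>

lemma lorentz_lower:
  assumes p: "0 < p" and r: "0 < r" and V: "0 \<le> V"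
    and norm: "lorentz_norm A p r f \<le> ennreal V"
  shows "ell_ball (1/r) UNIV (lorentz_lower_const p r * V) (dyadic_seq A p f)"
    and "dyadic_dr A f n < \<infinity>"
proof -
  define I where "I = (\<integral>\<^sup>+t\<in>{0<..}. epowr (ennreal (t powr (1/p)) * decreasing_rearrangement A f t) r
                            * ennreal (1/t) \<partial>lborel)"
  define d where "d = (\<lambda>n. dyadic_dr A f n)"
  define J where "J = (\<lambda>n::int. {2 powr real_of_int (n-1)<..2 powr real_of_int n})"
  have "epowr I (1/r) \<le> ennreal V" using norm by (simp add: lorentz_norm_def I_def)
  then have IV: "I \<le> ennreal (V powr r)" using r V by (subst (asm) epowr_le_ennreal_iff) auto
  define g where "g = (\<lambda>n. epowr (d n) r * ennreal (2 powr (real_of_int (n-1) * r / p) * 2 powr (- real_of_int n)))"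
  have disj: "n = m" if "t \<in> J n" "t \<in> J m" for t n m
  proof (rule ccontr)
    assume "n \<noteq> m"
    then have "n \<le> m - 1 \<or> m \<le> n - 1" by linarith
    then have "2 powr real_of_int n \<le> 2 powr real_of_int (m-1) \<or> 2 powr real_of_int m \<le> 2 powr real_of_int (n-1)"
      by (auto simp del: of_int_diff)
    then show False using that unfolding J_def greaterThanAtMost_iff by linarith
  qed
  have main: "(\<Sum>n\<in>F. epowr (d n) r * ennreal (2 powr (real_of_int (n-1) * r / p) / 2)) \<le> ennreal (V powr r)"
    if F: "finite F" for F :: "int set"
  proof -
    have "(\<Sum>n\<in>F. g n * indicator (J n) t) \<le>
        epowr (ennreal (t powr (1/p)) * decreasing_rearrangement A f t) r * ennreal (1/t) * indicator {0<..} t"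
      (is "_ \<le> ?R t") for t
    proof (cases "\<exists>n\<in>F. t \<in> J n")
      case True
      then obtain n where n: "n \<in> F" "t \<in> J n" by blast
      have "(\<Sum>m\<in>F. g m * indicator (J m) t) = (\<Sum>m\<in>{n}. g m * indicator (J m) t)"
        using F n disj by (intro sum.mono_neutral_right) (auto simp: indicator_def)
      also have "\<dots> = g n" using n by simp
      also have "\<dots> \<le> ?R t"
      proof -
        have t: "2 powr real_of_int (n-1) < t" "t \<le> 2 powr real_of_int n" using n by (auto simp: J_def)
        have t0: "t > 0" by (rule less_trans[OF _ t(1)]) simp
        have "ennreal (2 powr (real_of_int (n-1) * r / p)) * epowr (d n) r
            = epowr (ennreal (2 powr (real_of_int (n-1) / p)) * d n) r"
          using r by (subst epowr_mult_ennreal) (auto simp: powr_powr)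
        also have "\<dots> \<le> epowr (ennreal (t powr (1/p)) * decreasing_rearrangement A f t) r"
        proof (intro epowr_mono r mult_mono ennreal_leI)
          have "2 powr (real_of_int (n-1) / p) = (2 powr real_of_int (n-1)) powr (1/p)"
            by (simp add: powr_powr)
          also have "\<dots> \<le> t powr (1/p)" using t p by (intro powr_mono2) auto
          finally show "2 powr (real_of_int (n-1) / p) \<le> t powr (1/p)" .
          show "d n \<le> decreasing_rearrangement A f t" unfolding d_def using t(2) by (rule dr_antimono)
        qed auto
        finally have 1: "ennreal (2 powr (real_of_int (n-1) * r / p)) * epowr (d n) r \<le> \<dots>" .
        have "2 powr (- real_of_int n) \<le> 1/t"
          using t t0 by (simp add: powr_minus divide_inverse le_imp_inverse_le)
        then have 2: "ennreal (2 powr (- real_of_int n)) \<le> ennreal (1/t)" by (rule ennreal_leI)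
        have "g n = ennreal (2 powr (real_of_int (n-1) * r / p)) * epowr (d n) r * ennreal (2 powr (- real_of_int n))"
          by (simp add: g_def ennreal_mult mult_ac)
        also have "\<dots> \<le> epowr (ennreal (t powr (1/p)) * decreasing_rearrangement A f t) r * ennreal (1/t)"
          using 1 2 by (intro mult_mono) auto
        finally show ?thesis using t0 by simp
      qed
      finally show ?thesis .
    next
      case False
      then have "(\<Sum>n\<in>F. g n * indicator (J n) t) = 0" by (intro sum.neutral) (auto simp: indicator_def)
      then show ?thesis by simp
    qed
    then have "(\<integral>\<^sup>+t. (\<Sum>n\<in>F. g n * indicator (J n) t) \<partial>lborel) \<le> I"
      unfolding I_def by (intro nn_integral_mono)
    also have "(\<integral>\<^sup>+t. (\<Sum>n\<in>F. g n * indicator (J n) t) \<partial>lborel) = (\<Sum>n\<in>F. g n * emeasure lborel (J n))"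
      unfolding J_def by (subst nn_integral_sum) (auto simp: nn_integral_cmult_indicator)
    also have "\<dots> = (\<Sum>n\<in>F. epowr (d n) r * ennreal (2 powr (real_of_int (n-1) * r / p) / 2))"
    proof (rule sum.cong[OF refl])
      fix n
      have e: "2 powr real_of_int (n-1) = 2 powr real_of_int n / 2" by (simp add: powr_diff)
      then have "emeasure lborel (J n) = ennreal (2 powr real_of_int n / 2)"
        unfolding J_def by (subst emeasure_lborel_Ioc) auto
      then show "g n * emeasure lborel (J n) = epowr (d n) r * ennreal (2 powr (real_of_int (n-1) * r / p) / 2)"
        by (simp add: g_def mult.assoc powr_minus field_simps flip: ennreal_mult)
    qed
    finally show ?thesis using IV by (rule order_trans)
  qed
  have fin: "d n < \<infinity>" for n
  proof (rule ccontr)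
    assume "\<not> d n < \<infinity>"
    then have "epowr (d n) r * ennreal (2 powr (real_of_int (n-1) * r / p) / 2) = \<infinity>"
      by (simp add: epowr_def less_top[symmetric] ennreal_top_mult)
    then show False using main[of "{n}"] by (simp add: top_unique)
  qed
  then show "dyadic_dr A f n < \<infinity>" by (simp add: d_def)
  define c where "c = (\<lambda>n. enn2real (d n))"
  have dc: "d n = ennreal (c n)" for n using fin[of n] by (simp add: c_def less_top)
  have c0: "0 \<le> c n" for n by (simp add: c_def)
  show "ell_ball (1/r) UNIV (lorentz_lower_const p r * V) (dyadic_seq A p f)"
  proof (rule ell_ballI_sum)
    fix F :: "int set" assume F: "finite F" "F \<subseteq> UNIV"
    have "ennreal (\<Sum>n\<in>F. c n powr r * (2 powr (real_of_int (n-1) * r / p) / 2)) \<le> ennreal (V powr r)"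
      using main[OF F(1)] c0 by (simp add: dc flip: ennreal_mult)
    then have "(\<Sum>n\<in>F. c n powr r * (2 powr (real_of_int (n-1) * r / p) / 2)) \<le> V powr r"
      by (subst (asm) ennreal_le_iff) auto
    moreover have "dyadic_seq A p f n powr (1/(1/r)) = 2 * 2 powr (r/p) * (c n powr r * (2 powr (real_of_int (n-1) * r / p) / 2))" for n
    proof -
      have "real_of_int n / p * r = r / p + real_of_int (n-1) * r / p"
        by (simp add: algebra_simps flip: add_divide_distrib)
      then have "2 powr (real_of_int n / p * r) = 2 powr (r/p) * 2 powr (real_of_int (n-1) * r / p)"
        by (simp only: powr_add)
      then show ?thesis
        using r c0 by (simp add: dyadic_seq_def powr_mult powr_powr c_def d_def)
    qed
    ultimately have "(\<Sum>n\<in>F. dyadic_seq A p f n powr (1/(1/r)))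
        = 2 * 2 powr (r/p) * (\<Sum>n\<in>F. c n powr r * (2 powr (real_of_int (n-1) * r / p) / 2))"
      and le: "(\<Sum>n\<in>F. c n powr r * (2 powr (real_of_int (n-1) * r / p) / 2)) \<le> V powr r"
      by (simp_all only: sum_distrib_left)
    note this(1)
    also have "2 * 2 powr (r/p) * (\<Sum>n\<in>F. c n powr r * (2 powr (real_of_int (n-1) * r / p) / 2))
        \<le> 2 * 2 powr (r/p) * V powr r"
      by (intro mult_left_mono le) simp
    also have "\<dots> = (lorentz_lower_const p r * V) powr (1/(1/r))"
      using r V by (simp add: lorentz_lower_const_def powr_mult powr_powr)
    finally show "(\<Sum>n\<in>F. dyadic_seq A p f n powr (1/(1/r))) \<le> (lorentz_lower_const p r * V) powr (1/(1/r))" .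
  qed (use r V lorentz_lower_const_pos[of p r] in \<open>auto simp: dyadic_seq_def\<close>)
qed

definition lorentz_upper_const :: "real \<Rightarrow> real \<Rightarrow> real" where
  "lorentz_upper_const p r = (p / r * 4 powr (r/p)) powr (1/r)"

lemma lorentz_upper_const_nonneg: "lorentz_upper_const p r \<ge> 0"
  by (simp add: lorentz_upper_const_def)

lemma nn_integral_powr:
  assumes "0 < s" "0 \<le> b"
  shows "(\<integral>\<^sup>+t. ennreal (t powr (s - 1)) * indicator {0..b} t \<partial>lborel) = ennreal (b powr s / s)"
proof -
  have "((\<lambda>t. t powr (s - 1)) has_integral (b powr (s - 1 + 1) / (s - 1 + 1))) {0..b}"
    using assms by (intro has_integral_powr_from_0) auto
  then show ?thesis by (subst nn_integral_has_integral_lebesgue') auto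
qed

text \<open>
  By hypothesis \<open>f\<^sup>*\<close> is at most \<open>sup {c m | m \<ge> n}\<close> on \<open>[2\<^sup>n\<^sup>+\<^sup>1, \<infinity>)\<close>.  The \<open>r\<close>-th power of this supremum is at
  most the sum of \<open>c m powr r\<close> over \<open>m \<ge> n\<close>, and after exchanging sum and integral there remains the
  integral of \<open>t powr (r/p - 1)\<close> over \<open>(0, 2\<^sup>m\<^sup>+\<^sup>2)\<close>, which is a multiple of \<open>2 powr (m r/p)\<close>.  The bound is stated
  for general \<open>c\<close> because it is applied to the values of \<open>f\<^sup>*\<close>, to sums of two such sequences, and to
  the heights of atoms.
\<close>

lemma lorentz_upper:
  assumes p: "0 < p" and r: "0 < r"
    and V: "ell_ball (1/r) UNIV V (\<lambda>n. 2 powr (real_of_int n / p) * c n)"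
    and c: "\<And>n B. 0 < B \<Longrightarrow> (\<And>m. n \<le> m \<Longrightarrow> c m \<le> B) \<Longrightarrow> dyadic_dr A f (n + 1) \<le> ennreal B"
  shows "lorentz_norm A p r f \<le> ennreal (lorentz_upper_const p r * V)"
proof -
  have V0: "0 \<le> V" using ell_ballD(1)[OF V] .
  have c0: "0 \<le> c n" for n using ell_ballD(2)[OF V, of n] by (simp add: zero_le_mult_iff)
  define m where "m = (\<lambda>i::nat. int_decode i)"
  define T where "T = (\<lambda>t i. ennreal (c (m i) powr r) * indicator {0..2 powr real_of_int (m i + 2)} t)"
  have dT: "epowr (decreasing_rearrangement A f t) r \<le> (\<Sum>i. T t i)" if t: "t > 0" for t
  proof (cases "(\<Sum>i. T t i)")
    case (real s)
    define n where "n = \<lfloor>log 2 t\<rfloor> - 1"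
    have n: "2 powr real_of_int (n + 1) \<le> t" "t \<le> 2 powr real_of_int (n + 2)"
    proof -
      have "real_of_int (n + 1) \<le> log 2 t" "log 2 t \<le> real_of_int (n + 2)"
        unfolding n_def by linarith+
      then show "2 powr real_of_int (n + 1) \<le> t" "t \<le> 2 powr real_of_int (n + 2)"
        using t by (simp_all only: le_log_iff log_le_iff one_less_numeral_iff semiring_norm)
    qed
    have cs: "c k \<le> s powr (1/r)" if "n \<le> k" for k
    proof -
      have "ennreal (c k powr r) = T t (int_encode k)"
      proof -
        have "2 powr real_of_int (n + 2) \<le> 2 powr real_of_int (k + 2)" using that by simp
        then have "t \<le> 2 powr real_of_int (k + 2)" using n by linarith
        then show ?thesis using t by (simp add: T_def m_def)
      qed
      also have "\<dots> = sum (T t) {int_encode k}" by simp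
      also have "\<dots> \<le> (\<Sum>i. T t i)" by (intro sum_le_suminf) auto
      finally have "c k powr r \<le> s" using real by simp
      then have "(c k powr r) powr (1/r) \<le> s powr (1/r)" using r by (intro powr_mono2) auto
      then show ?thesis using r c0 by (simp add: powr_powr)
    qed
    have "decreasing_rearrangement A f t \<le> dyadic_dr A f (n + 1)" by (rule dr_antimono[OF n(1)])
    also have "\<dots> \<le> ennreal (s powr (1/r))"
    proof (rule ennreal_le_epsilon)
      fix e :: real assume e: "0 < e"
      have "dyadic_dr A f (n + 1) \<le> ennreal (s powr (1/r) + e)"
      proof (rule c)
        show "0 < s powr (1/r) + e" using e by (simp add: add_nonneg_pos)
        show "c k \<le> s powr (1/r) + e" if "n \<le> k" for k using cs[OF that] e by simp
      qed
      then show "dyadic_dr A f (n + 1) \<le> ennreal (s powr (1/r)) + ennreal e" using e by simp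
    qed
    finally show ?thesis using real r by (subst real) (simp add: epowr_le_ennreal_iff)
  qed simp
  have "(\<integral>\<^sup>+t\<in>{0<..}. epowr (ennreal (t powr (1/p)) * decreasing_rearrangement A f t) r * ennreal (1/t) \<partial>lborel)
    \<le> (\<integral>\<^sup>+t. (\<Sum>i. ennreal (t powr (r/p - 1)) * T t i) \<partial>lborel)"
  proof (rule nn_integral_mono)
    fix t :: real
    show "epowr (ennreal (t powr (1/p)) * decreasing_rearrangement A f t) r * ennreal (1/t) * indicator {0<..} t
      \<le> (\<Sum>i. ennreal (t powr (r/p - 1)) * T t i)"
    proof (cases "t > 0")
      case True
      have e: "t powr (r/p) * (1/t) = t powr (r/p - 1)" using True by (simp add: powr_diff)
      have "epowr (ennreal (t powr (1/p)) * decreasing_rearrangement A f t) r * ennreal (1/t)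
          = ennreal (t powr (r/p)) * epowr (decreasing_rearrangement A f t) r * ennreal (1/t)"
        using r True by (subst epowr_mult_ennreal) (auto simp: powr_powr)
      also have "\<dots> = ennreal (t powr (r/p - 1)) * epowr (decreasing_rearrangement A f t) r"
        unfolding e[symmetric] using True by (subst ennreal_mult) (auto simp: mult_ac)
      also have "\<dots> \<le> ennreal (t powr (r/p - 1)) * (\<Sum>i. T t i)"
        by (intro mult_left_mono dT True) auto
      finally show ?thesis using True by simp
    qed simp
  qed
  also have "\<dots> = (\<Sum>i. \<integral>\<^sup>+t. ennreal (t powr (r/p - 1)) * T t i \<partial>lborel)"
    unfolding T_def by (intro nn_integral_suminf) measurable
  also have "\<dots> = (\<Sum>i. ennreal (c (m i) powr r * ((2 powr real_of_int (m i + 2)) powr (r/p) / (r/p))))"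
  proof (rule suminf_cong)
    fix i
    have "(\<integral>\<^sup>+t. ennreal (t powr (r/p - 1)) * T t i \<partial>lborel)
        = (\<integral>\<^sup>+t. ennreal (c (m i) powr r) * (ennreal (t powr (r/p - 1)) * indicator {0..2 powr real_of_int (m i + 2)} t) \<partial>lborel)"
      by (intro nn_integral_cong) (simp add: T_def mult_ac)
    also have "\<dots> = ennreal (c (m i) powr r) * ennreal ((2 powr real_of_int (m i + 2)) powr (r/p) / (r/p))"
      using p r by (subst nn_integral_cmult) (auto simp: nn_integral_powr)
    also have "\<dots> = ennreal (c (m i) powr r * ((2 powr real_of_int (m i + 2)) powr (r/p) / (r/p)))"
      using p r by (subst ennreal_mult) auto
    finally show "(\<integral>\<^sup>+t. ennreal (t powr (r/p - 1)) * T t i \<partial>lborel) = \<dots>" .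
  qed
  also have "\<dots> = (\<Sum>i. ennreal (p / r * 4 powr (r/p) * (2 powr (real_of_int (m i) / p) * c (m i)) powr r))"
  proof (rule suminf_cong)
    fix i
    have "(2 powr real_of_int (m i + 2)) powr (r/p) = 4 powr (r/p) * (2 powr (real_of_int (m i) / p)) powr r"
    proof -
      have "(2 powr real_of_int (m i + 2)) powr (r/p) = (2 powr 2) powr (r/p) * (2 powr real_of_int (m i)) powr (r/p)"
        by (simp add: powr_add powr_mult)
      then show ?thesis by (simp add: powr_powr)
    qed
    then show "ennreal (c (m i) powr r * ((2 powr real_of_int (m i + 2)) powr (r/p) / (r/p)))
      = ennreal (p / r * 4 powr (r/p) * (2 powr (real_of_int (m i) / p) * c (m i)) powr r)"
      using c0 by (simp add: powr_mult mult_ac)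
  qed
  also have "\<dots> \<le> ennreal (p / r * 4 powr (r/p) * V powr r)"
  proof (rule suminf_le_const[OF summableI])
    fix N
    have "(\<Sum>i<N. (2 powr (real_of_int (m i) / p) * c (m i)) powr r)
        = (\<Sum>n\<in>m ` {..<N}. (2 powr (real_of_int n / p) * c n) powr (1/(1/r)))"
      by (subst sum.reindex) (auto simp: m_def inj_int_decode)
    also have "\<dots> \<le> V powr (1/(1/r))" using r by (intro ell_ballD(4)[OF V]) auto
    finally have "(\<Sum>i<N. (2 powr (real_of_int (m i) / p) * c (m i)) powr r) \<le> V powr r" by simp
    then have "p / r * 4 powr (r/p) * (\<Sum>i<N. (2 powr (real_of_int (m i) / p) * c (m i)) powr r) \<le> p / r * 4 powr (r/p) * V powr r"
      using p r by (intro mult_left_mono) auto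
    then show "(\<Sum>i<N. ennreal (p / r * 4 powr (r/p) * (2 powr (real_of_int (m i) / p) * c (m i)) powr r))
      \<le> ennreal (p / r * 4 powr (r/p) * V powr r)"
      using p r by (simp add: sum_distrib_left)
  qed
  finally have "lorentz_norm A p r f \<le> epowr (ennreal (p / r * 4 powr (r/p) * V powr r)) (1/r)"
    unfolding lorentz_norm_def using r by (intro epowr_mono) auto
  also have "\<dots> = ennreal (lorentz_upper_const p r * V)"
  proof -
    have "(p / r * 4 powr (r/p) * V powr r) powr (1/r) = (p / r * 4 powr (r/p)) powr (1/r) * (V powr r) powr (1/r)"
      by (rule powr_mult)
    then show ?thesis using p r V0 by (simp add: lorentz_upper_const_def powr_powr)
  qed
  finally show ?thesis .
qed

section \<open>Atoms and domination in Lorentz spaces\<close>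

lemma two_powr_succ: "2 * 2 powr real_of_int n = 2 powr real_of_int (n + 1)"
  by (simp add: powr_add)

lemma suminf_dyadic:
  "(\<Sum>i. ennreal (2 powr real_of_int (n - int i))) = ennreal (2 powr real_of_int (n + 1))"
proof (rule suminf_ennreal_eq)
  have "(\<lambda>i. 2 powr real_of_int n * (1/2)^i) sums (2 powr real_of_int n * (1 / (1 - 1/2)))"
    by (intro sums_mult geometric_sums) simp
  moreover have "2 powr real_of_int n * (1/2)^i = 2 powr real_of_int (n - int i)" for i
    by (simp add: powr_diff powr_realpow power_one_over)
  ultimately show "(\<lambda>i. 2 powr real_of_int (n - int i)) sums (2 powr real_of_int (n + 1))"
    by (simp add: powr_add mult.commute)
qed simp

text \<open>
  If \<open>B\<close> bounds \<open>c m\<close> for all \<open>m \<ge> n\<close>, then \<open>{|g| > B}\<close> is covered up to a null set by the \<open>E m\<close> with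
  \<open>m < n\<close>, whose measures add up to at most \<open>2\<^sup>n\<^sup>+\<^sup>1\<close>.
\<close>

lemma lorentz_norm_atomic:
  assumes A: "A \<in> sets lebesgue" and g: "g \<in> borel_measurable (lebesgue_on A)"
    and p: "0 < p" and r: "0 < r"
    and V: "ell_ball (1/r) UNIV V (\<lambda>n. 2 powr (real_of_int n / p) * c n)"
    and E: "\<And>n. E n \<in> sets lebesgue" "\<And>n. emeasure lebesgue (E n) \<le> ennreal (2 powr real_of_int (n + 1))"
    and Z: "Z \<in> null_sets lebesgue"
    and gE: "\<And>x. x \<in> A \<Longrightarrow> x \<notin> Z \<Longrightarrow> g x \<noteq> 0 \<Longrightarrow> \<exists>n. x \<in> E n \<and> cmod (g x) \<le> c n"
  shows "lorentz_norm A p r g \<le> ennreal (lorentz_upper_const p r * V)"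
proof (rule lorentz_upper[OF p r V])
  fix n B assume B: "0 < B" "\<And>m. n \<le> m \<Longrightarrow> c m \<le> B"
  define F where "F = (\<lambda>i::nat. E (n - 1 - int i))"
  have sub: "{x\<in>A. B < cmod (g x)} \<subseteq> (\<Union>i. F i) \<union> Z"
  proof
    fix x assume x: "x \<in> {x\<in>A. B < cmod (g x)}"
    show "x \<in> (\<Union>i. F i) \<union> Z"
    proof (cases "x \<in> Z")
      case False
      have "g x \<noteq> 0" using x B by auto
      then obtain m where m: "x \<in> E m" "cmod (g x) \<le> c m" using gE[of x] False x by blast
      have "m < n"
      proof (rule ccontr)
        assume "\<not> m < n"
        then have "c m \<le> B" by (intro B(2)) simp
        then show False using m(2) x by simp
      qed
      then have "m = n - 1 - int (nat (n - 1 - m))" by simp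
      then have "x \<in> F (nat (n - 1 - m))" using m(1) by (simp add: F_def)
      then show ?thesis by blast
    qed simp
  qed
  have "emeasure lebesgue {x\<in>A. B < cmod (g x)} \<le> emeasure lebesgue ((\<Union>i. F i) \<union> Z)"
    using sub by (rule emeasure_mono) (use E Z in \<open>auto simp: F_def\<close>)
  also have "\<dots> \<le> emeasure lebesgue (\<Union>i. F i) + emeasure lebesgue Z"
    by (rule emeasure_subadditive) (use E Z in \<open>auto simp: F_def\<close>)
  also have "\<dots> = emeasure lebesgue (\<Union>i. F i)" using Z by (simp add: null_setsD1)
  also have "\<dots> \<le> (\<Sum>i. emeasure lebesgue (F i))"
    by (rule emeasure_subadditive_countably) (use E in \<open>auto simp: F_def\<close>)
  also have "\<dots> \<le> (\<Sum>i. ennreal (2 powr real_of_int (n - int i)))"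
  proof (rule suminf_le)
    fix i show "emeasure lebesgue (F i) \<le> ennreal (2 powr real_of_int (n - int i))"
      using E(2)[of "n - 1 - int i"] by (simp add: F_def)
  qed auto
  also have "\<dots> = ennreal (2 powr real_of_int (n + 1))" by (rule suminf_dyadic)
  finally show "dyadic_dr A g (n + 1) \<le> ennreal B"
    using B(1) by (subst dr_le_iff[OF A g]) auto
qed

definition lorentz_dom_const :: "real \<Rightarrow> real \<Rightarrow> real" where
  "lorentz_dom_const p r = lorentz_upper_const p r * (4 * lorentz_lower_const p r)"

lemma lorentz_dom_const_nonneg: "lorentz_dom_const p r \<ge> 0"
  unfolding lorentz_dom_const_def
  using lorentz_upper_const_nonneg[of p r] lorentz_lower_const_pos[of p r] by simp

text \<open>
  A quasi-triangle inequality combined with the lattice property.  Doubling the argument of the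
  rearrangement shifts the dyadic index by one, which \<open>lorentz_upper\<close> allows for.
\<close>

lemma lorentz_norm_dominated:
  assumes A: "A \<in> sets lebesgue" and f: "f \<in> borel_measurable (lebesgue_on A)"
    and g: "g \<in> borel_measurable (lebesgue_on A)" and h: "h \<in> borel_measurable (lebesgue_on A)"
    and p: "0 < p" and r: "1 \<le> r" and UV: "0 \<le> U" "0 \<le> V" and ab: "0 \<le> a" "0 \<le> b"
    and nf: "lorentz_norm A p r f \<le> ennreal U" and ng: "lorentz_norm A p r g \<le> ennreal V"
    and le: "\<And>x. x \<in> A \<Longrightarrow> cmod (h x) \<le> a * cmod (f x) + b * cmod (g x)"
  shows "lorentz_norm A p r h \<le> ennreal (lorentz_dom_const p r * (a * U + b * V))"
proof -
  have r0: "0 < r" using r by simp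
  define L where "L = lorentz_lower_const p r"
  define d where "d = (\<lambda>f n. enn2real (dyadic_dr A f n))"
  have df: "dyadic_dr A f n = ennreal (d f n)" and dg: "dyadic_dr A g n = ennreal (d g n)" for n
    using lorentz_lower(2)[OF p r0 UV(1) nf, of n] lorentz_lower(2)[OF p r0 UV(2) ng, of n]
    by (simp_all add: d_def)
  have d0: "0 \<le> d f n" for f n by (simp add: d_def)
  have ball: "ell_ball (1/r) UNIV (4 * (a * (L * U) + b * (L * V)))
      (\<lambda>n. 2 powr (real_of_int n / p) * (a * d f n + b * d g n))"
  proof -
    have "ell_ball (1/r) UNIV (4 * (a * (L * U) + b * (L * V)))
      (\<lambda>n. a * dyadic_seq A p f n + b * dyadic_seq A p g n)"
      unfolding L_def using r
      by (intro ell_ball_add ell_ball_scale lorentz_lower(1) p r0 UV nf ng ab) auto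
    then show ?thesis by (simp add: dyadic_seq_def d_def algebra_simps)
  qed
  have "lorentz_norm A p r h \<le> ennreal (lorentz_upper_const p r * (4 * (a * (L * U) + b * (L * V))))"
  proof (rule lorentz_upper[OF p r0 ball])
    fix n B assume B: "0 < B" "\<And>m. n \<le> m \<Longrightarrow> a * d f m + b * d g m \<le> B"
    have "decreasing_rearrangement A h (2 * 2 powr real_of_int n) \<le> ennreal (a * d f n + b * d g n)"
      by (rule dr_dominated[OF A f g h le ab]) (auto simp: df dg d0)
    also have "\<dots> \<le> ennreal B" by (intro ennreal_leI B(2)) simp
    finally show "dyadic_dr A h (n + 1) \<le> ennreal B" by (simp only: two_powr_succ)
  qed
  then show ?thesis by (simp add: lorentz_dom_const_def L_def algebra_simps)
qed

text \<open>
  Otherwise \<open>f\<^sup>* \<ge> l\<close> everywhere, and \<open>2 powr (n/p) * f\<^sup>*(2\<^sup>n)\<close> would be unbounded as \<open>n\<close> grows.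
\<close>

lemma lorentz_superlevel_finite:
  assumes A: "A \<in> sets lebesgue" and f: "f \<in> borel_measurable (lebesgue_on A)"
    and p: "0 < p" and r: "0 < r" and V: "0 \<le> V" and nf: "lorentz_norm A p r f \<le> ennreal V"
    and l: "0 < l"
  shows "emeasure lebesgue {x\<in>A. l < cmod (f x)} < \<infinity>"
proof -
  define W where "W = lorentz_lower_const p r * V"
  have W: "0 \<le> W" using V lorentz_lower_const_pos[of p r] by (simp add: W_def)
  define n where "n = \<lceil>p * log 2 ((W + 1) / l)\<rceil>"
  have "log 2 ((W + 1) / l) \<le> real_of_int n / p"
    using p by (simp add: pos_le_divide_eq n_def mult.commute)
  then have n: "(W + 1) / l \<le> 2 powr (real_of_int n / p)"
    using W l by (simp add: log_le_iff)
  have "dyadic_seq A p f n \<le> W"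
    using ell_ballD(3)[OF lorentz_lower(1)[OF p r V nf], of n] by (simp add: W_def)
  moreover have "(W + 1) / l * enn2real (dyadic_dr A f n) \<le> dyadic_seq A p f n"
    unfolding dyadic_seq_def using n by (intro mult_right_mono) auto
  ultimately have "(W + 1) / l * enn2real (dyadic_dr A f n) \<le> W" by (rule order_trans[rotated])
  then have "(W + 1) * enn2real (dyadic_dr A f n) \<le> W * l" using l by (simp add: pos_divide_le_eq)
  also have "\<dots> \<le> (W + 1) * l" using l by (simp add: algebra_simps)
  finally have "enn2real (dyadic_dr A f n) \<le> l" using W by simp
  then have "ennreal (enn2real (dyadic_dr A f n)) \<le> ennreal l" by (rule ennreal_leI)
  moreover have "ennreal (enn2real (dyadic_dr A f n)) = dyadic_dr A f n"
    using lorentz_lower(2)[OF p r V nf, of n] by simp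
  ultimately have "dyadic_dr A f n \<le> ennreal l" by simp
  then have "emeasure lebesgue {x\<in>A. l < cmod (f x)} \<le> ennreal (2 powr real_of_int n)"
    using l by (subst (asm) dr_le_iff[OF A f]) auto
  then show ?thesis by (rule order.strict_trans1) simp
qed

lemma dyadic_dr_finite:
  assumes A: "A \<in> sets lebesgue" and f: "f \<in> borel_measurable (lebesgue_on A)"
    and fin: "\<And>l. 0 < l \<Longrightarrow> emeasure lebesgue {x\<in>A. l < cmod (f x)} < \<infinity>"
  shows "dyadic_dr A f n < \<infinity>"
proof -
  define S where "S = (\<lambda>i::nat. {x\<in>A. real (Suc i) < cmod (f x)})"
  have "(\<lambda>i. emeasure lebesgue (S i)) \<longlonglongrightarrow> emeasure lebesgue (\<Inter>i. S i)"
  proof (rule Lim_emeasure_decseq)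
    show "range S \<subseteq> sets lebesgue" unfolding S_def using superlevel_sets[OF A f] by blast
    show "decseq S" 
    proof (rule decseq_SucI)
      fix i show "S (Suc i) \<subseteq> S i" unfolding S_def by auto
    qed
    show "emeasure lebesgue (S i) \<noteq> \<infinity>" for i using fin[of "real (Suc i)"] by (simp add: S_def)
  qed
  moreover have "(\<Inter>i. S i) = {}"
  proof -
    have "\<exists>i. \<not> real (Suc i) < c" for c :: real
    proof -
      obtain i where "c < real i" using reals_Archimedean2 by blast
      then show ?thesis by (intro exI[of _ i]) simp
    qed
    then show ?thesis unfolding S_def by blast
  qed
  ultimately have "(\<lambda>i. emeasure lebesgue (S i)) \<longlonglongrightarrow> 0" by simp
  then have "eventually (\<lambda>i. emeasure lebesgue (S i) < ennreal (2 powr real_of_int n)) sequentially"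
    by (rule order_tendstoD(2)) simp
  then obtain i where i: "emeasure lebesgue (S i) < ennreal (2 powr real_of_int n)"
    by (auto simp: eventually_sequentially)
  then have "dyadic_dr A f n \<le> ennreal (real (Suc i))"
    by (subst dr_le_iff[OF A f]) (auto simp: S_def less_imp_le)
  then show ?thesis by (rule order.strict_trans1) simp
qed

section \<open>Averages over sets of prescribed measure\<close>

text \<open>
  On \<open>D\<close> the function is at most \<open>c 0\<close>, except on the layers \<open>{c j < |f| \<le> c (j+1)}\<close>, whose measure is
  at most \<open>2\<^sup>n\<^sup>-\<^sup>j\<close>, and on the null set where \<open>|f|\<close> exceeds every \<open>c j\<close>.
\<close>

lemma nn_integral_le_dyadic:
  assumes A: "A \<in> sets lebesgue" and f: "f \<in> borel_measurable (lebesgue_on A)"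
    and D: "D \<in> sets lebesgue" "D \<subseteq> A"
    and c: "\<And>j::nat. dyadic_dr A f (n - int j) \<le> ennreal (c j)" "\<And>j. 0 \<le> c j"
  shows "(\<integral>\<^sup>+x\<in>D. ennreal (cmod (f x)) \<partial>lebesgue) \<le>
    ennreal (c 0) * emeasure lebesgue D + (\<Sum>j. ennreal (c (Suc j)) * ennreal (2 powr real_of_int (n - int j)))"
proof -
  define S where "S = (\<lambda>j. {x\<in>A. c j < cmod (f x)})"
  have Sm: "S j \<in> sets lebesgue" for j unfolding S_def by (rule superlevel_sets[OF A f])
  have Se: "emeasure lebesgue (S j) \<le> ennreal (2 powr real_of_int (n - int j))" for j
    using c(1)[of j] dr_le_iff[OF A f c(2)[of j]] by (simp add: S_def)
  define Z where "Z = (\<Inter>j. S j)"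
  have Zm: "Z \<in> sets lebesgue" unfolding Z_def using Sm by (intro sets.countable_INT) auto
  have "Z \<in> null_sets lebesgue"
  proof (rule null_setsI[OF _ Zm])
    have "emeasure lebesgue Z \<le> 0"
    proof (rule LIMSEQ_le_const)
      show "\<exists>N. \<forall>j\<ge>N. emeasure lebesgue Z \<le> ennreal (2 powr real_of_int n * (1/2)^j)"
      proof (intro exI allI impI)
        fix j
        have "emeasure lebesgue Z \<le> emeasure lebesgue (S j)"
          using Sm by (intro emeasure_mono) (auto simp: Z_def)
        also have "\<dots> \<le> ennreal (2 powr real_of_int (n - int j))" by (rule Se)
        also have "2 powr real_of_int (n - int j) = 2 powr real_of_int n * (1/2)^j"
          by (simp add: powr_diff powr_realpow power_one_over)
        finally show "emeasure lebesgue Z \<le> ennreal (2 powr real_of_int n * (1/2)^j)" .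
      qed
      have "(\<lambda>j. 2 powr real_of_int n * (1/2)^j) \<longlonglongrightarrow> 2 powr real_of_int n * 0"
        by (intro tendsto_mult_left LIMSEQ_power_zero) simp
      then have "(\<lambda>j. ennreal (2 powr real_of_int n * (1/2)^j)) \<longlonglongrightarrow> ennreal (2 powr real_of_int n * 0)"
        by (rule tendsto_ennrealI)
      then show "(\<lambda>j. ennreal (2 powr real_of_int n * (1/2)^j)) \<longlonglongrightarrow> 0" by simp
    qed
    then show "emeasure lebesgue Z = 0" by simp
  qed
  then have AE: "AE x in lebesgue. x \<notin> Z" by (rule AE_not_in)
  have pt: "ennreal (cmod (f x)) * indicator D x \<le>
      ennreal (c 0) * indicator D x + (\<Sum>j. ennreal (c (Suc j)) * indicator (S j) x)"
    if xZ: "x \<notin> Z" for x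
  proof (cases "x \<in> D \<and> \<not> cmod (f x) \<le> c 0")
    case False
    then have "ennreal (cmod (f x)) * indicator D x \<le> ennreal (c 0) * indicator D x"
      by (auto simp: indicator_def intro: ennreal_leI)
    also have "\<dots> \<le> \<dots> + (\<Sum>j. ennreal (c (Suc j)) * indicator (S j) x)" by simp
    finally show ?thesis .
  next
    case True
    then have x: "x \<in> A" "x \<in> D" "c 0 < cmod (f x)" using D by auto
    have ex: "\<exists>j. cmod (f x) \<le> c j" using xZ x by (auto simp: Z_def S_def not_less)
    define k where "k = (LEAST j. cmod (f x) \<le> c j)"
    have k: "cmod (f x) \<le> c k" unfolding k_def using ex by (rule LeastI_ex)
    have "k \<noteq> 0" using k x(3) by (metis not_le)
    then obtain i where i: "k = Suc i" using not0_implies_Suc by blast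
    have "\<not> cmod (f x) \<le> c i" using not_less_Least[of i "\<lambda>j. cmod (f x) \<le> c j"] i by (simp add: k_def[symmetric])
    then have xi: "x \<in> S i" using x by (simp add: S_def)
    have "ennreal (cmod (f x)) * indicator D x \<le> ennreal (c (Suc i)) * indicator (S i) x"
      using k i xi x by (auto intro: ennreal_leI)
    also have "\<dots> = (\<Sum>j\<in>{i}. ennreal (c (Suc j)) * indicator (S j) x)" by (subst sum.insert) auto
    also have "\<dots> \<le> (\<Sum>j. ennreal (c (Suc j)) * indicator (S j) x)" by (intro sum_le_suminf) auto
    also have "\<dots> \<le> ennreal (c 0) * indicator D x + \<dots>" by simp
    finally show ?thesis .
  qed
  have "(\<integral>\<^sup>+x\<in>D. ennreal (cmod (f x)) \<partial>lebesgue) \<le>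
    (\<integral>\<^sup>+x. (ennreal (c 0) * indicator D x + (\<Sum>j. ennreal (c (Suc j)) * indicator (S j) x)) \<partial>lebesgue)"
    using AE by (intro nn_integral_mono_AE) (auto elim!: eventually_mono intro: pt)
  also have "\<dots> = (\<integral>\<^sup>+x. ennreal (c 0) * indicator D x \<partial>lebesgue)
      + (\<integral>\<^sup>+x. (\<Sum>j. ennreal (c (Suc j)) * indicator (S j) x) \<partial>lebesgue)"
    by (intro nn_integral_add borel_measurable_times_ennreal borel_measurable_suminf_order
        borel_measurable_indicator borel_measurable_const D(1) Sm)
  also have "(\<integral>\<^sup>+x. (\<Sum>j. ennreal (c (Suc j)) * indicator (S j) x) \<partial>lebesgue)
      = (\<Sum>j. \<integral>\<^sup>+x. ennreal (c (Suc j)) * indicator (S j) x \<partial>lebesgue)"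
    by (intro nn_integral_suminf borel_measurable_times_ennreal borel_measurable_indicator
        borel_measurable_const Sm)
  also have "\<dots> = (\<Sum>j. ennreal (c (Suc j)) * emeasure lebesgue (S j))"
    using Sm by (simp add: nn_integral_cmult_indicator)
  also have "\<dots> \<le> (\<Sum>j. ennreal (c (Suc j)) * ennreal (2 powr real_of_int (n - int j)))"
    by (intro suminf_le mult_left_mono Se) auto
  finally show ?thesis using D by (simp add: nn_integral_cmult_indicator)
qed

definition mean_modulus :: "'a::euclidean_space set \<Rightarrow> ('a \<Rightarrow> complex) \<Rightarrow> real" where
  "mean_modulus D f = enn2real (\<integral>\<^sup>+x\<in>D. ennreal (cmod (f x)) \<partial>lebesgue) / measure lebesgue D"

lemma mean_modulus_nonneg [simp]: "0 \<le> mean_modulus D f"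
  by (simp add: mean_modulus_def)

definition lorentz_avg_const :: "real \<Rightarrow> real \<Rightarrow> real" where
  "lorentz_avg_const p r = (let q = 2 powr (- ((1 - 1/p) / 2)) in
     (1 + 2 * q / (1 - q)) * lorentz_lower_const p r * (1 / (1 - q powr r)) powr (1/r))"

lemma lorentz_avg_const_nonneg:
  assumes "1 < p" shows "0 \<le> lorentz_avg_const p r"
proof -
  define q :: real where "q = 2 powr (- ((1 - 1/p) / 2))"
  have "q < 2 powr 0" unfolding q_def using assms by (intro powr_less_mono) auto
  then have "0 < q" "q < 1" by (auto simp: q_def)
  then show ?thesis
    using lorentz_lower_const_pos[of p r]
    unfolding lorentz_avg_const_def q_def[symmetric] Let_def by simp
qed

text \<open>
  A form of Hardy's inequality.  The mean of \<open>|f|\<close> over a set of measure at least \<open>2\<^sup>n\<close> is at most a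
  constant times the mean of \<open>f\<^sup>*\<close> over \<open>(0, 2\<^sup>n)\<close>; in terms of the dyadic sequence \<open>v\<close> of \<open>f\<close>, the weighted
  mean is bounded by the convolution \<open>\<Sum>\<^sub>j v (n-j) * 2 powr (- j (1 - 1/p))\<close>, where \<open>p > 1\<close> gives decay.  Half
  of the decay is used to replace this sum by the \<open>l\<^sup>r\<close> expression \<open>S n\<close>, and the other half remains in
  \<open>S n\<close> and makes the double sum over \<open>n\<close> and \<open>j\<close> converge.
\<close>

lemma lorentz_averages:
  assumes A: "A \<in> sets lebesgue" and f: "f \<in> borel_measurable (lebesgue_on A)"
    and p: "1 < p" and r: "0 < r" and V: "0 \<le> V" and nf: "lorentz_norm A p r f \<le> ennreal V"
    and D: "\<And>n. n \<in> N \<Longrightarrow> D n \<in> sets lebesgue" "\<And>n. n \<in> N \<Longrightarrow> D n \<subseteq> A"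
    and De: "\<And>n. n \<in> N \<Longrightarrow> ennreal (2 powr real_of_int n) \<le> emeasure lebesgue (D n)"
      "\<And>n. n \<in> N \<Longrightarrow> emeasure lebesgue (D n) < \<infinity>"
  shows "ell_ball (1/r) N (lorentz_avg_const p r * V)
     (\<lambda>n. 2 powr (real_of_int n / p) * mean_modulus (D n) f)"
    and "n \<in> N \<Longrightarrow> (\<integral>\<^sup>+x\<in>D n. ennreal (cmod (f x)) \<partial>lebesgue) < \<infinity>"
proof -
  \<comment> \<open>Half of the available decay rate \<open>1 - 1/p\<close>.\<close>
  define \<tau> where "\<tau> = (1 - 1/p) / 2"
  define q where "q = 2 powr (- \<tau>)"
  have \<tau>: "\<tau> > 0" using p by (simp add: \<tau>_def)
  have q: "0 < q" "q < 1"
    using \<tau> powr_less_mono[of "-\<tau>" 0 2] by (auto simp: q_def)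
  have qr: "0 < q powr r" "q powr r < 1"
    using q r powr_less_mono2[of r q 1] by auto
  define L where "L = lorentz_lower_const p r * V"
  have L0: "0 \<le> L" using V lorentz_lower_const_pos[of p r] by (simp add: L_def)
  define v where "v = dyadic_seq A p f"
  have v: "ell_ball (1/r) UNIV L v"
    unfolding v_def L_def by (rule lorentz_lower(1)) (use p r V nf in auto)
  have v0: "0 \<le> v n" "v n \<le> L" for n using ell_ballD(2,3)[OF v, of n] by auto
  define w where "w = (\<lambda>n j. (q ^ j * v (n - int j)) powr r)"
  have w_eq: "w n j = (q powr r) ^ j * v (n - int j) powr r" for n j
  proof -
    have "(q ^ j) powr r = (q powr r) ^ j"
      using q by (simp add: powr_powr mult.commute flip: powr_realpow)
    then show ?thesis by (simp add: w_def powr_mult)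
  qed
  have geo: "summable (\<lambda>j. (q powr r) ^ j)" "(\<Sum>j. (q powr r) ^ j) = 1 / (1 - q powr r)"
    using qr by (auto intro: summable_geometric suminf_geometric)
  have wsum: "summable (w n)" for n
  proof (rule summable_comparison_test_ev)
    show "summable (\<lambda>j. (q powr r) ^ j * L powr r)" by (intro summable_mult2 geo)
    show "eventually (\<lambda>j. norm (w n j) \<le> (q powr r) ^ j * L powr r) sequentially"
      using v0 r by (intro always_eventually allI) (auto simp: w_eq intro!: mult_left_mono powr_mono2)
  qed
  have w0: "0 \<le> w n j" for n j by (simp add: w_def)
  define S where "S = (\<lambda>n. (\<Sum>j. w n j) powr (1/r))"
  have S0: "0 \<le> S n" for n by (simp add: S_def)
  have vS: "q ^ j * v (n - int j) \<le> S n" for n j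
  proof -
    have "w n j = sum (w n) {j}" by simp
    also have "\<dots> \<le> (\<Sum>j. w n j)" using w0 by (intro sum_le_suminf wsum) auto
    finally have "w n j powr (1/r) \<le> S n" unfolding S_def using r w0 by (intro powr_mono2) auto
    then show ?thesis using r q v0 by (simp add: w_def powr_powr)
  qed
  define c where "c = (\<lambda>n j. S n * 2 powr (real j * \<tau>) * 2 powr (- (real_of_int (n - int j) / p)))"
  have c0: "0 \<le> c n j" for n j using S0 by (simp add: c_def)
  have dc: "dyadic_dr A f (n - int j) \<le> ennreal (c n j)" for n j
  proof -
    define d where "d = enn2real (dyadic_dr A f (n - int j))"
    have "dyadic_dr A f (n - int j) = ennreal d"
      using lorentz_lower(2)[OF _ r V nf, of "n - int j"] p by (simp add: d_def)
    moreover have "d \<le> c n j"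
    proof -
      have 1: "q ^ j = 2 powr (- (real j * \<tau>))"
        by (simp add: q_def powr_powr mult.commute flip: powr_realpow)
      have "d = 2 powr (real j * \<tau>) * 2 powr (- (real_of_int (n - int j) / p)) * (q ^ j * v (n - int j))"
        unfolding 1 v_def dyadic_seq_def d_def by (simp add: powr_minus field_simps)
      also have "\<dots> \<le> 2 powr (real j * \<tau>) * 2 powr (- (real_of_int (n - int j) / p)) * S n"
        by (intro mult_left_mono vS) auto
      finally show ?thesis by (simp add: c_def mult_ac)
    qed
    ultimately show ?thesis by (simp add: ennreal_leI)
  qed
  define K where "K = 2 * q / (1 - q)"
  have K0: "0 \<le> K" using q by (simp add: K_def)
  have tail: "(\<Sum>j. ennreal (c n (Suc j)) * ennreal (2 powr real_of_int (n - int j)))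
      = ennreal (S n * 2 powr (- (real_of_int n / p)) * 2 powr real_of_int n * K)" for n
  proof -
    have term_eq: "c n (Suc j) * 2 powr real_of_int (n - int j)
        = S n * 2 powr (- (real_of_int n / p)) * 2 powr real_of_int n * (2 * q * q ^ j)" for j
    proof -
      have ex: "real (Suc j) * \<tau> + (- (real_of_int (n - int (Suc j)) / p)) + real_of_int (n - int j)
         = - (real_of_int n / p) + real_of_int n + 1 + - (real (Suc j) * \<tau>)"
        using p by (simp add: \<tau>_def field_simps)
      have q1: "q * q ^ j = 2 powr (- (real (Suc j) * \<tau>))"
        using powr_realpow[of q "Suc j"] q by (simp add: q_def powr_powr mult.commute del: of_nat_Suc)
      have "c n (Suc j) * 2 powr real_of_int (n - int j)
        = S n * (2 powr (real (Suc j) * \<tau>) * 2 powr (- (real_of_int (n - int (Suc j)) / p)) * 2 powr real_of_int (n - int j))"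
        by (simp only: c_def mult_ac)
      also have "\<dots> = S n * 2 powr (real (Suc j) * \<tau> + (- (real_of_int (n - int (Suc j)) / p)) + real_of_int (n - int j))"
        by (simp only: powr_add)
      also have "\<dots> = S n * (2 powr (- (real_of_int n / p)) * 2 powr real_of_int n * 2 powr 1 * 2 powr (- (real (Suc j) * \<tau>)))"
        unfolding ex by (simp only: powr_add)
      also have "\<dots> = S n * (2 powr (- (real_of_int n / p)) * 2 powr real_of_int n * 2 * (q * q ^ j))"
        unfolding q1 by simp
      finally show ?thesis by (simp only: mult_ac)
    qed
    have sums: "(\<lambda>j. c n (Suc j) * 2 powr real_of_int (n - int j)) sums
        (S n * 2 powr (- (real_of_int n / p)) * 2 powr real_of_int n * (2 * q * (1 / (1 - q))))"
      unfolding term_eq using q by (intro sums_mult geometric_sums) simp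
    have "(\<Sum>j. ennreal (c n (Suc j)) * ennreal (2 powr real_of_int (n - int j)))
       = (\<Sum>j. ennreal (c n (Suc j) * 2 powr real_of_int (n - int j)))"
      using c0 by (simp add: ennreal_mult)
    also have "\<dots> = ennreal (S n * 2 powr (- (real_of_int n / p)) * 2 powr real_of_int n * (2 * q * (1 / (1 - q))))"
      using c0 by (intro suminf_ennreal_eq sums) auto
    finally show ?thesis by (simp add: K_def)
  qed
  have main: "(\<integral>\<^sup>+x\<in>D n. ennreal (cmod (f x)) \<partial>lebesgue) \<le>
      ennreal (S n * 2 powr (- (real_of_int n / p)) * measure lebesgue (D n) * (1 + K))" if n: "n \<in> N" for n
  proof -
    have m: "emeasure lebesgue (D n) = ennreal (measure lebesgue (D n))"
      using De(2)[OF n] by (simp add: emeasure_eq_ennreal_measure less_top)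
    have m2: "2 powr real_of_int n \<le> measure lebesgue (D n)"
      using De(1)[OF n] by (simp add: m)
    have "(\<integral>\<^sup>+x\<in>D n. ennreal (cmod (f x)) \<partial>lebesgue) \<le>
      ennreal (c n 0) * emeasure lebesgue (D n) + (\<Sum>j. ennreal (c n (Suc j)) * ennreal (2 powr real_of_int (n - int j)))"
      by (intro nn_integral_le_dyadic[OF A f D(1,2)[OF n] dc c0])
    also have "\<dots> = ennreal (c n 0 * measure lebesgue (D n) + S n * 2 powr (- (real_of_int n / p)) * 2 powr real_of_int n * K)"
      unfolding tail m using c0[of n 0] S0[of n] K0 by (simp add: ennreal_mult)
    also have "\<dots> \<le> ennreal (c n 0 * measure lebesgue (D n) + S n * 2 powr (- (real_of_int n / p)) * measure lebesgue (D n) * K)"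
      using S0[of n] K0 m2 by (intro ennreal_leI add_left_mono mult_right_mono mult_left_mono) auto
    also have "\<dots> = ennreal (S n * 2 powr (- (real_of_int n / p)) * measure lebesgue (D n) * (1 + K))"
      by (simp add: c_def algebra_simps)
    finally show ?thesis .
  qed
  show "(\<integral>\<^sup>+x\<in>D n. ennreal (cmod (f x)) \<partial>lebesgue) < \<infinity>" if "n \<in> N"
    using main[OF that] by (rule order.strict_trans1) simp
  define B where "B = L * (1 / (1 - q powr r)) powr (1/r)"
  have B0: "0 \<le> B" using L0 by (simp add: B_def)
  have SB: "ell_ball (1/r) N B S"
  proof (rule ell_ballI_sum)
    fix F assume F: "finite F" "F \<subseteq> N"
    have "(\<Sum>n\<in>F. S n powr (1/(1/r))) = (\<Sum>n\<in>F. \<Sum>j. w n j)"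
      using r by (intro sum.cong) (auto simp: S_def powr_powr suminf_nonneg[OF wsum w0])
    also have "\<dots> = (\<Sum>j. \<Sum>n\<in>F. w n j)" by (rule suminf_sum[symmetric]) (rule wsum)
    also have "\<dots> \<le> (\<Sum>j. (q powr r) ^ j * L powr r)"
    proof (intro suminf_le summable_sum wsum summable_mult2 geo)
      fix j
      have "(\<Sum>n\<in>F. w n j) = (q powr r) ^ j * (\<Sum>n\<in>F. v (n - int j) powr r)"
        by (simp add: w_eq sum_distrib_left)
      also have "(\<Sum>n\<in>F. v (n - int j) powr r) = (\<Sum>m\<in>(\<lambda>n. n - int j) ` F. v m powr (1/(1/r)))"
        by (subst sum.reindex) (auto simp: inj_on_def)
      also have "\<dots> \<le> L powr (1/(1/r))" using r F by (intro ell_ballD(4)[OF v]) auto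
      finally show "(\<Sum>n\<in>F. w n j) \<le> (q powr r) ^ j * L powr r" using qr by simp
    qed
    also have "\<dots> = L powr r * (1 / (1 - q powr r))"
      using geo by (simp add: suminf_mult2[symmetric])
    also have "\<dots> = B powr (1/(1/r))"
      using L0 qr r by (simp add: B_def powr_mult powr_powr)
    finally show "(\<Sum>n\<in>F. S n powr (1/(1/r))) \<le> B powr (1/(1/r))" .
  qed (use r B0 S0 in auto)
  have "ell_ball (1/r) N ((1 + K) * B)
     (\<lambda>n. 2 powr (real_of_int n / p) * mean_modulus (D n) f)"
  proof (rule ell_ball_mono[OF ell_ball_scale[OF SB, of "1 + K"]])
    fix n assume n: "n \<in> N"
    have mpos: "0 < measure lebesgue (D n)"
    proof -
      have "0 < emeasure lebesgue (D n)" by (rule order.strict_trans2[OF _ De(1)[OF n]]) simp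
      then show ?thesis using De(2)[OF n] by (simp add: measure_def enn2real_positive_iff)
    qed
    have "enn2real (\<integral>\<^sup>+x\<in>D n. ennreal (cmod (f x)) \<partial>lebesgue)
        \<le> S n * 2 powr (- (real_of_int n / p)) * measure lebesgue (D n) * (1 + K)"
      using main[OF n] S0[of n] K0 by (intro enn2real_leI) auto
    then have "mean_modulus (D n) f
        \<le> S n * 2 powr (- (real_of_int n / p)) * (1 + K)"
      using mpos by (simp add: mean_modulus_def pos_divide_le_eq mult_ac)
    then have "2 powr (real_of_int n / p) * mean_modulus (D n) f
       \<le> 2 powr (real_of_int n / p) * (S n * 2 powr (- (real_of_int n / p)) * (1 + K))"
      by (rule mult_left_mono) simp
    also have "\<dots> = (1 + K) * S n" by (simp add: powr_minus field_simps)
    finally show "2 powr (real_of_int n / p) * mean_modulus (D n) f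
       \<le> (1 + K) * S n" .
  qed (use K0 in auto)
  moreover have "(1 + K) * B = lorentz_avg_const p r * V"
    unfolding lorentz_avg_const_def Let_def \<tau>_def[symmetric] q_def[symmetric] K_def B_def L_def by simp
  ultimately show "ell_ball (1/r) N (lorentz_avg_const p r * V)
     (\<lambda>n. 2 powr (real_of_int n / p) * mean_modulus (D n) f)"
    by simp
qed

section \<open>The spaces HL\<close>

lemma two_powi_eq_powr: "(2::real) powi n = 2 powr real_of_int n"
  by (simp add: powr_real_of_int')

lemma dyadic_shell_subset: "dyadic_shell \<Omega> k \<subseteq> \<Omega>"
  by (auto simp: dyadic_shell_def)

lemma dyadic_shell_sets: "\<Omega> \<in> sets lebesgue \<Longrightarrow> dyadic_shell \<Omega> k \<in> sets lebesgue"
proof -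
  assume \<Omega>: "\<Omega> \<in> sets lebesgue"
  have 1: "dyadic_shell \<Omega> k = \<Omega> \<inter> (if k = -1 then {x. norm x < 1/2}
      else {x. 2 powi (k - 1) \<le> norm x} \<inter> {x. norm x < 2 powi k})"
    by (auto simp: dyadic_shell_def)
  have "{x::'a. norm x < c} \<in> sets lebesgue" "{x::'a. c \<le> norm x} \<in> sets lebesgue" for c
    by (intro sets_completionI_sets; simp)+
  then show ?thesis unfolding 1 using \<Omega> by auto
qed

lemma dyadic_shell_unique:
  assumes "x \<in> dyadic_shell \<Omega> k" "x \<in> dyadic_shell \<Omega> l" "k \<ge> -1" "l \<ge> -1"
  shows "k = l"
proof -
  have *: "k \<le> l" if k: "x \<in> dyadic_shell \<Omega> k" "k \<ge> -1" and l: "x \<in> dyadic_shell \<Omega> l" "l \<ge> -1" for k l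
  proof (cases "k = -1")
    case False
    have "2 powr real_of_int (k - 1) \<le> norm x"
      using k False unfolding two_powi_eq_powr[symmetric] by (simp add: dyadic_shell_def)
    moreover have "norm x < 2 powr real_of_int l"
    proof (cases "l = -1")
      case True
      then have "norm x < 1/2" using l by (simp add: dyadic_shell_def)
      then show ?thesis using True by (simp add: powr_minus)
    next
      case False
      then show ?thesis
        using l unfolding two_powi_eq_powr[symmetric] by (simp add: dyadic_shell_def)
    qed
    ultimately have "2 powr real_of_int (k - 1) < 2 powr real_of_int l" by (rule order.strict_trans1)
    then have "k - 1 < l" by simp
    then show ?thesis by simp
  qed (use l in simp)
  show ?thesis using *[OF assms(1,3) assms(2,4)] *[OF assms(2,4) assms(1,3)] by simp
qed

lemma measurable_on_shell:
  "f \<in> borel_measurable (lebesgue_on \<Omega>) \<Longrightarrow> f \<in> borel_measurable (lebesgue_on (dyadic_shell \<Omega> k))"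
  by (rule measurable_restrict_mono[OF _ dyadic_shell_subset])

lemma exponent_cases:
  assumes "1 \<le> (q::ennreal)" "\<kappa> = enn2real (1 / q)"
  shows "q = \<infinity> \<and> \<kappa> = 0 \<or> q \<noteq> \<infinity> \<and> 0 < \<kappa> \<and> \<kappa> \<le> 1 \<and> enn2real q = 1 / \<kappa>"
proof (cases q)
  case (real s)
  have s: "s \<ge> 1" using assms(1) real by (simp flip: ennreal_1)
  then have "1 / q = ennreal (1 / s)" using real by (simp add: divide_ennreal flip: ennreal_1)
  then have "\<kappa> = 1 / s" using assms(2) s by simp
  then show ?thesis using real s by simp
qed (use assms in \<open>simp add: ennreal_divide_top\<close>)

lemma HL_simps: "carr (HL \<Omega> p r a q) = {f \<in> borel_measurable (lebesgue_on \<Omega>).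
               (\<forall>k\<ge>-1. f \<in> lorentz_space (dyadic_shell \<Omega> k) p r) \<and> HL_norm \<Omega> p r a q f < \<infinity>}"
  "nrm (HL \<Omega> p r a q) f = enn2real (HL_norm \<Omega> p r a q f)"
  by (simp_all add: HL_def)

lemma HL_nrm_nonneg [simp]: "0 \<le> nrm (HL \<Omega> p r a q) f"
  by (simp add: HL_simps)

definition shell_norm :: "'a::euclidean_space set \<Rightarrow> real \<Rightarrow> real \<Rightarrow> ('a \<Rightarrow> complex) \<Rightarrow> int \<Rightarrow> real" where
  "shell_norm \<Omega> p r f k = enn2real (lorentz_norm (dyadic_shell \<Omega> k) p r f)"

lemma shell_norm_nonneg [simp]: "0 \<le> shell_norm \<Omega> p r f k"
  by (simp add: shell_norm_def)

lemma HL_D: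
  assumes f: "f \<in> carr (HL \<Omega> p r a q)"
  shows "f \<in> borel_measurable (lebesgue_on \<Omega>)"
    and "k \<ge> -1 \<Longrightarrow> lorentz_norm (dyadic_shell \<Omega> k) p r f = ennreal (shell_norm \<Omega> p r f k)"
  using assms by (auto simp: HL_simps shell_norm_def lorentz_space_def)

text \<open>
  Together with the converse \<open>HL_I\<close> below, this describes membership and norm of \<open>HL\<close> by the sequence
  of weighted shell norms, in the same way for finite and infinite \<open>q\<close>.
\<close>

lemma HL_ell_ball:
  assumes f: "f \<in> carr (HL \<Omega> p r a q)" and q: "1 \<le> q" and \<kappa>: "\<kappa> = enn2real (1 / q)"
  shows "ell_ball \<kappa> {-1..} (nrm (HL \<Omega> p r a q) f) (\<lambda>k. 2 powr (of_int k * a) * shell_norm \<Omega> p r f k)"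
proof -
  define N where "N = nrm (HL \<Omega> p r a q) f"
  have N0: "0 \<le> N" by (simp add: N_def)
  have HN: "HL_norm \<Omega> p r a q f = ennreal N"
    using f by (simp add: HL_simps N_def)
  note ln = HL_D(2)[OF f]
  have "ell_ball \<kappa> {-1..} N (\<lambda>k. 2 powr (of_int k * a) * shell_norm \<Omega> p r f k)"
    using exponent_cases[OF q \<kappa>]
  proof (elim disjE conjE)
    assume q: "q = \<infinity>" "\<kappa> = 0"
    have "2 powr (of_int k * a) * shell_norm \<Omega> p r f k \<le> N" if k: "k \<ge> -1" for k
    proof -
      have "ennreal (2 powr (of_int k * a)) * lorentz_norm (dyadic_shell \<Omega> k) p r f
         \<le> (SUP k\<in>{-1..}. ennreal (2 powr (of_int k * a)) * lorentz_norm (dyadic_shell \<Omega> k) p r f)"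
        using k by (intro SUP_upper) auto
      also have "\<dots> = ennreal N" using HN q by (simp add: HL_norm_def)
      finally show ?thesis using N0 by (simp add: ln[OF k] flip: ennreal_mult)
    qed
    then show ?thesis using q N0 by (auto simp: ell_ball_def)
  next
    assume q: "q \<noteq> \<infinity>" "0 < \<kappa>" "\<kappa> \<le> 1" "enn2real q = 1 / \<kappa>"
    define S where "S = (\<Sum>\<^sub>\<infinity>k\<in>{-1..}. ennreal (2 powr (of_int k * a * enn2real q)) *
                     epowr (lorentz_norm (dyadic_shell \<Omega> k) p r f) (enn2real q))"
    have "epowr S \<kappa> \<le> ennreal N" using HN q by (simp add: HL_norm_def S_def)
    then have SN: "S \<le> ennreal (N powr (1/\<kappa>))"
      using q N0 by (subst (asm) epowr_le_ennreal_iff) auto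
    show ?thesis
    proof (rule ell_ballI_sum[OF q(2) N0])
      fix F :: "int set" assume F: "finite F" "F \<subseteq> {-1..}"
      have "ennreal (\<Sum>k\<in>F. (2 powr (of_int k * a) * shell_norm \<Omega> p r f k) powr (1/\<kappa>))
         = (\<Sum>k\<in>F. ennreal (2 powr (of_int k * a * enn2real q)) *
                     epowr (lorentz_norm (dyadic_shell \<Omega> k) p r f) (enn2real q))"
        unfolding sum_ennreal[symmetric, OF powr_ge_zero]
      proof (rule sum.cong[OF refl])
        fix k assume "k \<in> F"
        then have k: "k \<ge> -1" using F by auto
        show "ennreal ((2 powr (of_int k * a) * shell_norm \<Omega> p r f k) powr (1/\<kappa>)) =
          ennreal (2 powr (of_int k * a * enn2real q)) *
                     epowr (lorentz_norm (dyadic_shell \<Omega> k) p r f) (enn2real q)"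
          by (simp add: ln[OF k] q(4) powr_mult powr_powr flip: ennreal_mult)
      qed
      also have "\<dots> \<le> S"
        unfolding S_def by (subst nonneg_infsum_complete) (use F in \<open>auto intro!: SUP_upper\<close>)
      finally show "(\<Sum>k\<in>F. (2 powr (of_int k * a) * shell_norm \<Omega> p r f k) powr (1/\<kappa>)) \<le> N powr (1/\<kappa>)"
        using SN by (metis ennreal_le_iff order_trans powr_ge_zero)
    qed simp
  qed
  then show ?thesis by (simp add: N_def)
qed

lemma HL_I:
  assumes f: "f \<in> borel_measurable (lebesgue_on \<Omega>)"
    and b: "\<And>k. k \<ge> -1 \<Longrightarrow> lorentz_norm (dyadic_shell \<Omega> k) p r f \<le> ennreal (b k)"
    and B: "ell_ball \<kappa> {-1..} B (\<lambda>k. 2 powr (of_int k * a) * b k)"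
    and q: "1 \<le> q" and \<kappa>: "\<kappa> = enn2real (1 / q)"
  shows "f \<in> carr (HL \<Omega> p r a q)" "nrm (HL \<Omega> p r a q) f \<le> B"
proof -
  have B0: "0 \<le> B" using ell_ballD(1)[OF B] .
  have b0: "0 \<le> b k" if "k \<ge> -1" for k
    using ell_ballD(2)[OF B, of k] that by (simp add: zero_le_mult_iff)
  have HN: "HL_norm \<Omega> p r a q f \<le> ennreal B"
    using exponent_cases[OF q \<kappa>]
  proof (elim disjE conjE)
    assume q: "q = \<infinity>" "\<kappa> = 0"
    have "ennreal (2 powr (of_int k * a)) * lorentz_norm (dyadic_shell \<Omega> k) p r f \<le> ennreal B" if k: "k \<ge> -1" for k
    proof -
      have "ennreal (2 powr (of_int k * a)) * lorentz_norm (dyadic_shell \<Omega> k) p r f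
         \<le> ennreal (2 powr (of_int k * a)) * ennreal (b k)"
        by (intro mult_left_mono b k) simp
      also have "\<dots> = ennreal (2 powr (of_int k * a) * b k)" using b0[OF k] by (simp add: ennreal_mult)
      also have "\<dots> \<le> ennreal B" using ell_ballD(3)[OF B] k by (intro ennreal_leI) auto
      finally show ?thesis .
    qed
    then show ?thesis using q by (auto simp: HL_norm_def intro!: SUP_least)
  next
    assume q: "q \<noteq> \<infinity>" "0 < \<kappa>" "\<kappa> \<le> 1" "enn2real q = 1 / \<kappa>"
    have "(\<Sum>\<^sub>\<infinity>k\<in>{-1..}. ennreal (2 powr (of_int k * a * enn2real q)) *
                     epowr (lorentz_norm (dyadic_shell \<Omega> k) p r f) (enn2real q)) \<le> ennreal (B powr (1/\<kappa>))"
    proof (subst nonneg_infsum_complete)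
      show "(SUP F\<in>{F. finite F \<and> F \<subseteq> {-1..}}. \<Sum>k\<in>F. ennreal (2 powr (of_int k * a * enn2real q)) *
                     epowr (lorentz_norm (dyadic_shell \<Omega> k) p r f) (enn2real q)) \<le> ennreal (B powr (1/\<kappa>))"
      proof (rule SUP_least)
        fix F :: "int set" assume "F \<in> {F. finite F \<and> F \<subseteq> {-1..}}"
        then have F: "finite F" "F \<subseteq> {-1..}" by auto
        have "(\<Sum>k\<in>F. ennreal (2 powr (of_int k * a * enn2real q)) *
                     epowr (lorentz_norm (dyadic_shell \<Omega> k) p r f) (enn2real q))
           \<le> (\<Sum>k\<in>F. ennreal ((2 powr (of_int k * a) * b k) powr (1/\<kappa>)))"
        proof (rule sum_mono)
          fix k assume "k \<in> F"
          then have k: "k \<ge> -1" using F by auto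
          have "ennreal (2 powr (of_int k * a * enn2real q)) *
                     epowr (lorentz_norm (dyadic_shell \<Omega> k) p r f) (enn2real q)
             \<le> ennreal (2 powr (of_int k * a * enn2real q)) * epowr (ennreal (b k)) (enn2real q)"
            using q by (intro mult_left_mono epowr_mono b k) auto
          also have "\<dots> = ennreal ((2 powr (of_int k * a) * b k) powr (1/\<kappa>))"
            using b0[OF k] by (simp add: q(4) powr_mult powr_powr ennreal_mult)
          finally show "ennreal (2 powr (of_int k * a * enn2real q)) *
                     epowr (lorentz_norm (dyadic_shell \<Omega> k) p r f) (enn2real q) \<le> \<dots>" .
        qed
        also have "\<dots> = ennreal (\<Sum>k\<in>F. (2 powr (of_int k * a) * b k) powr (1/\<kappa>))" by simp
        also have "\<dots> \<le> ennreal (B powr (1/\<kappa>))"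
          by (intro ennreal_leI ell_ballD(4)[OF B q(2) F])
        finally show "(\<Sum>k\<in>F. ennreal (2 powr (of_int k * a * enn2real q)) *
                     epowr (lorentz_norm (dyadic_shell \<Omega> k) p r f) (enn2real q)) \<le> ennreal (B powr (1/\<kappa>))" .
      qed
    qed simp
    then have "epowr (\<Sum>\<^sub>\<infinity>k\<in>{-1..}. ennreal (2 powr (of_int k * a * enn2real q)) *
                     epowr (lorentz_norm (dyadic_shell \<Omega> k) p r f) (enn2real q)) \<kappa> \<le> epowr (ennreal (B powr (1/\<kappa>))) \<kappa>"
      using q by (intro epowr_mono)
    then show ?thesis using q B0 by (simp add: HL_norm_def powr_powr)
  qed
  then have fin: "HL_norm \<Omega> p r a q f < \<infinity>" by (rule order.strict_trans1) simp
  have "lorentz_norm (dyadic_shell \<Omega> k) p r f < \<infinity>" if "k \<ge> -1" for k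
    using b[OF that] by (rule order.strict_trans1) simp
  then show "f \<in> carr (HL \<Omega> p r a q)"
    using f fin by (auto simp: HL_simps lorentz_space_def intro: measurable_on_shell)
  show "nrm (HL \<Omega> p r a q) f \<le> B"
    using HN B0 by (simp add: HL_simps enn2real_leI)
qed

text \<open>
  This gives at once that \<open>HL\<close> is a linear space, that it is solid, and that its norm is a
  quasi-norm up to a constant factor.
\<close>

lemma HL_dominated:
  assumes \<Omega>: "\<Omega> \<in> sets lebesgue" and f: "f \<in> carr (HL \<Omega> p r a q)" and g: "g \<in> carr (HL \<Omega> p r a q)"
    and h: "h \<in> borel_measurable (lebesgue_on \<Omega>)"
    and p: "0 < p" and r: "1 \<le> r" and q: "1 \<le> q" and st: "0 \<le> s" "0 \<le> t"
    and le: "\<And>x. x \<in> \<Omega> \<Longrightarrow> cmod (h x) \<le> s * cmod (f x) + t * cmod (g x)"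
  shows "h \<in> carr (HL \<Omega> p r a q)"
    "nrm (HL \<Omega> p r a q) h \<le> 4 * lorentz_dom_const p r * (s * nrm (HL \<Omega> p r a q) f + t * nrm (HL \<Omega> p r a q) g)"
proof -
  define \<kappa> where "\<kappa> = enn2real (1 / q)"
  have \<kappa>1: "\<kappa> \<le> 1" using exponent_cases[OF q \<kappa>_def] by auto
  define M where "M = lorentz_dom_const p r"
  define b where "b = (\<lambda>k. M * (s * shell_norm \<Omega> p r f k + t * shell_norm \<Omega> p r g k))"
  have b: "lorentz_norm (dyadic_shell \<Omega> k) p r h \<le> ennreal (b k)" if k: "k \<ge> -1" for k
    unfolding b_def M_def
    by (rule lorentz_norm_dominated[OF dyadic_shell_sets[OF \<Omega>] measurable_on_shell[OF HL_D(1)[OF f]]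
          measurable_on_shell[OF HL_D(1)[OF g]] measurable_on_shell[OF h] p r _ _ st])
      (use le dyadic_shell_subset in \<open>auto simp: HL_D(2)[OF f k] HL_D(2)[OF g k]\<close>)
  have "ell_ball \<kappa> {-1..} (M * (4 * (s * nrm (HL \<Omega> p r a q) f + t * nrm (HL \<Omega> p r a q) g)))
      (\<lambda>k. M * (s * (2 powr (of_int k * a) * shell_norm \<Omega> p r f k) + t * (2 powr (of_int k * a) * shell_norm \<Omega> p r g k)))"
    using lorentz_dom_const_nonneg[of p r]
    by (intro ell_ball_scale ell_ball_add HL_ell_ball f g q \<kappa>_def st \<kappa>1) (simp add: M_def)
  moreover have "(\<lambda>k. M * (s * (2 powr (of_int k * a) * shell_norm \<Omega> p r f k) + t * (2 powr (of_int k * a) * shell_norm \<Omega> p r g k)))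
     = (\<lambda>k. 2 powr (of_int k * a) * b k)"
    by (simp add: b_def algebra_simps fun_eq_iff)
  ultimately have B: "ell_ball \<kappa> {-1..} (M * (4 * (s * nrm (HL \<Omega> p r a q) f + t * nrm (HL \<Omega> p r a q) g)))
      (\<lambda>k. 2 powr (of_int k * a) * b k)" by simp
  show "h \<in> carr (HL \<Omega> p r a q)" by (rule HL_I(1)[OF h b B q \<kappa>_def])
  show "nrm (HL \<Omega> p r a q) h \<le> 4 * lorentz_dom_const p r * (s * nrm (HL \<Omega> p r a q) f + t * nrm (HL \<Omega> p r a q) g)"
    using HL_I(2)[OF h b B q \<kappa>_def] by (simp add: M_def mult_ac)
qed

text \<open>
  The atomic estimate, shell by shell.  The null sets \<open>Z k\<close> absorb the points at which \<open>u\<close> is not controlled by any atom.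
\<close>

lemma HL_atomic:
  assumes \<Omega>: "\<Omega> \<in> sets lebesgue" and u: "u \<in> borel_measurable (lebesgue_on \<Omega>)"
    and p: "0 < p" and r: "0 < r" and q: "1 \<le> q" and \<kappa>: "\<kappa> = enn2real (1 / q)"
    and E: "\<And>k n. E k n \<in> sets lebesgue" "\<And>k n. k \<ge> -1 \<Longrightarrow> emeasure lebesgue (E k n) \<le> ennreal (2 powr real_of_int (n + 1))"
    and Z: "\<And>k. k \<ge> -1 \<Longrightarrow> Z k \<in> null_sets lebesgue"
    and uE: "\<And>k x. k \<ge> -1 \<Longrightarrow> x \<in> dyadic_shell \<Omega> k \<Longrightarrow> x \<notin> Z k \<Longrightarrow> u x \<noteq> 0 \<Longrightarrow>
        \<exists>n. x \<in> E k n \<and> cmod (u x) \<le> 2 powr (- (of_int k * a)) * 2 powr (- (real_of_int n / p)) * s k n"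
    and s: "mixed_ball \<kappa> (1/r) {-1..} B s"
  shows "u \<in> carr (HL \<Omega> p r a q)" "nrm (HL \<Omega> p r a q) u \<le> lorentz_upper_const p r * B"
proof -
  obtain b where b: "ell_ball \<kappa> {-1..} B b" "\<And>k. k \<ge> -1 \<Longrightarrow> ell_ball (1/r) UNIV (b k) (s k)"
    using s unfolding mixed_ball_def by auto
  define \<beta> where "\<beta> = (\<lambda>k. lorentz_upper_const p r * (2 powr (- (of_int k * a)) * b k))"
  have 1: "lorentz_norm (dyadic_shell \<Omega> k) p r u \<le> ennreal (\<beta> k)" if k: "k \<ge> -1" for k
    unfolding \<beta>_def
  proof (rule lorentz_norm_atomic[OF dyadic_shell_sets[OF \<Omega>] measurable_on_shell[OF u] p r _ E(1) E(2)[OF k] Z[OF k] uE[OF k]])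
    have "ell_ball (1/r) UNIV (2 powr (- (of_int k * a)) * b k) (\<lambda>n. 2 powr (- (of_int k * a)) * s k n)"
      by (intro ell_ball_scale b k) simp
    then show "ell_ball (1/r) UNIV (2 powr (- (of_int k * a)) * b k)
       (\<lambda>n. 2 powr (real_of_int n / p) * (2 powr (- (of_int k * a)) * 2 powr (- (real_of_int n / p)) * s k n))"
      by (simp add: powr_minus field_simps)
  qed
  have "ell_ball \<kappa> {-1..} (lorentz_upper_const p r * B) (\<lambda>k. lorentz_upper_const p r * b k)"
    by (intro ell_ball_scale b lorentz_upper_const_nonneg)
  then have 2: "ell_ball \<kappa> {-1..} (lorentz_upper_const p r * B) (\<lambda>k. 2 powr (of_int k * a) * \<beta> k)"
    by (simp add: \<beta>_def powr_minus field_simps)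
  show "u \<in> carr (HL \<Omega> p r a q)" "nrm (HL \<Omega> p r a q) u \<le> lorentz_upper_const p r * B"
    using HL_I[OF u 1 2 q \<kappa>] by auto
qed

text \<open>
  Hardy's inequality for averages, shell by shell.  The set \<open>P\<close> allows for indices without a suitable \<open>D k n\<close>.
\<close>

lemma HL_averages:
  assumes \<Omega>: "\<Omega> \<in> sets lebesgue" and f: "f \<in> carr (HL \<Omega> p r a q)"
    and p: "1 < p" and r: "0 < r" and q: "1 \<le> q" and \<kappa>: "\<kappa> = enn2real (1 / q)"
    and K: "K \<subseteq> {-1..}"
    and D: "\<And>k n. (k, n) \<in> P \<Longrightarrow> D k n \<in> sets lebesgue" "\<And>k n. (k, n) \<in> P \<Longrightarrow> D k n \<subseteq> dyadic_shell \<Omega> k"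
      "\<And>k n. (k, n) \<in> P \<Longrightarrow> ennreal (2 powr real_of_int n) \<le> emeasure lebesgue (D k n)"
      "\<And>k n. (k, n) \<in> P \<Longrightarrow> emeasure lebesgue (D k n) < \<infinity>"
  shows "mixed_ball \<kappa> (1/r) K (lorentz_avg_const p r * nrm (HL \<Omega> p r a q) f)
     (\<lambda>k n. if (k, n) \<in> P then 2 powr (of_int k * a) * (2 powr (real_of_int n / p) *
        mean_modulus (D k n) f) else 0)"
    and "(k, n) \<in> P \<Longrightarrow> k \<ge> -1 \<Longrightarrow> (\<integral>\<^sup>+x\<in>D k n. ennreal (cmod (f x)) \<partial>lebesgue) < \<infinity>"
proof -
  have avk: "ell_ball (1/r) {n. (k, n) \<in> P} (lorentz_avg_const p r * shell_norm \<Omega> p r f k)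
     (\<lambda>n. 2 powr (real_of_int n / p) * mean_modulus (D k n) f)"
    if k: "k \<ge> -1" for k
    by (rule lorentz_averages(1)[OF dyadic_shell_sets[OF \<Omega>, of k] measurable_on_shell[OF HL_D(1)[OF f], of k] p r
          shell_norm_nonneg[of \<Omega> p r f k]])
      (use D k in \<open>auto simp: HL_D(2)[OF f k]\<close>)
  show "(k, n) \<in> P \<Longrightarrow> k \<ge> -1 \<Longrightarrow> (\<integral>\<^sup>+x\<in>D k n. ennreal (cmod (f x)) \<partial>lebesgue) < \<infinity>"
    by (rule lorentz_averages(2)[where N = "{n. (k, n) \<in> P}" and D = "D k",
          OF dyadic_shell_sets[OF \<Omega>, of k] measurable_on_shell[OF HL_D(1)[OF f], of k] p r
          shell_norm_nonneg[of \<Omega> p r f k]]) (use D in \<open>auto simp: HL_D(2)[OF f]\<close>)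
  have "ell_ball \<kappa> K (lorentz_avg_const p r * nrm (HL \<Omega> p r a q) f)
      (\<lambda>k. lorentz_avg_const p r * (2 powr (of_int k * a) * shell_norm \<Omega> p r f k))"
    by (rule ell_ball_mono[OF ell_ball_scale[OF HL_ell_ball[OF f q \<kappa>] lorentz_avg_const_nonneg[OF p]] K])
      (use lorentz_avg_const_nonneg[OF p] in auto)
  moreover have "ell_ball (1/r) UNIV (lorentz_avg_const p r * (2 powr (of_int k * a) * shell_norm \<Omega> p r f k))
    (\<lambda>n. if (k, n) \<in> P then 2 powr (of_int k * a) * (2 powr (real_of_int n / p) *
        mean_modulus (D k n) f) else 0)"
    if k: "k \<in> K" for k
  proof -
    have "ell_ball (1/r) {n. (k, n) \<in> P} (2 powr (of_int k * a) * (lorentz_avg_const p r * shell_norm \<Omega> p r f k))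
     (\<lambda>n. 2 powr (of_int k * a) * (2 powr (real_of_int n / p) * mean_modulus (D k n) f))"
      using k K by (intro ell_ball_scale avk) auto
    from ell_ball_indicator[OF this, of UNIV] show ?thesis by (simp add: mult_ac)
  qed
  ultimately show "mixed_ball \<kappa> (1/r) K (lorentz_avg_const p r * nrm (HL \<Omega> p r a q) f)
     (\<lambda>k n. if (k, n) \<in> P then 2 powr (of_int k * a) * (2 powr (real_of_int n / p) *
        mean_modulus (D k n) f) else 0)"
    unfolding mixed_ball_def by blast
qed

section \<open>The strip, and averages as functionals\<close>

text \<open>
  The three lines theorem with equal bounds.  The factor \<open>exp (\<epsilon> (z\<^sup>2 - 1))\<close> has modulus at most \<open>1\<close> on the
  boundary of the strip and is small high up, so the maximum principle on a tall rectangle applies;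
  then \<open>\<epsilon>\<close> tends to \<open>0\<close>.
\<close>

lemma strip_maximum_modulus:
  assumes cont: "continuous_on closed_strip \<phi>" and hol: "\<phi> holomorphic_on open_strip"
    and bdd: "\<And>z. z \<in> closed_strip \<Longrightarrow> cmod (\<phi> z) \<le> B"
    and bnd: "\<And>t. cmod (\<phi> (Complex 0 t)) \<le> M" "\<And>t. cmod (\<phi> (Complex 1 t)) \<le> M"
    and z: "z \<in> closed_strip"
  shows "cmod (\<phi> z) \<le> M"
proof -
  have M0: "0 \<le> M" using bnd(1)[of 0] norm_ge_zero order_trans by blast
  have B0: "0 \<le> B" using bdd[OF z] norm_ge_zero order_trans by blast
  have key: "cmod (\<phi> z) * exp (- (\<epsilon> * (1 + (Im z)\<^sup>2))) \<le> M + \<epsilon>" if \<epsilon>: "\<epsilon> > 0" for \<epsilon>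
  proof -
    define g where "g = (\<lambda>w. \<phi> w * exp (of_real \<epsilon> * (w\<^sup>2 - 1)))"
    have gn: "cmod (g w) = cmod (\<phi> w) * exp (\<epsilon> * ((Re w)\<^sup>2 - (Im w)\<^sup>2 - 1))" for w
      by (simp add: g_def norm_mult norm_exp_eq_Re power2_eq_square)
    \<comment> \<open>High enough that \<open>B exp (- \<epsilon> T\<^sup>2) \<le> \<epsilon>\<close>, and that the rectangle contains \<open>z\<close>.\<close>
    define T where "T = \<bar>Im z\<bar> + B / \<epsilon>\<^sup>2 + 1"
    have T: "T \<ge> 1" "T > \<bar>Im z\<bar>" "B / \<epsilon>\<^sup>2 \<le> T\<^sup>2"
    proof -
      show "T \<ge> 1" "T > \<bar>Im z\<bar>" using B0 \<epsilon> by (auto simp: T_def add_nonneg_pos)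
      have "B / \<epsilon>\<^sup>2 \<le> T" by (simp add: T_def)
      also have "\<dots> \<le> T\<^sup>2" using \<open>T \<ge> 1\<close> by (simp add: self_le_power)
      finally show "B / \<epsilon>\<^sup>2 \<le> T\<^sup>2" .
    qed
    define R where "R = cbox (Complex 0 (-T)) (Complex 1 T)"
    have Rsub: "R \<subseteq> closed_strip" by (auto simp: R_def closed_strip_def in_cbox_complex_iff)
    have intR: "interior R \<subseteq> open_strip"
      by (auto simp: R_def open_strip_def interior_cbox in_box_complex_iff)
    have "cmod (g z) \<le> M + \<epsilon>"
    proof (rule maximum_modulus_frontier[of g R])
      show "g holomorphic_on interior R"
        unfolding g_def by (intro holomorphic_intros holomorphic_on_subset[OF hol intR])
      have "continuous_on R g"
        unfolding g_def by (intro continuous_intros continuous_on_subset[OF cont Rsub])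
      then show "continuous_on (closure R) g" by (simp add: R_def)
      show "bounded R" by (simp add: R_def)
      show "z \<in> R" using z T by (auto simp: R_def closed_strip_def in_cbox_complex_iff)
      fix w assume w: "w \<in> frontier R"
      then have wR: "w \<in> R" and "w \<notin> box (Complex 0 (-T)) (Complex 1 T)"
        by (auto simp: R_def frontier_cbox)
      then consider "Re w = 0" | "Re w = 1" | "\<bar>Im w\<bar> = T"
        by (fastforce simp: R_def in_cbox_complex_iff in_box_complex_iff)
      then show "cmod (g w) \<le> M + \<epsilon>"
      proof cases
        case 1
        then have "w = Complex 0 (Im w)" by (simp add: complex_eq_iff)
        then have "cmod (\<phi> w) \<le> M" using bnd(1)[of "Im w"] by simp
        moreover have "exp (\<epsilon> * ((Re w)\<^sup>2 - (Im w)\<^sup>2 - 1)) \<le> 1"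
          using 1 \<epsilon> by (auto simp: mult_le_0_iff intro: order_trans[of _ 0])
        ultimately have "cmod (g w) \<le> M * 1" unfolding gn using M0 by (intro mult_mono) auto
        then show ?thesis using \<epsilon> by simp
      next
        case 2
        then have "w = Complex 1 (Im w)" by (simp add: complex_eq_iff)
        then have "cmod (\<phi> w) \<le> M" using bnd(2)[of "Im w"] by simp
        moreover have "exp (\<epsilon> * ((Re w)\<^sup>2 - (Im w)\<^sup>2 - 1)) \<le> 1"
          using 2 \<epsilon> by (auto simp: mult_le_0_iff intro: order_trans[of _ 0])
        ultimately have "cmod (g w) \<le> M * 1" unfolding gn using M0 by (intro mult_mono) auto
        then show ?thesis using \<epsilon> by simp
      next
        case 3
        have ws: "w \<in> closed_strip" using wR Rsub by auto
        then have "(Re w)\<^sup>2 \<le> 1" by (simp add: closed_strip_def power_le_one)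
        moreover have "(Im w)\<^sup>2 = T\<^sup>2" using 3 by (metis power2_abs)
        ultimately have "\<epsilon> * ((Re w)\<^sup>2 - (Im w)\<^sup>2 - 1) \<le> - (\<epsilon> * T\<^sup>2)"
          using \<epsilon> by (simp add: algebra_simps)
        then have "cmod (g w) \<le> B * exp (- (\<epsilon> * T\<^sup>2))"
          unfolding gn using bdd[OF ws] B0 by (intro mult_mono) auto
        also have "\<dots> \<le> \<epsilon>"
        proof -
          have "B \<le> \<epsilon> * (\<epsilon> * T\<^sup>2)" using T(3) \<epsilon> by (simp add: field_simps power2_eq_square)
          also have "\<dots> \<le> \<epsilon> * exp (\<epsilon> * T\<^sup>2)"
            using \<epsilon> exp_ge_add_one_self[of "\<epsilon> * T\<^sup>2"] by (intro mult_left_mono) linarith+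
          finally show ?thesis by (simp add: exp_minus field_simps)
        qed
        finally show ?thesis using M0 by simp
      qed
    qed
    moreover have "cmod (\<phi> z) * exp (- (\<epsilon> * (1 + (Im z)\<^sup>2))) \<le> cmod (g z)"
      unfolding gn using \<epsilon> by (intro mult_left_mono) (auto simp: algebra_simps)
    ultimately show ?thesis by simp
  qed
  have "((\<lambda>\<epsilon>. cmod (\<phi> z) * exp (- (\<epsilon> * (1 + (Im z)\<^sup>2)))) \<longlongrightarrow> cmod (\<phi> z) * exp (- (0 * (1 + (Im z)\<^sup>2)))) (at_right 0)"
    by (intro tendsto_intros)
  moreover have "((\<lambda>\<epsilon>. M + \<epsilon>) \<longlongrightarrow> M + 0) (at_right 0)" by (intro tendsto_intros)
  moreover have "eventually (\<lambda>\<epsilon>. cmod (\<phi> z) * exp (- (\<epsilon> * (1 + (Im z)\<^sup>2))) \<le> M + \<epsilon>) (at_right (0::real))"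
    using key by (simp add: eventually_at_filter)
  ultimately show ?thesis
    using tendsto_le[of "at_right (0::real)"] by fastforce
qed

lemma mixed_ballD:
  assumes "mixed_ball \<kappa> \<rho> K B s" "k \<in> K"
  shows "s k n \<le> B" "0 \<le> s k n" "0 \<le> B"
proof -
  obtain b where b: "ell_ball \<kappa> K B b" "\<forall>k\<in>K. ell_ball \<rho> UNIV (b k) (s k)"
    using assms(1) unfolding mixed_ball_def by blast
  show "s k n \<le> B" "0 \<le> s k n" "0 \<le> B"
    using ell_ballD(3)[OF b(1) assms(2)] ell_ballD(2,3)[OF b(2)[rule_format, OF assms(2)], of n] ell_ballD(1)[OF b(1)]
    by auto
qed

text \<open>
  For fixed finite \<open>K\<close> the inner sums converge along the finite sets \<open>N\<close>, and the bound passes to the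
  limit.
\<close>

lemma mixed_ball_finite_sums:
  fixes y :: "'k \<Rightarrow> 'n \<Rightarrow> real"
  assumes y: "\<And>k n. 0 \<le> y k n" and \<kappa>: "0 < \<kappa>" and \<rho>: "0 < \<rho>" and B: "0 \<le> B"
    and le: "\<And>K N. finite K \<Longrightarrow> finite N \<Longrightarrow> K \<subseteq> I \<Longrightarrow>
      (\<Sum>k\<in>K. (\<Sum>n\<in>N. y k n powr (1/\<rho>)) powr (\<rho>/\<kappa>)) powr \<kappa> \<le> B"
  shows "mixed_ball \<kappa> \<rho> I B y"
proof -
  define S where "S = (\<lambda>k. infsum (\<lambda>n. y k n powr (1/\<rho>)) UNIV)"
  have summ: "(\<lambda>n. y k n powr (1/\<rho>)) summable_on UNIV" if k: "k \<in> I" for k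
  proof (rule nonneg_bdd_above_summable_on)
    have "(\<Sum>n\<in>N. y k n powr (1/\<rho>)) \<le> B powr (1/\<rho>)" if N: "finite N" for N
    proof -
      have s0: "0 \<le> (\<Sum>n\<in>N. y k n powr (1/\<rho>))" by (intro sum_nonneg) auto
      have "(\<Sum>n\<in>N. y k n powr (1/\<rho>)) powr \<rho> \<le> B"
        using le[of "{k}" N] k N \<kappa> by (simp add: powr_powr)
      then have "((\<Sum>n\<in>N. y k n powr (1/\<rho>)) powr \<rho>) powr (1/\<rho>) \<le> B powr (1/\<rho>)"
        using \<rho> by (intro powr_mono2) auto
      then show ?thesis using \<rho> s0 by (simp add: powr_powr)
    qed
    then show "bdd_above (sum (\<lambda>n. y k n powr (1/\<rho>)) ` {F. F \<subseteq> UNIV \<and> finite F})"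
      unfolding bdd_above_def by (intro exI[of _ "B powr (1/\<rho>)"]) auto
  qed auto
  have S0: "0 \<le> S k" for k unfolding S_def by (intro infsum_nonneg) auto
  define b where "b = (\<lambda>k. S k powr \<rho>)"
  have "ell_ball \<rho> UNIV (b k) (y k)" if k: "k \<in> I" for k
  proof (rule ell_ballI_sum[OF \<rho>])
    fix N :: "'n set" assume N: "finite N"
    have "(\<Sum>n\<in>N. y k n powr (1/\<rho>)) \<le> S k"
      unfolding S_def by (rule finite_sum_le_infsum[OF summ[OF k] N]) auto
    also have "\<dots> = b k powr (1/\<rho>)" using S0 \<rho> by (simp add: b_def powr_powr)
    finally show "(\<Sum>n\<in>N. y k n powr (1/\<rho>)) \<le> b k powr (1/\<rho>)" .
  qed (auto simp: b_def y)
  moreover have "ell_ball \<kappa> I B b"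
  proof (rule ell_ballI_sum[OF \<kappa> B])
    fix K assume K: "finite K" "K \<subseteq> I"
    have lim: "((\<lambda>N. \<Sum>k\<in>K. (\<Sum>n\<in>N. y k n powr (1/\<rho>)) powr (\<rho>/\<kappa>)) \<longlongrightarrow>
        (\<Sum>k\<in>K. S k powr (\<rho>/\<kappa>))) (finite_subsets_at_top UNIV)"
    proof (rule tendsto_sum)
      fix k assume "k \<in> K"
      then have "((\<lambda>n. y k n powr (1/\<rho>)) has_sum S k) UNIV"
        unfolding S_def using K summ by (intro has_sum_infsum) auto
      then have "(sum (\<lambda>n. y k n powr (1/\<rho>)) \<longlongrightarrow> S k) (finite_subsets_at_top UNIV)"
        by (simp add: has_sum_def)
      then show "((\<lambda>N. (\<Sum>n\<in>N. y k n powr (1/\<rho>)) powr (\<rho>/\<kappa>)) \<longlongrightarrow> S k powr (\<rho>/\<kappa>)) (finite_subsets_at_top UNIV)"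
        by (rule tendsto_powr') (use \<rho> \<kappa> in \<open>auto intro!: always_eventually sum_nonneg\<close>)
    qed
    have "(\<Sum>k\<in>K. S k powr (\<rho>/\<kappa>)) \<le> B powr (1/\<kappa>)"
    proof (rule tendsto_upperbound[OF lim])
      show "eventually (\<lambda>N. (\<Sum>k\<in>K. (\<Sum>n\<in>N. y k n powr (1/\<rho>)) powr (\<rho>/\<kappa>)) \<le> B powr (1/\<kappa>)) (finite_subsets_at_top UNIV)"
      proof (rule eventually_finite_subsets_at_top_weakI)
        fix N :: "'n set" assume N: "finite N"
        have s0: "0 \<le> (\<Sum>k\<in>K. (\<Sum>n\<in>N. y k n powr (1/\<rho>)) powr (\<rho>/\<kappa>))" by (intro sum_nonneg) auto
        have "((\<Sum>k\<in>K. (\<Sum>n\<in>N. y k n powr (1/\<rho>)) powr (\<rho>/\<kappa>)) powr \<kappa>) powr (1/\<kappa>) \<le> B powr (1/\<kappa>)"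
          using \<kappa> le[OF K(1) N K(2)] by (intro powr_mono2) auto
        then show "(\<Sum>k\<in>K. (\<Sum>n\<in>N. y k n powr (1/\<rho>)) powr (\<rho>/\<kappa>)) \<le> B powr (1/\<kappa>)"
          using s0 \<kappa> by (simp add: powr_powr)
      qed
    qed simp
    then show "(\<Sum>k\<in>K. b k powr (1/\<kappa>)) \<le> B powr (1/\<kappa>)" by (simp add: b_def powr_powr)
  qed (auto simp: b_def)
  ultimately show ?thesis unfolding mixed_ball_def by blast
qed

lemma HL_from_dyadic:
  assumes \<Omega>: "\<Omega> \<in> sets lebesgue" and h: "h \<in> borel_measurable (lebesgue_on \<Omega>)"
    and p: "0 < p" and r: "0 < r" and q: "1 \<le> q" and \<kappa>: "\<kappa> = enn2real (1 / q)"
    and fin: "\<And>k n. k \<ge> -1 \<Longrightarrow> dyadic_dr (dyadic_shell \<Omega> k) h n < \<infinity>"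
    and B: "mixed_ball \<kappa> (1/r) {-1..} B (\<lambda>k n. 2 powr (of_int k * a) * dyadic_seq (dyadic_shell \<Omega> k) p h n)"
  shows "h \<in> carr (HL \<Omega> p r a q)" "nrm (HL \<Omega> p r a q) h \<le> lorentz_upper_const p r * B"
proof -
  obtain b where b: "ell_ball \<kappa> {-1..} B b"
    "\<And>k. k \<ge> -1 \<Longrightarrow> ell_ball (1/r) UNIV (b k) (\<lambda>n. 2 powr (of_int k * a) * dyadic_seq (dyadic_shell \<Omega> k) p h n)"
    using B unfolding mixed_ball_def by auto
  define \<beta> where "\<beta> = (\<lambda>k. lorentz_upper_const p r * (2 powr (- (of_int k * a)) * b k))"
  have 1: "lorentz_norm (dyadic_shell \<Omega> k) p r h \<le> ennreal (\<beta> k)" if k: "k \<ge> -1" for k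
    unfolding \<beta>_def
  proof (rule lorentz_upper[OF p r])
    have "ell_ball (1/r) UNIV (2 powr (- (of_int k * a)) * b k)
        (\<lambda>n. 2 powr (- (of_int k * a)) * (2 powr (of_int k * a) * dyadic_seq (dyadic_shell \<Omega> k) p h n))"
      by (intro ell_ball_scale b k) simp
    then show "ell_ball (1/r) UNIV (2 powr (- (of_int k * a)) * b k)
       (\<lambda>n. 2 powr (real_of_int n / p) * enn2real (dyadic_dr (dyadic_shell \<Omega> k) h n))"
      by (simp add: powr_minus field_simps dyadic_seq_def)
  next
    fix n B assume *: "0 < B" "\<And>m. n \<le> m \<Longrightarrow> enn2real (dyadic_dr (dyadic_shell \<Omega> k) h m) \<le> B"
    have "dyadic_dr (dyadic_shell \<Omega> k) h (n + 1) \<le> dyadic_dr (dyadic_shell \<Omega> k) h n"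
      by (rule dr_antimono) simp
    also have "\<dots> = ennreal (enn2real (dyadic_dr (dyadic_shell \<Omega> k) h n))" using fin[OF k, of n] by simp
    also have "\<dots> \<le> ennreal B" by (intro ennreal_leI *) simp
    finally show "dyadic_dr (dyadic_shell \<Omega> k) h (n + 1) \<le> ennreal B" .
  qed
  have "ell_ball \<kappa> {-1..} (lorentz_upper_const p r * B) (\<lambda>k. lorentz_upper_const p r * b k)"
    by (intro ell_ball_scale b lorentz_upper_const_nonneg)
  then have 2: "ell_ball \<kappa> {-1..} (lorentz_upper_const p r * B) (\<lambda>k. 2 powr (of_int k * a) * \<beta> k)"
    by (simp add: \<beta>_def powr_minus field_simps)
  show "h \<in> carr (HL \<Omega> p r a q)" "nrm (HL \<Omega> p r a q) h \<le> lorentz_upper_const p r * B"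
    using HL_I[OF h 1 2 q \<kappa>] by auto
qed

text \<open>
  The factor \<open>\<sigma>\<close> will be the conjugate phase of a fixed function, so that the average of that function
  becomes the mean of its modulus.
\<close>

definition weighted_average :: "'a::euclidean_space set \<Rightarrow> ('a \<Rightarrow> complex) \<Rightarrow> ('a \<Rightarrow> complex) \<Rightarrow> complex" where
  "weighted_average D \<sigma> u = (\<integral>x. u x * \<sigma> x \<partial>(lebesgue_on D)) / of_real (measure lebesgue D)"

lemma HL_weighted_average:
  assumes \<Omega>: "\<Omega> \<in> sets lebesgue" and u: "u \<in> carr (HL \<Omega> p r a q)"
    and p: "1 < p" and r: "0 < r" and q: "1 \<le> q"
    and k: "k \<ge> -1"
    and D: "D \<in> sets lebesgue" "D \<subseteq> dyadic_shell \<Omega> k"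
      "ennreal (2 powr real_of_int n) \<le> emeasure lebesgue D" "emeasure lebesgue D < \<infinity>"
    and \<sigma>: "\<sigma> \<in> borel_measurable (lebesgue_on \<Omega>)" "\<And>x. cmod (\<sigma> x) \<le> 1"
  shows "integrable (lebesgue_on D) (\<lambda>x. u x * \<sigma> x)"
    and "cmod (weighted_average D \<sigma> u) \<le> mean_modulus D u"
    and "cmod (weighted_average D \<sigma> u) \<le>
      lorentz_avg_const p r * 2 powr (- (of_int k * a)) * 2 powr (- (real_of_int n / p)) * nrm (HL \<Omega> p r a q) u"
proof -
  define I where "I = (\<integral>\<^sup>+x\<in>D. ennreal (cmod (u x)) \<partial>lebesgue)"
  have fin: "I < \<infinity>"
    unfolding I_def
    by (rule HL_averages(2)[OF \<Omega> u p r q refl, where P = "{(k, n)}" and D = "\<lambda>k n. D" and K = "{}" and k = k and n = n])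
      (use D k in auto)
  have D\<Omega>: "D \<subseteq> \<Omega>" using D(2) dyadic_shell_subset by blast
  have meas: "u \<in> borel_measurable (lebesgue_on D)" "\<sigma> \<in> borel_measurable (lebesgue_on D)"
    using HL_D(1)[OF u] \<sigma>(1) D\<Omega> by (auto intro: measurable_restrict_mono)
  have le: "(\<integral>\<^sup>+x. ennreal (cmod (u x * \<sigma> x)) \<partial>(lebesgue_on D)) \<le> I"
  proof -
    have "cmod (u x * \<sigma> x) \<le> cmod (u x)" for x
      using mult_left_mono[OF \<sigma>(2)[of x], of "cmod (u x)"] by (simp add: norm_mult)
    then have "(\<integral>\<^sup>+x. ennreal (cmod (u x * \<sigma> x)) \<partial>(lebesgue_on D)) \<le> (\<integral>\<^sup>+x. ennreal (cmod (u x)) \<partial>(lebesgue_on D))"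
      by (intro nn_integral_mono ennreal_leI)
    also have "\<dots> = I" unfolding I_def using D(1) by (subst nn_integral_restrict_space) auto
    finally show ?thesis .
  qed
  show int: "integrable (lebesgue_on D) (\<lambda>x. u x * \<sigma> x)"
  proof (rule integrableI_bounded)
    show "(\<lambda>x. u x * \<sigma> x) \<in> borel_measurable (lebesgue_on D)" using meas by measurable
    show "(\<integral>\<^sup>+x. ennreal (norm (u x * \<sigma> x)) \<partial>(lebesgue_on D)) < \<infinity>"
      using le fin by (rule order.strict_trans1)
  qed
  have "ennreal (cmod (\<integral>x. u x * \<sigma> x \<partial>(lebesgue_on D))) \<le> I"
    using integral_norm_bound_ennreal[OF int] le by (rule order_trans)
  then have "cmod (\<integral>x. u x * \<sigma> x \<partial>(lebesgue_on D)) \<le> enn2real I"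
    using fin by (metis enn2real_ennreal enn2real_mono infinity_ennreal_def norm_ge_zero)
  then have 1: "cmod (weighted_average D \<sigma> u) \<le> mean_modulus D u"
    unfolding weighted_average_def mean_modulus_def I_def[symmetric]
    by (simp add: norm_divide divide_right_mono)
  then show "cmod (weighted_average D \<sigma> u) \<le> mean_modulus D u" .
  have "mixed_ball (enn2real (1/q)) (1/r) {k} (lorentz_avg_const p r * nrm (HL \<Omega> p r a q) u)
     (\<lambda>k' n'. if (k', n') \<in> {(k, n)} then 2 powr (of_int k' * a) * (2 powr (real_of_int n' / p) *
        mean_modulus D u) else 0)"
    by (rule HL_averages(1)[OF \<Omega> u p r q refl]) (use D k in auto)
  from mixed_ballD(1)[OF this, of k n]
  have "2 powr (of_int k * a) * (2 powr (real_of_int n / p) * (mean_modulus D u))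
    \<le> lorentz_avg_const p r * nrm (HL \<Omega> p r a q) u" by simp
  then have "mean_modulus D u \<le>
     2 powr (- (of_int k * a)) * 2 powr (- (real_of_int n / p)) * (lorentz_avg_const p r * nrm (HL \<Omega> p r a q) u)"
    by (simp add: powr_minus field_simps)
  with 1 show "cmod (weighted_average D \<sigma> u) \<le>
      lorentz_avg_const p r * 2 powr (- (of_int k * a)) * 2 powr (- (real_of_int n / p)) * nrm (HL \<Omega> p r a q) u"
    by (simp add: mult_ac)
qed

text \<open>
  The norm on \<open>calderon_F\<close> contains suprema of real numbers, which are meaningful only for bounded
  families.  Outside a compact interval the decay at infinity gives a bound.  On the interval, continuity
  gives a bound near every point by the quasi-triangle inequality, and a Bolzano argument patches
  these together.
\<close>

lemma boundary_admissible_bounded: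
  assumes \<Omega>: "\<Omega> \<in> sets lebesgue" and p: "0 < p" and r: "1 \<le> r" and q: "1 \<le> q"
    and h: "boundary_admissible (HL \<Omega> p r a q) h"
  shows "bdd_above (range (\<lambda>t. nrm (HL \<Omega> p r a q) (h t)))"
proof -
  define A where "A = HL \<Omega> p r a q"
  define C where "C = 4 * lorentz_dom_const p r"
  have C0: "0 \<le> C" using lorentz_dom_const_nonneg by (simp add: C_def)
  have hA: "h t \<in> carr A" for t
    using h by (auto simp: boundary_admissible_def fspace_continuous_on_def A_def)
  have lim: "((\<lambda>w. nrm A (\<lambda>u. h w u - h z u)) \<longlongrightarrow> 0) (at z)" for z
    using h by (auto simp: boundary_admissible_def fspace_continuous_on_def A_def)
  have "((\<lambda>t. nrm A (h t)) \<longlongrightarrow> 0) at_infinity"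
    using h by (auto simp: boundary_admissible_def A_def)
  then have "eventually (\<lambda>t. nrm A (h t) < 1) at_infinity" by (rule order_tendstoD(2)) simp
  then obtain R where R: "\<And>t. \<bar>t\<bar> \<ge> R \<Longrightarrow> nrm A (h t) < 1"
    by (auto simp: eventually_at_infinity)
  define R' where "R' = \<bar>R\<bar>"
  have diff: "(\<lambda>u. h w u - h z u) \<in> carr A" for w z
    unfolding A_def
  proof (rule HL_dominated(1)[OF \<Omega> hA[unfolded A_def] hA[unfolded A_def] _ p r q, where s = 1 and t = 1])
    show "(\<lambda>u. h w u - h z u) \<in> borel_measurable (lebesgue_on \<Omega>)"
      using HL_D(1)[OF hA[unfolded A_def]] by (intro borel_measurable_diff)
    show "cmod (h w x - h z x) \<le> 1 * cmod (h w x) + 1 * cmod (h z x)" for x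
      using norm_triangle_ineq4 by simp
  qed auto
  have quasi: "nrm A (h w) \<le> C * (nrm A (\<lambda>u. h w u - h z u) + nrm A (h z))" for w z
  proof -
    have "nrm A (h w) \<le> C * (1 * nrm A (\<lambda>u. h w u - h z u) + 1 * nrm A (h z))"
      unfolding A_def C_def
    proof (rule HL_dominated(2)[OF \<Omega> diff[unfolded A_def] hA[unfolded A_def] HL_D(1)[OF hA[unfolded A_def]] p r q])
      show "cmod (h w x) \<le> 1 * cmod (h w x - h z x) + 1 * cmod (h z x)" for x
        using norm_triangle_sub[of "h w x" "h z x"] by simp
    qed auto
    then show ?thesis by simp
  qed
  have "\<exists>M. \<forall>t\<in>{-R'..R'}. nrm A (h t) \<le> M"
  proof (rule Bolzano[of "-R'" R' "\<lambda>a b. \<exists>M. \<forall>t\<in>{a..b}. nrm A (h t) \<le> M"])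
    show "- R' \<le> R'" by (simp add: R'_def)
  next
    fix a b c :: real
    assume "\<exists>M. \<forall>t\<in>{a..b}. nrm A (h t) \<le> M" "\<exists>M. \<forall>t\<in>{b..c}. nrm A (h t) \<le> M"
    then obtain M N where MN: "\<forall>t\<in>{a..b}. nrm A (h t) \<le> M" "\<forall>t\<in>{b..c}. nrm A (h t) \<le> N" by blast
    have "nrm A (h t) \<le> max M N" if "t \<in> {a..c}" for t
    proof (cases "t \<le> b")
      case True
      then have "nrm A (h t) \<le> M" using MN(1) that by auto
      then show ?thesis by simp
    next
      case False
      then have "nrm A (h t) \<le> N" using MN(2) that by auto
      then show ?thesis by simp
    qed
    then show "\<exists>M. \<forall>t\<in>{a..c}. nrm A (h t) \<le> M" by blast
  next
    fix x :: real
    have "eventually (\<lambda>w. nrm A (\<lambda>u. h w u - h x u) < 1) (at x)"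
      using lim[of x] by (rule order_tendstoD(2)) simp
    then obtain d where d: "d > 0" "\<And>w. w \<noteq> x \<Longrightarrow> dist w x < d \<Longrightarrow> nrm A (\<lambda>u. h w u - h x u) < 1"
      by (auto simp: eventually_at)
    have "nrm A (h w) \<le> max (nrm A (h x)) (C * (1 + nrm A (h x)))" if "dist w x < d" for w
    proof (cases "w = x")
      case False
      have "nrm A (h w) \<le> C * (nrm A (\<lambda>u. h w u - h x u) + nrm A (h x))" by (rule quasi)
      also have "\<dots> \<le> C * (1 + nrm A (h x))"
        using d(2)[OF False that] C0 by (intro mult_left_mono) auto
      finally show ?thesis by simp
    qed simp
    then have "\<forall>a b. a \<le> x \<and> x \<le> b \<and> b - a < d \<longrightarrow> (\<forall>t\<in>{a..b}. nrm A (h t) \<le> max (nrm A (h x)) (C * (1 + nrm A (h x))))"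
      by (auto simp: dist_real_def)
    then show "\<exists>d>0. \<forall>a b. a \<le> x \<and> x \<le> b \<and> b - a < d \<longrightarrow> (\<exists>M. \<forall>t\<in>{a..b}. nrm A (h t) \<le> M)"
      using d(1) by blast
  qed
  then obtain M where M: "\<And>t. t \<in> {-R'..R'} \<Longrightarrow> nrm A (h t) \<le> M" by blast
  have "nrm A (h t) \<le> max M 1" for t
  proof (cases "t \<in> {-R'..R'}")
    case False
    then have "\<bar>t\<bar> \<ge> R" by (auto simp: R'_def)
    then show ?thesis using R[of t] by simp
  qed (use M[of t] in simp)
  then show ?thesis unfolding A_def[symmetric] by (intro bdd_aboveI[of _ "max M 1"]) auto
qed

section \<open>The couple and its sum space\<close>

lemma HL_linear:
  assumes \<Omega>: "\<Omega> \<in> sets lebesgue" and p: "0 < p" and r: "1 \<le> r" and q: "1 \<le> q"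
    and u: "u \<in> carr (HL \<Omega> p r a q)" and v: "v \<in> carr (HL \<Omega> p r a q)"
  shows "(\<lambda>x. s * u x + t * v x) \<in> carr (HL \<Omega> p r a q)"
proof (rule HL_dominated(1)[OF \<Omega> u v _ p r q, where s = "cmod s" and t = "cmod t"])
  show "(\<lambda>x. s * u x + t * v x) \<in> borel_measurable (lebesgue_on \<Omega>)"
    using HL_D(1)[OF u] HL_D(1)[OF v] by measurable
  show "cmod (s * u x + t * v x) \<le> cmod s * cmod (u x) + cmod t * cmod (v x)" for x
    using norm_triangle_ineq[of "s * u x" "t * v x"] by (simp add: norm_mult)
qed auto

lemma powr_le_add_one:
  fixes g x :: real
  assumes "0 \<le> g" "0 \<le> x" "x \<le> 1"
  shows "g powr x \<le> g + 1"
proof (cases "g \<le> 1")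
  case True
  then have "g powr x \<le> 1" using assms by (simp add: powr_le1)
  then show ?thesis using assms by simp
next
  case False
  then have "g powr x \<le> g powr 1" using assms by (intro powr_mono) auto
  then show ?thesis using assms by simp
qed

locale HL_couple =
  fixes \<Omega> :: "'a::euclidean_space set"
    and \<theta> p\<^sub>0 p\<^sub>1 r\<^sub>0 r\<^sub>1 a\<^sub>0 a\<^sub>1 p r a :: real
    and q\<^sub>0 q\<^sub>1 q :: ennreal
  assumes \<Omega>: "\<Omega> \<in> sets lebesgue"
    and \<theta>: "0 < \<theta>" "\<theta> < 1"
    and r0: "1 < r\<^sub>0" "r\<^sub>0 \<le> p\<^sub>0"
    and r1: "1 < r\<^sub>1" "r\<^sub>1 \<le> p\<^sub>1"
    and q01: "1 \<le> q\<^sub>0" "1 \<le> q\<^sub>1" "\<not> (q\<^sub>0 = \<infinity> \<and> q\<^sub>1 = \<infinity>)"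
    and p_eq: "1 / p = (1 - \<theta>) / p\<^sub>0 + \<theta> / p\<^sub>1"
    and q_eq: "1 / q = ennreal (1 - \<theta>) / q\<^sub>0 + ennreal \<theta> / q\<^sub>1"
    and r_eq: "1 / r = (1 - \<theta>) / r\<^sub>0 + \<theta> / r\<^sub>1"
    and a_eq: "a = (1 - \<theta>) * a\<^sub>0 + \<theta> * a\<^sub>1"
begin

abbreviation "A\<^sub>0 \<equiv> HL \<Omega> p\<^sub>0 r\<^sub>0 a\<^sub>0 q\<^sub>0"
abbreviation "A\<^sub>1 \<equiv> HL \<Omega> p\<^sub>1 r\<^sub>1 a\<^sub>1 q\<^sub>1"
abbreviation "A \<equiv> HL \<Omega> p r a q"
abbreviation "S \<equiv> sum_fspace A\<^sub>0 A\<^sub>1"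
abbreviation "\<kappa>\<^sub>0 \<equiv> enn2real (1 / q\<^sub>0)"
abbreviation "\<kappa>\<^sub>1 \<equiv> enn2real (1 / q\<^sub>1)"
abbreviation "\<kappa> \<equiv> enn2real (1 / q)"

lemma p01: "1 < p\<^sub>0" "1 < p\<^sub>1"
  using r0 r1 by auto

lemma convex_reciprocal_gt_1:
  assumes "1 < s" "1 < t" "1 / u = (1 - \<theta>) / s + \<theta> / t"
  shows "1 < (u::real)"
proof -
  have "(1 - \<theta>) * 1 < (1 - \<theta>) * s" "\<theta> * 1 < \<theta> * t"
    using assms \<theta> by (auto intro!: mult_strict_left_mono)
  then have "(1 - \<theta>) / s < 1 - \<theta>" "\<theta> / t < \<theta>" "0 < (1 - \<theta>) / s" "0 < \<theta> / t"
    using assms \<theta> by (simp_all add: divide_less_eq)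
  then have "0 < 1 / u" "1 / u < 1" using assms by linarith+
  then show ?thesis by (simp add: field_simps zero_less_divide_iff)
qed

lemma p1: "1 < p" using convex_reciprocal_gt_1[OF p01 p_eq] .
lemma r1': "1 < r" using convex_reciprocal_gt_1[OF r0(1) r1(1) r_eq] .

lemma exps: "0 < p\<^sub>0" "0 < p\<^sub>1" "0 < p" "0 < r\<^sub>0" "0 < r\<^sub>1" "0 < r" "1 \<le> r\<^sub>0" "1 \<le> r\<^sub>1" "1 \<le> r"
  using p01 p1 r1' r0 r1 by auto

lemma weight_interpolation:
  fixes t :: real
  shows "(2 powr (t * a\<^sub>0)) powr (1 - \<theta>) * (2 powr (t * a\<^sub>1)) powr \<theta> = 2 powr (t * a)"
    and "(2 powr (t / p\<^sub>0)) powr (1 - \<theta>) * (2 powr (t / p\<^sub>1)) powr \<theta> = 2 powr (t / p)"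
proof -
  have "t * a\<^sub>0 * (1 - \<theta>) + t * a\<^sub>1 * \<theta> = t * a" by (simp add: a_eq algebra_simps)
  then show "(2 powr (t * a\<^sub>0)) powr (1 - \<theta>) * (2 powr (t * a\<^sub>1)) powr \<theta> = 2 powr (t * a)"
    unfolding powr_powr powr_add[symmetric] by simp
  have "t / p\<^sub>0 * (1 - \<theta>) + t / p\<^sub>1 * \<theta> = t * (1 / p)" unfolding p_eq by (simp add: algebra_simps)
  then show "(2 powr (t / p\<^sub>0)) powr (1 - \<theta>) * (2 powr (t / p\<^sub>1)) powr \<theta> = 2 powr (t / p)"
    unfolding powr_powr powr_add[symmetric] by simp
qed

lemma kappa01: "0 \<le> \<kappa>\<^sub>0" "\<kappa>\<^sub>0 \<le> 1" "0 \<le> \<kappa>\<^sub>1" "\<kappa>\<^sub>1 \<le> 1" "0 < \<kappa>\<^sub>0 \<or> 0 < \<kappa>\<^sub>1"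
  using exponent_cases[OF q01(1) refl] exponent_cases[OF q01(2) refl] q01(3) by auto

lemma one_div_q: "1 / q = ennreal ((1 - \<theta>) * \<kappa>\<^sub>0 + \<theta> * \<kappa>\<^sub>1)"
proof -
  have *: "1 / s = ennreal (enn2real (1 / s))" if "1 \<le> s" for s :: ennreal
  proof -
    have "1 / s \<le> 1" using that by (simp add: divide_le_posI_ennreal order.strict_trans2[OF zero_less_one])
    then have "1 / s < \<infinity>" by (rule order.strict_trans1) simp
    then show ?thesis by simp
  qed
  have "ennreal (1 - \<theta>) / q\<^sub>0 = ennreal (1 - \<theta>) * (1 / q\<^sub>0)" "ennreal \<theta> / q\<^sub>1 = ennreal \<theta> * (1 / q\<^sub>1)"
    by (simp_all add: ennreal_times_divide)
  then have "1 / q = ennreal (1 - \<theta>) * ennreal \<kappa>\<^sub>0 + ennreal \<theta> * ennreal \<kappa>\<^sub>1"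
    unfolding q_eq by (simp only: *[OF q01(1), symmetric] *[OF q01(2), symmetric])
  also have "\<dots> = ennreal ((1 - \<theta>) * \<kappa>\<^sub>0) + ennreal (\<theta> * \<kappa>\<^sub>1)"
    using \<theta> by (simp add: ennreal_mult)
  also have "\<dots> = ennreal ((1 - \<theta>) * \<kappa>\<^sub>0 + \<theta> * \<kappa>\<^sub>1)"
    using \<theta> kappa01 by (intro ennreal_plus[symmetric]) auto
  finally show ?thesis .
qed

lemma kappa: "\<kappa> = (1 - \<theta>) * \<kappa>\<^sub>0 + \<theta> * \<kappa>\<^sub>1" "0 < \<kappa>" "\<kappa> \<le> 1"
proof -
  show 1: "\<kappa> = (1 - \<theta>) * \<kappa>\<^sub>0 + \<theta> * \<kappa>\<^sub>1"
    unfolding one_div_q by (rule enn2real_ennreal) (use \<theta> kappa01 in simp)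
  have "0 \<le> (1 - \<theta>) * \<kappa>\<^sub>0" "0 \<le> \<theta> * \<kappa>\<^sub>1" using \<theta> kappa01 by auto
  moreover have "0 < (1 - \<theta>) * \<kappa>\<^sub>0 \<or> 0 < \<theta> * \<kappa>\<^sub>1" using \<theta> kappa01 by auto
  ultimately show "0 < \<kappa>" unfolding 1 by linarith
  have "(1 - \<theta>) * \<kappa>\<^sub>0 \<le> (1 - \<theta>) * 1" "\<theta> * \<kappa>\<^sub>1 \<le> \<theta> * 1"
    using \<theta> kappa01 by (auto intro: mult_left_mono)
  then have "(1 - \<theta>) * \<kappa>\<^sub>0 + \<theta> * \<kappa>\<^sub>1 \<le> (1 - \<theta>) * 1 + \<theta> * 1" by (rule add_mono)
  then show "\<kappa> \<le> 1" unfolding 1 by simp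
qed

lemma q1: "1 \<le> q"
proof (cases q)
  case (real s)
  have \<kappa>1: "(1 - \<theta>) * \<kappa>\<^sub>0 + \<theta> * \<kappa>\<^sub>1 \<le> 1" using kappa by simp
  have "s \<noteq> 0"
  proof
    assume "s = 0"
    then have "1 / q = \<infinity>" using real by (simp add: ennreal_divide_zero)
    then show False using one_div_q by simp
  qed
  then have s: "s > 0" using real by simp
  then have "1 / q = ennreal (1 / s)" using real by (simp add: divide_ennreal flip: ennreal_1)
  then have "1 / s = \<kappa>" using s by simp
  then have "1 / s \<le> 1" using kappa by simp
  then have "1 \<le> s" using s by (simp add: divide_le_eq)
  then show ?thesis using real by (simp flip: ennreal_1)
qed simp

lemma carr_sum: "u \<in> carr S \<longleftrightarrow> (\<exists>x\<^sub>0\<in>carr A\<^sub>0. \<exists>x\<^sub>1\<in>carr A\<^sub>1. u = (\<lambda>x. x\<^sub>0 x + x\<^sub>1 x))"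
  by (auto simp: sum_fspace_def)

lemma sum_linear:
  assumes "u \<in> carr S" "v \<in> carr S"
  shows "(\<lambda>x. s * u x + t * v x) \<in> carr S"
proof -
  obtain u\<^sub>0 u\<^sub>1 where u: "u\<^sub>0 \<in> carr A\<^sub>0" "u\<^sub>1 \<in> carr A\<^sub>1" "u = (\<lambda>x. u\<^sub>0 x + u\<^sub>1 x)"
    using assms(1) by (auto simp: carr_sum)
  obtain v\<^sub>0 v\<^sub>1 where v: "v\<^sub>0 \<in> carr A\<^sub>0" "v\<^sub>1 \<in> carr A\<^sub>1" "v = (\<lambda>x. v\<^sub>0 x + v\<^sub>1 x)"
    using assms(2) by (auto simp: carr_sum)
  have 0: "(\<lambda>x. s * u\<^sub>0 x + t * v\<^sub>0 x) \<in> carr A\<^sub>0"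
    by (rule HL_linear) (use \<Omega> exps q01 u v in auto)
  have 1: "(\<lambda>x. s * u\<^sub>1 x + t * v\<^sub>1 x) \<in> carr A\<^sub>1"
    by (rule HL_linear) (use \<Omega> exps q01 u v in auto)
  have 2: "(\<lambda>x. s * u x + t * v x) = (\<lambda>x. (s * u\<^sub>0 x + t * v\<^sub>0 x) + (s * u\<^sub>1 x + t * v\<^sub>1 x))"
    using u v by (auto simp: algebra_simps)
  show ?thesis unfolding carr_sum by (rule bexI[OF _ 0], rule bexI[OF _ 1], rule 2)
qed

lemma sum_measurable:
  assumes "u \<in> carr S"
  shows "u \<in> borel_measurable (lebesgue_on \<Omega>)"
proof -
  obtain u\<^sub>0 u\<^sub>1 where u: "u\<^sub>0 \<in> carr A\<^sub>0" "u\<^sub>1 \<in> carr A\<^sub>1" "u = (\<lambda>x. u\<^sub>0 x + u\<^sub>1 x)"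
    using assms by (auto simp: carr_sum)
  show ?thesis unfolding u(3) using HL_D(1)[OF u(1)] HL_D(1)[OF u(2)] by measurable
qed

lemma nrm_sum_le:
  assumes "x\<^sub>0 \<in> carr A\<^sub>0" "x\<^sub>1 \<in> carr A\<^sub>1"
  shows "nrm S (\<lambda>u. x\<^sub>0 u + x\<^sub>1 u) \<le> nrm A\<^sub>0 x\<^sub>0 + nrm A\<^sub>1 x\<^sub>1"
  unfolding sum_fspace_def fspace.simps
  by (rule cInf_lower) (use assms in \<open>auto intro!: bdd_belowI[of _ 0]\<close>)

lemma nrm_sum_greatest:
  assumes "u \<in> carr S"
    and "\<And>x\<^sub>0 x\<^sub>1. x\<^sub>0 \<in> carr A\<^sub>0 \<Longrightarrow> x\<^sub>1 \<in> carr A\<^sub>1 \<Longrightarrow> u = (\<lambda>x. x\<^sub>0 x + x\<^sub>1 x) \<Longrightarrow> m \<le> nrm A\<^sub>0 x\<^sub>0 + nrm A\<^sub>1 x\<^sub>1"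
  shows "m \<le> nrm S u"
  unfolding sum_fspace_def fspace.simps
  by (rule cInf_greatest) (use assms in \<open>auto simp: carr_sum\<close>)

lemma nrm_sum_nonneg: "u \<in> carr S \<Longrightarrow> 0 \<le> nrm S u"
  by (rule nrm_sum_greatest) auto

lemma sum_superlevel_finite:
  assumes "h \<in> carr S" "k \<ge> -1" "0 < l"
  shows "emeasure lebesgue {x\<in>dyadic_shell \<Omega> k. l < cmod (h x)} < \<infinity>"
proof -
  obtain u\<^sub>0 u\<^sub>1 where u: "u\<^sub>0 \<in> carr A\<^sub>0" "u\<^sub>1 \<in> carr A\<^sub>1" "h = (\<lambda>x. u\<^sub>0 x + u\<^sub>1 x)"
    using assms by (auto simp: carr_sum)
  let ?B = "dyadic_shell \<Omega> k"
  note m = measurable_on_shell[OF HL_D(1)[OF u(1)], of k] measurable_on_shell[OF HL_D(1)[OF u(2)], of k]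
  let ?U = "{x\<in>?B. l/2 < cmod (u\<^sub>0 x)}" and ?V = "{x\<in>?B. l/2 < cmod (u\<^sub>1 x)}"
  have "{x\<in>?B. l < cmod (h x)} \<subseteq> ?U \<union> ?V"
  proof
    fix x assume x: "x \<in> {x\<in>?B. l < cmod (h x)}"
    have "cmod (h x) \<le> cmod (u\<^sub>0 x) + cmod (u\<^sub>1 x)" unfolding u(3) by (rule norm_triangle_ineq)
    then have "l/2 < cmod (u\<^sub>0 x) \<or> l/2 < cmod (u\<^sub>1 x)" using x by auto
    then show "x \<in> ?U \<union> ?V" using x by blast
  qed
  then have "emeasure lebesgue {x\<in>?B. l < cmod (h x)} \<le> emeasure lebesgue (?U \<union> ?V)"
    by (rule emeasure_mono) (intro sets.Un superlevel_sets dyadic_shell_sets \<Omega> m)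
  also have "\<dots> \<le> emeasure lebesgue ?U + emeasure lebesgue ?V"
    by (intro emeasure_subadditive superlevel_sets dyadic_shell_sets \<Omega> m)
  also have "\<dots> < \<infinity>"
  proof -
    have "emeasure lebesgue ?U < \<infinity>"
      by (rule lorentz_superlevel_finite[OF dyadic_shell_sets[OF \<Omega>] m(1) exps(1,4) shell_norm_nonneg])
        (use HL_D(2)[OF u(1) assms(2)] assms in auto)
    moreover have "emeasure lebesgue ?V < \<infinity>"
      by (rule lorentz_superlevel_finite[OF dyadic_shell_sets[OF \<Omega>] m(2) exps(2,5) shell_norm_nonneg])
        (use HL_D(2)[OF u(2) assms(2)] assms in auto)
    ultimately show ?thesis by simp
  qed
  finally show ?thesis .
qed

text \<open>
  The averages are bounded linear functionals on \<open>A\<^sub>0 + A\<^sub>1\<close>: on each summand by \<open>HL_weighted_average\<close>,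
  and on the sum because every decomposition gives a bound.
\<close>

lemma sum_weighted_average:
  assumes k: "k \<ge> -1"
    and D: "D \<in> sets lebesgue" "D \<subseteq> dyadic_shell \<Omega> k"
      "ennreal (2 powr real_of_int n) \<le> emeasure lebesgue D" "emeasure lebesgue D < \<infinity>"
    and \<sigma>: "\<sigma> \<in> borel_measurable (lebesgue_on \<Omega>)" "\<And>x. cmod (\<sigma> x) \<le> 1"
  obtains C where "0 \<le> C" "\<And>u. u \<in> carr S \<Longrightarrow> integrable (lebesgue_on D) (\<lambda>x. u x * \<sigma> x)"
    "\<And>u. u \<in> carr S \<Longrightarrow> cmod (weighted_average D \<sigma> u) \<le> C * nrm S u"
proof -
  note w0 = HL_weighted_average[OF \<Omega> _ p01(1) exps(4) q01(1) k D \<sigma>]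
  note w1 = HL_weighted_average[OF \<Omega> _ p01(2) exps(5) q01(2) k D \<sigma>]
  define C0 where "C0 = lorentz_avg_const p\<^sub>0 r\<^sub>0 * 2 powr (- (of_int k * a\<^sub>0)) * 2 powr (- (real_of_int n / p\<^sub>0))"
  define C1 where "C1 = lorentz_avg_const p\<^sub>1 r\<^sub>1 * 2 powr (- (of_int k * a\<^sub>1)) * 2 powr (- (real_of_int n / p\<^sub>1))"
  define C where "C = max C0 C1 + 1"
  have C: "0 < C" "C0 \<le> C" "C1 \<le> C"
    using lorentz_avg_const_nonneg[OF p01(1), of r\<^sub>0] by (auto simp: C_def C0_def add_nonneg_pos le_max_iff_disj)
  have int: "integrable (lebesgue_on D) (\<lambda>x. u x * \<sigma> x)" if "u \<in> carr S" for u
  proof -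
    obtain u\<^sub>0 u\<^sub>1 where u: "u\<^sub>0 \<in> carr A\<^sub>0" "u\<^sub>1 \<in> carr A\<^sub>1" "u = (\<lambda>x. u\<^sub>0 x + u\<^sub>1 x)"
      using \<open>u \<in> carr S\<close> by (auto simp: carr_sum)
    show ?thesis unfolding u(3) distrib_right
      by (rule Bochner_Integration.integrable_add[OF w0(1)[OF u(1)] w1(1)[OF u(2)]])
  qed
  have bnd: "cmod (weighted_average D \<sigma> u) \<le> C * nrm S u" if uS: "u \<in> carr S" for u
  proof -
    have "cmod (weighted_average D \<sigma> u) / C \<le> nrm S u"
    proof (rule nrm_sum_greatest[OF uS])
      fix u\<^sub>0 u\<^sub>1 assume u: "u\<^sub>0 \<in> carr A\<^sub>0" "u\<^sub>1 \<in> carr A\<^sub>1" "u = (\<lambda>x. u\<^sub>0 x + u\<^sub>1 x)"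
      have "weighted_average D \<sigma> u = weighted_average D \<sigma> u\<^sub>0 + weighted_average D \<sigma> u\<^sub>1"
        unfolding weighted_average_def u(3) distrib_right
        by (subst Bochner_Integration.integral_add[OF w0(1)[OF u(1)] w1(1)[OF u(2)]]) (rule add_divide_distrib)
      then have "cmod (weighted_average D \<sigma> u) \<le> cmod (weighted_average D \<sigma> u\<^sub>0) + cmod (weighted_average D \<sigma> u\<^sub>1)"
        by (simp add: norm_triangle_ineq)
      also have "\<dots> \<le> C0 * nrm A\<^sub>0 u\<^sub>0 + C1 * nrm A\<^sub>1 u\<^sub>1"
        using w0(3)[OF u(1)] w1(3)[OF u(2)] by (intro add_mono) (auto simp: C0_def C1_def)
      also have "\<dots> \<le> C * nrm A\<^sub>0 u\<^sub>0 + C * nrm A\<^sub>1 u\<^sub>1"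
        using C by (intro add_mono mult_right_mono) auto
      finally show "cmod (weighted_average D \<sigma> u) / C \<le> nrm A\<^sub>0 u\<^sub>0 + nrm A\<^sub>1 u\<^sub>1"
        using C by (simp add: pos_divide_le_eq algebra_simps)
    qed
    then show ?thesis using C by (simp add: pos_divide_le_eq mult.commute)
  qed
  show ?thesis by (rule that[OF less_imp_le[OF C(1)] int bnd])
qed

text \<open>
  A bounded functional carries continuity and differentiability in \<open>A\<^sub>0 + A\<^sub>1\<close> over to scalar functions.
\<close>

lemma weighted_average_analytic:
  assumes f: "f \<in> calderon_F A\<^sub>0 A\<^sub>1" and k: "k \<ge> -1"
    and D: "D \<in> sets lebesgue" "D \<subseteq> dyadic_shell \<Omega> k"
      "ennreal (2 powr real_of_int n) \<le> emeasure lebesgue D" "emeasure lebesgue D < \<infinity>"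
    and \<sigma>: "\<sigma> \<in> borel_measurable (lebesgue_on \<Omega>)" "\<And>x. cmod (\<sigma> x) \<le> 1"
  shows "continuous_on closed_strip (\<lambda>z. weighted_average D \<sigma> (f z))"
    and "(\<lambda>z. weighted_average D \<sigma> (f z)) holomorphic_on open_strip"
    and "\<exists>B. \<forall>z\<in>closed_strip. cmod (weighted_average D \<sigma> (f z)) \<le> B"
proof -
  obtain C where C: "0 \<le> C" "\<And>u. u \<in> carr S \<Longrightarrow> integrable (lebesgue_on D) (\<lambda>x. u x * \<sigma> x)"
    "\<And>u. u \<in> carr S \<Longrightarrow> cmod (weighted_average D \<sigma> u) \<le> C * nrm S u"
    by (rule sum_weighted_average[OF k D \<sigma>]) blast
  define \<Lambda> where "\<Lambda> = weighted_average D \<sigma>"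
  have lin: "\<Lambda> (\<lambda>x. s * u x + t * v x) = s * \<Lambda> u + t * \<Lambda> v" if "u \<in> carr S" "v \<in> carr S" for s t u v
  proof -
    have "(\<integral>x. (s * u x + t * v x) * \<sigma> x \<partial>(lebesgue_on D))
       = (\<integral>x. s * (u x * \<sigma> x) + t * (v x * \<sigma> x) \<partial>(lebesgue_on D))"
      by (simp add: algebra_simps)
    also have "\<dots> = s * (\<integral>x. u x * \<sigma> x \<partial>(lebesgue_on D)) + t * (\<integral>x. v x * \<sigma> x \<partial>(lebesgue_on D))"
      using C(2)[OF that(1)] C(2)[OF that(2)] by simp
    finally show ?thesis by (simp add: \<Lambda>_def weighted_average_def add_divide_distrib)
  qed
  have fc: "fspace_continuous_on S closed_strip f" and fa: "fspace_analytic_on S open_strip f"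
    using f by (auto simp: calderon_F_def)
  obtain M where M: "\<And>z. z \<in> closed_strip \<Longrightarrow> nrm S (f z) \<le> M"
    using f by (auto simp: calderon_F_def)
  have fS: "f z \<in> carr S" if "z \<in> closed_strip" for z
    using fc that by (auto simp: fspace_continuous_on_def)
  have sub: "open_strip \<subseteq> closed_strip" by (auto simp: open_strip_def closed_strip_def)
  have diff: "(\<lambda>u. f w u - f z u) \<in> carr S" "\<Lambda> (\<lambda>u. f w u - f z u) = \<Lambda> (f w) - \<Lambda> (f z)"
    if "w \<in> closed_strip" "z \<in> closed_strip" for w z
    using sum_linear[OF fS[OF that(1)] fS[OF that(2)], of 1 "-1"]
      lin[OF fS[OF that(1)] fS[OF that(2)], of 1 "-1"] by simp_all
  have "((\<lambda>w. \<Lambda> (f w)) \<longlongrightarrow> \<Lambda> (f z)) (at z within closed_strip)" if z: "z \<in> closed_strip" for z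
  proof (rule Lim_null[THEN iffD2])
    have "((\<lambda>w. C * nrm S (\<lambda>u. f w u - f z u)) \<longlongrightarrow> C * 0) (at z within closed_strip)"
      using fc z by (intro tendsto_mult_left) (auto simp: fspace_continuous_on_def)
    then have lim: "((\<lambda>w. C * nrm S (\<lambda>u. f w u - f z u)) \<longlongrightarrow> 0) (at z within closed_strip)" by simp
    show "((\<lambda>w. \<Lambda> (f w) - \<Lambda> (f z)) \<longlongrightarrow> 0) (at z within closed_strip)"
    proof (rule Lim_null_comparison[OF _ lim])
      show "eventually (\<lambda>w. norm (\<Lambda> (f w) - \<Lambda> (f z)) \<le> C * nrm S (\<lambda>u. f w u - f z u)) (at z within closed_strip)"
        unfolding eventually_at_filter
      proof (intro always_eventually allI impI)
        fix w assume "w \<noteq> z" "w \<in> closed_strip"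
        then show "norm (\<Lambda> (f w) - \<Lambda> (f z)) \<le> C * nrm S (\<lambda>u. f w u - f z u)"
          using C(3)[OF diff(1)[of w z]] diff(2)[of w z] z by (simp add: \<Lambda>_def)
      qed
    qed
  qed
  then show "continuous_on closed_strip (\<lambda>z. weighted_average D \<sigma> (f z))"
    by (simp add: continuous_on_def \<Lambda>_def)
  have "\<exists>g. ((\<lambda>w. \<Lambda> (f w)) has_field_derivative g) (at z within open_strip)" if z: "z \<in> open_strip" for z
  proof -
    obtain g where g: "g \<in> carr S"
      "((\<lambda>w. nrm S (\<lambda>u. (f w u - f z u) / (w - z) - g u)) \<longlongrightarrow> 0) (at z within open_strip)"
      using fa z unfolding fspace_analytic_on_def by blast
    have zc: "z \<in> closed_strip" using z sub by blast
    have quot: "(\<lambda>u. (f w u - f z u) / (w - z) - g u) \<in> carr S"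
      "\<Lambda> (\<lambda>u. (f w u - f z u) / (w - z) - g u) = (\<Lambda> (f w) - \<Lambda> (f z)) / (w - z) - \<Lambda> g"
      if "w \<in> closed_strip" for w
      using sum_linear[OF diff(1)[OF that zc] g(1), of "1 / (w - z)" "-1"]
        lin[OF diff(1)[OF that zc] g(1), of "1 / (w - z)" "-1"] diff(2)[OF that zc] by simp_all
    have "((\<lambda>w. C * nrm S (\<lambda>u. (f w u - f z u) / (w - z) - g u)) \<longlongrightarrow> C * 0) (at z within open_strip)"
      by (intro tendsto_mult_left g)
    then have lim: "((\<lambda>w. C * nrm S (\<lambda>u. (f w u - f z u) / (w - z) - g u)) \<longlongrightarrow> 0) (at z within open_strip)" by simp
    have "((\<lambda>w. (\<Lambda> (f w) - \<Lambda> (f z)) / (w - z) - \<Lambda> g) \<longlongrightarrow> 0) (at z within open_strip)"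
    proof (rule Lim_null_comparison[OF _ lim])
      show "eventually (\<lambda>w. norm ((\<Lambda> (f w) - \<Lambda> (f z)) / (w - z) - \<Lambda> g) \<le> C * nrm S (\<lambda>u. (f w u - f z u) / (w - z) - g u)) (at z within open_strip)"
        unfolding eventually_at_filter
      proof (intro always_eventually allI impI)
        fix w assume "w \<noteq> z" "w \<in> open_strip"
        then have w: "w \<in> closed_strip" using sub by blast
        show "norm ((\<Lambda> (f w) - \<Lambda> (f z)) / (w - z) - \<Lambda> g) \<le> C * nrm S (\<lambda>u. (f w u - f z u) / (w - z) - g u)"
          unfolding quot(2)[OF w, symmetric] using C(3)[OF quot(1)[OF w]] by (simp add: \<Lambda>_def)
      qed
    qed
    then have "((\<lambda>w. (\<Lambda> (f w) - \<Lambda> (f z)) / (w - z)) \<longlongrightarrow> \<Lambda> g) (at z within open_strip)"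
      by (rule Lim_null[THEN iffD2])
    then show ?thesis unfolding has_field_derivative_iff by blast
  qed
  then show "(\<lambda>z. weighted_average D \<sigma> (f z)) holomorphic_on open_strip"
    unfolding holomorphic_on_def field_differentiable_def \<Lambda>_def by blast
  show "\<exists>B. \<forall>z\<in>closed_strip. cmod (weighted_average D \<sigma> (f z)) \<le> B"
  proof (intro exI ballI)
    fix z assume z: "z \<in> closed_strip"
    have "cmod (weighted_average D \<sigma> (f z)) \<le> C * nrm S (f z)" by (rule C(3)[OF fS[OF z]])
    also have "\<dots> \<le> C * M" using C(1) M[OF z] by (rule mult_left_mono[rotated])
    finally show "cmod (weighted_average D \<sigma> (f z)) \<le> C * M" .
  qed
qed

lemma boundary_norm_le:
  assumes f: "f \<in> calderon_F A\<^sub>0 A\<^sub>1"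
  shows "f (Complex 0 t) \<in> carr A\<^sub>0" "f (Complex 1 t) \<in> carr A\<^sub>1"
    "nrm A\<^sub>0 (f (Complex 0 t)) \<le> calderon_F_norm A\<^sub>0 A\<^sub>1 f"
    "nrm A\<^sub>1 (f (Complex 1 t)) \<le> calderon_F_norm A\<^sub>0 A\<^sub>1 f"
proof -
  have b: "boundary_admissible A\<^sub>0 (\<lambda>t. f (Complex 0 t))" "boundary_admissible A\<^sub>1 (\<lambda>t. f (Complex 1 t))"
    using f by (auto simp: calderon_F_def)
  show "f (Complex 0 t) \<in> carr A\<^sub>0" "f (Complex 1 t) \<in> carr A\<^sub>1"
    using b by (auto simp: boundary_admissible_def fspace_continuous_on_def)
  have "nrm A\<^sub>0 (f (Complex 0 t)) \<le> (SUP t. nrm A\<^sub>0 (f (Complex 0 t)))"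
    by (rule cSUP_upper[OF UNIV_I boundary_admissible_bounded[OF \<Omega> exps(1,7) q01(1) b(1)]])
  then show "nrm A\<^sub>0 (f (Complex 0 t)) \<le> calderon_F_norm A\<^sub>0 A\<^sub>1 f"
    unfolding calderon_F_norm_def by simp
  have "nrm A\<^sub>1 (f (Complex 1 t)) \<le> (SUP t. nrm A\<^sub>1 (f (Complex 1 t)))"
    by (rule cSUP_upper[OF UNIV_I boundary_admissible_bounded[OF \<Omega> exps(2,8) q01(2) b(2)]])
  then show "nrm A\<^sub>1 (f (Complex 1 t)) \<le> calderon_F_norm A\<^sub>0 A\<^sub>1 f"
    unfolding calderon_F_norm_def by simp
qed

lemma calderon_F_norm_nonneg: "f \<in> calderon_F A\<^sub>0 A\<^sub>1 \<Longrightarrow> 0 \<le> calderon_F_norm A\<^sub>0 A\<^sub>1 f"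
  using boundary_norm_le(3)[of f 0] HL_nrm_nonneg order_trans by blast

end

section \<open>The interpolation space is contained in HL\<close>

lemma weighted_average_sgn_ge:
  assumes D: "D \<in> sets lebesgue" "emeasure lebesgue D < \<infinity>" "0 < measure lebesgue D"
    and int: "integrable (lebesgue_on D) (\<lambda>x. h x * (cnj (h x) / of_real (cmod (h x))))"
    and l: "\<And>x. x \<in> D \<Longrightarrow> l \<le> cmod (h x)"
  obtains m where "l \<le> m" "weighted_average D (\<lambda>x. cnj (h x) / of_real (cmod (h x))) h = of_real m"
proof -
  have eq: "h x * (cnj (h x) / of_real (cmod (h x))) = complex_of_real (cmod (h x))" for x
    by (cases "h x = 0") (simp_all add: complex_norm_square[symmetric] power2_eq_square field_simps)
  have int': "integrable (lebesgue_on D) (\<lambda>x. cmod (h x))"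
    using integrable_norm[OF int[unfolded eq]] by simp
  have fin: "finite_measure (lebesgue_on D)"
    using D by (intro finite_measureI) (auto simp: emeasure_restrict_space)
  have "(\<integral>x. l \<partial>(lebesgue_on D)) \<le> (\<integral>x. cmod (h x) \<partial>(lebesgue_on D))"
  proof (rule integral_mono[OF _ int'])
    show "integrable (lebesgue_on D) (\<lambda>x. l)" using fin by (rule finite_measure.integrable_const)
    show "\<And>x. x \<in> space (lebesgue_on D) \<Longrightarrow> l \<le> cmod (h x)" using l by simp
  qed
  moreover have "measure (lebesgue_on D) D = measure lebesgue D"
    using D by (intro measure_restrict_space) auto
  ultimately have "l \<le> (\<integral>x. cmod (h x) \<partial>(lebesgue_on D)) / measure lebesgue D"
    using D by (simp add: pos_le_divide_eq mult.commute)
  moreover have "weighted_average D (\<lambda>x. cnj (h x) / of_real (cmod (h x))) h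
      = of_real ((\<integral>x. cmod (h x) \<partial>(lebesgue_on D)) / measure lebesgue D)"
    unfolding weighted_average_def eq by simp
  ultimately show ?thesis by (rule that)
qed

text \<open>
  By \<open>HL_averages\<close> the weighted means of \<open>|w|\<close> form a sequence in the ball of the mixed space whose
  radius is a constant times the norm of \<open>w\<close>; it is paired with \<open>e\<close> from the dual ball.
\<close>

lemma dual_pairing_bound:
  assumes \<Omega>: "\<Omega> \<in> sets lebesgue" and w: "w \<in> carr (HL \<Omega> p r a q)"
    and p: "1 < p" and r: "0 < r" and q: "1 \<le> q" and K: "K \<subseteq> {-1..}"
    and D: "\<And>k n. (k, n) \<in> P \<Longrightarrow> D k n \<in> sets lebesgue" "\<And>k n. (k, n) \<in> P \<Longrightarrow> D k n \<subseteq> dyadic_shell \<Omega> k"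
      "\<And>k n. (k, n) \<in> P \<Longrightarrow> ennreal (2 powr real_of_int n) \<le> emeasure lebesgue (D k n)"
      "\<And>k n. (k, n) \<in> P \<Longrightarrow> emeasure lebesgue (D k n) < \<infinity>"
    and \<sigma>: "\<sigma> \<in> borel_measurable (lebesgue_on \<Omega>)" "\<And>x. cmod (\<sigma> x) \<le> 1"
    and e: "\<And>k n. 0 \<le> e k n"
      "\<And>B v. mixed_ball (enn2real (1 / q)) (1/r) K B v \<Longrightarrow> (\<Sum>k\<in>K. \<Sum>n\<in>N. e k n * v k n) \<le> B"
    and c: "\<And>k n. cmod (c k n) \<le> 2 powr (of_int k * a) * (2 powr (real_of_int n / p) * e k n)"
  shows "cmod (\<Sum>k\<in>K. \<Sum>n\<in>N. if (k, n) \<in> P then c k n * weighted_average (D k n) \<sigma> w else 0)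
    \<le> lorentz_avg_const p r * nrm (HL \<Omega> p r a q) w"
proof -
  define v where "v = (\<lambda>k n. if (k, n) \<in> P
    then 2 powr (of_int k * a) * (2 powr (real_of_int n / p) * mean_modulus (D k n) w) else 0)"
  have v: "mixed_ball (enn2real (1 / q)) (1/r) K (lorentz_avg_const p r * nrm (HL \<Omega> p r a q) w) v"
    unfolding v_def by (rule HL_averages(1)[OF \<Omega> w p r q refl K D])
  have "cmod (if (k, n) \<in> P then c k n * weighted_average (D k n) \<sigma> w else 0) \<le> e k n * v k n"
    if "k \<in> K" for k n
  proof (cases "(k, n) \<in> P")
    case True
    have "k \<ge> -1" using that K by auto
    then have "cmod (weighted_average (D k n) \<sigma> w) \<le> mean_modulus (D k n) w"
      by (rule HL_weighted_average(2)[OF \<Omega> w p r q _ D[OF True] \<sigma>])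
    then have "cmod (c k n * weighted_average (D k n) \<sigma> w)
        \<le> (2 powr (of_int k * a) * (2 powr (real_of_int n / p) * e k n)) * mean_modulus (D k n) w"
      unfolding norm_mult using c e(1) by (intro mult_mono) auto
    also have "\<dots> = e k n * v k n" using True by (simp add: v_def mult_ac)
    finally show ?thesis using True by simp
  qed (use e(1) mixed_ballD(2)[OF v that] in simp)
  then have "cmod (\<Sum>k\<in>K. \<Sum>n\<in>N. if (k, n) \<in> P then c k n * weighted_average (D k n) \<sigma> w else 0)
      \<le> (\<Sum>k\<in>K. \<Sum>n\<in>N. e k n * v k n)"
    by (intro sum_norm_le)
  also have "\<dots> \<le> lorentz_avg_const p r * nrm (HL \<Omega> p r a q) w" by (rule e(2)[OF v])
  finally show ?thesis .
qed

lemma cmod_of_real_powr: "0 \<le> g \<Longrightarrow> cmod (of_real g powr z) = g powr Re z"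
  by (subst norm_powr_real_powr) auto

context HL_couple
begin

definition dual_const :: real where
  "dual_const = max (lorentz_avg_const p\<^sub>0 r\<^sub>0) (lorentz_avg_const p\<^sub>1 r\<^sub>1)"

lemma dual_const: "0 \<le> dual_const" "lorentz_avg_const p\<^sub>0 r\<^sub>0 \<le> dual_const" "lorentz_avg_const p\<^sub>1 r\<^sub>1 \<le> dual_const"
  using lorentz_avg_const_nonneg[OF p01(1), of r\<^sub>0] by (auto simp: dual_const_def)

text \<open>
  Let \<open>y\<close> be the weighted sequence of the rearrangements of \<open>h = f \<theta>\<close> at dyadic points, restricted to finitely
  many indices.  The set \<open>D k n = {|h| > h\<^sup>*(2\<^sup>n)/2}\<close> in the \<open>k\<close>-th shell has measure at least \<open>2\<^sup>n\<close>, and the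
  average of \<open>h\<close> over it against the conjugate phase of \<open>h\<close> is at least \<open>h\<^sup>*(2\<^sup>n)/2\<close>.  Pairing the averages of \<open>f z\<close>
  over these sets with the analytic family \<open>e0\<^sup>1\<^sup>-\<^sup>z e1\<^sup>z\<close>, where \<open>e0\<close>, \<open>e1\<close> come from the factorization of the norming
  functional of \<open>y\<close>, yields a scalar analytic function \<open>\<psi>\<close> on the strip.  At \<open>\<theta>\<close> it is at least half the norm of
  \<open>y\<close>, and on the boundary lines it is bounded by duality.
\<close>

lemma finite_estimate:
  assumes f: "f \<in> calderon_F A\<^sub>0 A\<^sub>1" and K: "finite K" "K \<subseteq> {-1..}" and N: "finite N"
  defines "h \<equiv> f (of_real \<theta>)"
  defines "y \<equiv> \<lambda>k n. 2 powr (of_int k * a) * dyadic_seq (dyadic_shell \<Omega> k) p h n"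
  shows "(\<Sum>k\<in>K. (\<Sum>n\<in>N. y k n powr (1/(1/r))) powr ((1/r)/\<kappa>)) powr \<kappa>
    \<le> 2 * (dual_const * calderon_F_norm A\<^sub>0 A\<^sub>1 f)"
proof -
  define M where "M = calderon_F_norm A\<^sub>0 A\<^sub>1 f"
  have M0: "0 \<le> M" unfolding M_def by (rule calderon_F_norm_nonneg[OF f])
  have \<theta>s: "of_real \<theta> \<in> closed_strip" using \<theta> by (simp add: closed_strip_def)
  have hS: "h \<in> carr S"
    using f \<theta>s by (auto simp: calderon_F_def fspace_continuous_on_def h_def)
  have hm: "h \<in> borel_measurable (lebesgue_on \<Omega>)" by (rule sum_measurable[OF hS])
  have hfin: "k \<ge> -1 \<Longrightarrow> 0 < l \<Longrightarrow> emeasure lebesgue {x\<in>dyadic_shell \<Omega> k. l < cmod (h x)} < \<infinity>" for k l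
    by (rule sum_superlevel_finite[OF hS])
  define u where "u = (\<lambda>k n. enn2real (dyadic_dr (dyadic_shell \<Omega> k) h n))"
  have u0: "0 \<le> u k n" for k n by (simp add: u_def)
  have du: "dyadic_dr (dyadic_shell \<Omega> k) h n = ennreal (u k n)" if "k \<ge> -1" for k n
    using dyadic_dr_finite[OF dyadic_shell_sets[OF \<Omega>] measurable_on_shell[OF hm] hfin[OF that]]
    by (simp add: u_def)
  have y_eq: "y k n = 2 powr (of_int k * a) * (2 powr (real_of_int n / p) * u k n)" for k n
    by (simp add: y_def dyadic_seq_def u_def)
  define P where "P = {(k, n). k \<ge> -1 \<and> 0 < u k n}"
  \<comment> \<open>The level lies strictly below \<open>h\<^sup>*(2\<^sup>n)\<close>: only then is the measure known to exceed \<open>2\<^sup>n\<close>.\<close>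
  define D where "D = (\<lambda>k n. {x\<in>dyadic_shell \<Omega> k. u k n / 2 < cmod (h x)})"
  have D: "D k n \<in> sets lebesgue" "D k n \<subseteq> dyadic_shell \<Omega> k"
    "ennreal (2 powr real_of_int n) \<le> emeasure lebesgue (D k n)" "emeasure lebesgue (D k n) < \<infinity>"
    if "(k, n) \<in> P" for k n
  proof -
    have k: "k \<ge> -1" "0 < u k n" using that by (auto simp: P_def)
    show "D k n \<in> sets lebesgue" "D k n \<subseteq> dyadic_shell \<Omega> k"
      unfolding D_def by (intro superlevel_sets dyadic_shell_sets \<Omega> measurable_on_shell hm) auto
    show "emeasure lebesgue (D k n) < \<infinity>" unfolding D_def using k by (intro hfin) auto
    have "\<not> dyadic_dr (dyadic_shell \<Omega> k) h n \<le> ennreal (u k n / 2)"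
      unfolding du[OF k(1)] using k by simp
    then show "ennreal (2 powr real_of_int n) \<le> emeasure lebesgue (D k n)"
      using k by (subst (asm) dr_le_iff[OF dyadic_shell_sets[OF \<Omega>] measurable_on_shell[OF hm]]) (auto simp: D_def)
  qed
  define \<sigma> where "\<sigma> = (\<lambda>x. cnj (h x) / of_real (cmod (h x)))"
  have \<sigma>m: "\<sigma> \<in> borel_measurable (lebesgue_on \<Omega>)" 
  proof -
    have "(cnj :: complex \<Rightarrow> complex) \<in> borel_measurable borel"
      by (intro borel_measurable_continuous_onI continuous_on_cnj continuous_on_id)
    moreover have "(\<lambda>z. complex_of_real (cmod z)) \<in> borel_measurable borel"
      by (intro borel_measurable_continuous_onI continuous_intros)
    ultimately show ?thesis
      unfolding \<sigma>_def by (intro borel_measurable_divide measurable_compose[OF hm])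
  qed
  have \<sigma>1: "cmod (\<sigma> x) \<le> 1" for x by (simp add: \<sigma>_def norm_divide)
  have \<rho>: "0 < 1/r\<^sub>0" "1/r\<^sub>0 < 1" "0 < 1/r\<^sub>1" "1/r\<^sub>1 < 1" using r0 r1 by auto
  have \<rho>eq: "1/r = (1 - \<theta>) * (1/r\<^sub>0) + \<theta> * (1/r\<^sub>1)" using r_eq by simp
  have y0: "0 \<le> y k n" for k n using u0 by (simp add: y_eq)
  obtain e0 e1 where e: "\<And>k n. 0 \<le> e0 k n" "\<And>k n. 0 \<le> e1 k n"
    "(\<Sum>k\<in>K. \<Sum>n\<in>N. y k n * (e0 k n powr (1 - \<theta>) * e1 k n powr \<theta>)) =
       (\<Sum>k\<in>K. (\<Sum>n\<in>N. y k n powr (1/(1/r))) powr ((1/r)/\<kappa>)) powr \<kappa>"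
    "\<And>B v. mixed_ball \<kappa>\<^sub>0 (1/r\<^sub>0) K B v \<Longrightarrow> (\<Sum>k\<in>K. \<Sum>n\<in>N. e0 k n * v k n) \<le> B"
    "\<And>B v. mixed_ball \<kappa>\<^sub>1 (1/r\<^sub>1) K B v \<Longrightarrow> (\<Sum>k\<in>K. \<Sum>n\<in>N. e1 k n * v k n) \<le> B"
    "\<And>k n. y k n = 0 \<Longrightarrow> e0 k n = 0 \<and> e1 k n = 0"
    by (rule mixed_dual_factorization[of K N y, OF K(1) N y0 \<theta> kappa01(1-4) kappa(1,2) \<rho> \<rho>eq]) blast
  define Y where "Y = (\<Sum>k\<in>K. (\<Sum>n\<in>N. y k n powr (1/(1/r))) powr ((1/r)/\<kappa>)) powr \<kappa>"
  define G0 where "G0 = (\<lambda>k n. 2 powr (of_int k * a\<^sub>0) * (2 powr (real_of_int n / p\<^sub>0) * e0 k n))"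
  define G1 where "G1 = (\<lambda>k n. 2 powr (of_int k * a\<^sub>1) * (2 powr (real_of_int n / p\<^sub>1) * e1 k n))"
  have G: "0 \<le> G0 k n" "0 \<le> G1 k n" for k n using e by (auto simp: G0_def G1_def)
  \<comment> \<open>If a base is \<open>0\<close>, the complex power is \<open>0\<close> for every exponent, so no index has to be excluded.\<close>
  define c where "c = (\<lambda>k n z. complex_of_real (G0 k n) powr (1 - z) * complex_of_real (G1 k n) powr z)"
  have cn: "cmod (c k n z) = G0 k n powr (1 - Re z) * G1 k n powr (Re z)" for k n z
    unfolding c_def by (simp add: norm_mult cmod_of_real_powr G)
  define T where "T = (\<lambda>k n z. if (k, n) \<in> P then c k n z * weighted_average (D k n) \<sigma> (f z) else 0)"
  define \<psi> where "\<psi> = (\<lambda>z. \<Sum>k\<in>K. \<Sum>n\<in>N. T k n z)"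
  have Kge: "k \<ge> -1" if "k \<in> K" for k using that K(2) by auto
  have chol: "c k n holomorphic_on X" for k n X
    unfolding c_def by (intro holomorphic_intros)
  have wa: "continuous_on closed_strip (\<lambda>z. weighted_average (D k n) \<sigma> (f z))"
    "(\<lambda>z. weighted_average (D k n) \<sigma> (f z)) holomorphic_on open_strip"
    "\<exists>B. \<forall>z\<in>closed_strip. cmod (weighted_average (D k n) \<sigma> (f z)) \<le> B" if "(k, n) \<in> P" for k n
    using weighted_average_analytic[OF f _ D[OF that] \<sigma>m \<sigma>1] that by (auto simp: P_def)
  have Tcont: "continuous_on closed_strip (T k n)" for k n
    unfolding T_def using wa(1)[of k n]
    by (cases "(k, n) \<in> P") (auto intro!: continuous_on_mult holomorphic_on_imp_continuous_on[OF chol])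
  have Thol: "T k n holomorphic_on open_strip" for k n
    unfolding T_def using wa(2)[of k n] by (cases "(k, n) \<in> P") (auto intro!: holomorphic_on_mult chol)
  have "\<exists>B. \<forall>z\<in>closed_strip. cmod (T k n z) \<le> B" for k n
  proof (cases "(k, n) \<in> P")
    case True
    obtain B where B: "\<forall>z\<in>closed_strip. cmod (weighted_average (D k n) \<sigma> (f z)) \<le> B"
      using wa(3)[OF True] by blast
    have "cmod (T k n z) \<le> ((G0 k n + 1) * (G1 k n + 1)) * B" if z: "z \<in> closed_strip" for z
    proof -
      have "cmod (c k n z) \<le> (G0 k n + 1) * (G1 k n + 1)"
        unfolding cn using z G by (intro mult_mono powr_le_add_one) (auto simp: closed_strip_def add_nonneg_nonneg)
      then show ?thesis
        using True B z G by (simp add: T_def norm_mult mult_mono add_nonneg_nonneg)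
    qed
    then show ?thesis by blast
  qed (auto simp: T_def intro: exI[of _ 0])
  then obtain BT where BT: "\<And>k n z. z \<in> closed_strip \<Longrightarrow> cmod (T k n z) \<le> BT k n" by metis
  have main: "cmod (\<psi> (of_real \<theta>)) \<le> dual_const * M"
  proof (rule strip_maximum_modulus[OF _ _ _ _ _ \<theta>s])
    show "continuous_on closed_strip \<psi>" unfolding \<psi>_def by (intro continuous_on_sum Tcont)
    show "\<psi> holomorphic_on open_strip" unfolding \<psi>_def by (intro holomorphic_on_sum Thol)
    show "cmod (\<psi> z) \<le> (\<Sum>k\<in>K. \<Sum>n\<in>N. BT k n)" if "z \<in> closed_strip" for z
      unfolding \<psi>_def by (intro sum_norm_le BT that)
  next
    fix t
    have "cmod (\<psi> (Complex 0 t)) \<le> lorentz_avg_const p\<^sub>0 r\<^sub>0 * nrm A\<^sub>0 (f (Complex 0 t))"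
      unfolding \<psi>_def T_def
    proof (rule dual_pairing_bound[OF \<Omega> boundary_norm_le(1)[OF f] p01(1) exps(4) q01(1) K(2) D \<sigma>m \<sigma>1 e(1,4)])
      show "cmod (c k n (Complex 0 t)) \<le> 2 powr (of_int k * a\<^sub>0) * (2 powr (real_of_int n / p\<^sub>0) * e0 k n)" for k n
      proof -
        have "cmod (c k n (Complex 0 t)) \<le> G0 k n"
          unfolding cn using G[of k n] by (auto simp: powr_def)
        then show ?thesis by (simp only: G0_def)
      qed
    qed
    also have "\<dots> \<le> dual_const * M"
      using boundary_norm_le(3)[OF f, of t] dual_const M0 by (intro mult_mono) (auto simp: M_def)
    finally show "cmod (\<psi> (Complex 0 t)) \<le> dual_const * M" .
  next
    fix t
    have "cmod (\<psi> (Complex 1 t)) \<le> lorentz_avg_const p\<^sub>1 r\<^sub>1 * nrm A\<^sub>1 (f (Complex 1 t))"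
      unfolding \<psi>_def T_def
    proof (rule dual_pairing_bound[OF \<Omega> boundary_norm_le(2)[OF f] p01(2) exps(5) q01(2) K(2) D \<sigma>m \<sigma>1 e(2,5)])
      show "cmod (c k n (Complex 1 t)) \<le> 2 powr (of_int k * a\<^sub>1) * (2 powr (real_of_int n / p\<^sub>1) * e1 k n)" for k n
      proof -
        have "cmod (c k n (Complex 1 t)) \<le> G1 k n"
          unfolding cn using G[of k n] by (auto simp: powr_def)
        then show ?thesis by (simp only: G1_def)
      qed
    qed
    also have "\<dots> \<le> dual_const * M"
      using boundary_norm_le(4)[OF f, of t] dual_const M0 by (intro mult_mono) (auto simp: M_def)
    finally show "cmod (\<psi> (Complex 1 t)) \<le> dual_const * M" .
  qed
  have low: "\<exists>m. T k n (of_real \<theta>) = of_real m \<and> y k n * (e0 k n powr (1 - \<theta>) * e1 k n powr \<theta>) \<le> 2 * m"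
    if k: "k \<in> K" for k n
  proof (cases "(k, n) \<in> P")
    case True
    note kn = True
    have mpos: "0 < measure lebesgue (D k n)"
    proof -
      have "0 < emeasure lebesgue (D k n)" by (rule order.strict_trans2[OF _ D(3)[OF kn]]) simp
      then show ?thesis using D(4)[OF kn] by (simp add: measure_def enn2real_positive_iff)
    qed
    obtain C where C: "0 \<le> C" "\<And>u. u \<in> carr S \<Longrightarrow> integrable (lebesgue_on (D k n)) (\<lambda>x. u x * \<sigma> x)"
        "\<And>u. u \<in> carr S \<Longrightarrow> cmod (weighted_average (D k n) \<sigma> u) \<le> C * nrm S u"
      by (rule sum_weighted_average[OF Kge[OF k] D[OF kn] \<sigma>m \<sigma>1]) blast
    obtain m where m: "u k n / 2 \<le> m" "weighted_average (D k n) \<sigma> h = of_real m"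
      unfolding \<sigma>_def
      by (rule weighted_average_sgn_ge[OF D(1)[OF kn] D(4)[OF kn] mpos C(2)[OF hS, unfolded \<sigma>_def], of "u k n / 2"])
        (auto simp: D_def)
    define g where "g = G0 k n powr (1 - \<theta>) * G1 k n powr \<theta>"
    have "c k n (of_real \<theta>) = of_real g"
    proof -
      have "complex_of_real (G0 k n) powr (1 - of_real \<theta>) = of_real (G0 k n powr (1 - \<theta>))"
        using powr_of_real[OF G(1), of k n "1 - \<theta>"] by simp
      moreover have "complex_of_real (G1 k n) powr (of_real \<theta>) = of_real (G1 k n powr \<theta>)"
        by (rule powr_of_real[OF G(2)])
      ultimately show ?thesis by (simp add: c_def g_def)
    qed
    then have "T k n (of_real \<theta>) = of_real (g * m)"
      using True m(2) by (simp add: T_def h_def)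
    moreover have "y k n * (e0 k n powr (1 - \<theta>) * e1 k n powr \<theta>) = g * u k n"
    proof -
      have "g = ((2 powr (of_int k * a\<^sub>0)) powr (1 - \<theta>) * (2 powr (of_int k * a\<^sub>1)) powr \<theta>) *
         ((2 powr (real_of_int n / p\<^sub>0)) powr (1 - \<theta>) * (2 powr (real_of_int n / p\<^sub>1)) powr \<theta>) *
         (e0 k n powr (1 - \<theta>) * e1 k n powr \<theta>)"
        unfolding g_def G0_def G1_def powr_mult by (simp only: mult_ac)
      then show ?thesis unfolding weight_interpolation y_eq by (simp add: mult_ac)
    qed
    moreover have "g * u k n \<le> 2 * (g * m)"
    proof -
      have "0 \<le> g" by (simp add: g_def)
      then have "g * (u k n / 2) \<le> g * m" using m(1) by (intro mult_left_mono)
      then show ?thesis by simp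
    qed
    ultimately show ?thesis by (intro exI[of _ "g * m"]) simp
  next
    case False
    then have "u k n = 0" using Kge[OF k] u0[of k n] by (simp add: P_def)
    then have "y k n = 0" by (simp add: y_eq)
    then show ?thesis using False by (intro exI[of _ 0]) (simp add: T_def)
  qed
  then obtain m where m: "\<And>k n. k \<in> K \<Longrightarrow> T k n (of_real \<theta>) = of_real (m k n)"
    "\<And>k n. k \<in> K \<Longrightarrow> y k n * (e0 k n powr (1 - \<theta>) * e1 k n powr \<theta>) \<le> 2 * m k n" by metis
  have "Y = (\<Sum>k\<in>K. \<Sum>n\<in>N. y k n * (e0 k n powr (1 - \<theta>) * e1 k n powr \<theta>))"
    unfolding Y_def e(3) ..
  also have "\<dots> \<le> (\<Sum>k\<in>K. \<Sum>n\<in>N. 2 * m k n)" by (intro sum_mono m(2))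
  also have "\<dots> = 2 * (\<Sum>k\<in>K. \<Sum>n\<in>N. m k n)" by (simp add: sum_distrib_left)
  also have "\<dots> \<le> 2 * cmod (\<psi> (of_real \<theta>))"
  proof -
    have "\<psi> (of_real \<theta>) = of_real (\<Sum>k\<in>K. \<Sum>n\<in>N. m k n)" by (simp add: \<psi>_def m(1))
    then have "cmod (\<psi> (of_real \<theta>)) = \<bar>\<Sum>k\<in>K. \<Sum>n\<in>N. m k n\<bar>" by (simp only: norm_of_real)
    then show ?thesis by simp
  qed
  also have "\<dots> \<le> 2 * (dual_const * M)" using main by simp
  finally show ?thesis by (simp only: Y_def M_def)
qed

definition upper_const :: real where
  "upper_const = lorentz_upper_const p r * (2 * dual_const)"

lemma interpolation_into_HL:
  assumes f: "f \<in> calderon_F A\<^sub>0 A\<^sub>1"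
  shows "f (of_real \<theta>) \<in> carr A" "nrm A (f (of_real \<theta>)) \<le> upper_const * calderon_F_norm A\<^sub>0 A\<^sub>1 f"
proof -
  define h where "h = f (of_real \<theta>)"
  define B where "B = 2 * (dual_const * calderon_F_norm A\<^sub>0 A\<^sub>1 f)"
  have \<theta>s: "of_real \<theta> \<in> closed_strip" using \<theta> by (simp add: closed_strip_def)
  have hS: "h \<in> carr S"
    using f \<theta>s by (auto simp: calderon_F_def fspace_continuous_on_def h_def)
  have hm: "h \<in> borel_measurable (lebesgue_on \<Omega>)" by (rule sum_measurable[OF hS])
  have fin: "dyadic_dr (dyadic_shell \<Omega> k) h n < \<infinity>" if "k \<ge> -1" for k n
    by (rule dyadic_dr_finite[OF dyadic_shell_sets[OF \<Omega>] measurable_on_shell[OF hm] sum_superlevel_finite[OF hS that]])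
  have "mixed_ball \<kappa> (1/r) {-1..} B (\<lambda>k n. 2 powr (of_int k * a) * dyadic_seq (dyadic_shell \<Omega> k) p h n)"
  proof (rule mixed_ball_finite_sums)
    show "0 \<le> B" unfolding B_def using dual_const calderon_F_norm_nonneg[OF f] by simp
    show "0 \<le> 2 powr (of_int k * a) * dyadic_seq (dyadic_shell \<Omega> k) p h n" for k n
      by (simp add: dyadic_seq_def)
  qed (use finite_estimate[OF f] kappa exps in \<open>auto simp: h_def B_def\<close>)
  from HL_from_dyadic[OF \<Omega> hm exps(3,6) q1 refl fin this]
  show "f (of_real \<theta>) \<in> carr A" "nrm A (f (of_real \<theta>)) \<le> upper_const * calderon_F_norm A\<^sub>0 A\<^sub>1 f"
    by (auto simp: h_def B_def upper_const_def mult_ac)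
qed

end

section \<open>Analytic families at one endpoint\<close>

text \<open>
  \<open>\<Lambda>\<close> will be constant on each piece of a countable partition, so that \<open>h\<close> is multiplied by a number
  depending on the piece.
\<close>

definition multiplied :: "('a \<Rightarrow> complex) \<Rightarrow> ('a \<Rightarrow> real) \<Rightarrow> (real \<Rightarrow> complex) \<Rightarrow> 'a \<Rightarrow> complex" where
  "multiplied h \<Lambda> m = (\<lambda>x. h x * m (\<Lambda> x))"

text \<open>
  For \<open>c = \<theta>\<close> this is the analytic family with value \<open>1\<close> at \<open>z = \<theta>\<close> that grows like \<open>exp ((Re z - \<theta>) \<lambda>)\<close> on a piece
  with parameter \<open>\<lambda>\<close>; the Gaussian factor makes it decay in the imaginary direction.  For \<open>c = 0\<close> or \<open>c = 1\<close>
  it is the same family relative to its size on the line \<open>Re z = c\<close>.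
\<close>

definition strip_kernel :: "real \<Rightarrow> real \<Rightarrow> complex \<Rightarrow> real \<Rightarrow> complex" where
  "strip_kernel \<theta> c z l = exp ((z - of_real c) * of_real l + (z\<^sup>2 - of_real (\<theta>\<^sup>2)))"

definition strip_kernel' :: "real \<Rightarrow> real \<Rightarrow> complex \<Rightarrow> real \<Rightarrow> complex" where
  "strip_kernel' \<theta> c z l = (of_real l + 2 * z) * strip_kernel \<theta> c z l"

lemma cmod_strip_kernel:
  "cmod (strip_kernel \<theta> c z l) = exp ((Re z - c) * l) * exp ((Re z)\<^sup>2 - (Im z)\<^sup>2 - \<theta>\<^sup>2)"
  by (simp add: strip_kernel_def norm_exp_eq_Re power2_eq_square flip: exp_add)

lemma strip_kernel_shift:
  "strip_kernel \<theta> c z l = of_real (exp ((d - c) * l)) * strip_kernel \<theta> d z l"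
  by (simp add: strip_kernel_def algebra_simps flip: exp_add exp_of_real)

lemma strip_kernel'_shift:
  "strip_kernel' \<theta> c z l = of_real (exp ((d - c) * l)) * strip_kernel' \<theta> d z l"
  unfolding strip_kernel'_def by (subst strip_kernel_shift[of \<theta> c z l d]) (simp add: mult_ac)

lemma strip_kernel_deriv:
  "((\<lambda>z. strip_kernel \<theta> c z l) has_field_derivative strip_kernel' \<theta> c z l) (at z within X)"
  unfolding strip_kernel_def strip_kernel'_def
  by (auto intro!: derivative_eq_intros simp: algebra_simps)

lemma strip_kernel_measurable [measurable]:
  "strip_kernel \<theta> c z \<in> borel_measurable borel" "strip_kernel' \<theta> c z \<in> borel_measurable borel"
  unfolding strip_kernel_def strip_kernel'_def
  by (intro borel_measurable_continuous_onI continuous_intros)+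

lemma strip_kernel_tendsto:
  "((\<lambda>w. strip_kernel \<theta> c w l) \<longlongrightarrow> strip_kernel \<theta> c z l) (at z within X)"
  unfolding strip_kernel_def by (intro tendsto_intros)

text \<open>
  If \<open>\<lambda> \<le> 0\<close> the family is, relative to its size on the left line, bounded on the whole strip; if \<open>\<lambda> > 0\<close>
  this holds relative to the right line.  This decides which part of the family is placed in which of the two
  spaces.
\<close>

lemma strip_kernel_le:
  assumes z: "z \<in> closed_strip" and c: "c = 0 \<and> l \<le> 0 \<or> c = 1 \<and> 0 < l"
  shows "cmod (strip_kernel \<theta> c z l) \<le> exp 1"
proof -
  have "(Re z - c) * l \<le> 0"
    using z c by (auto simp: closed_strip_def mult_le_0_iff)
  moreover have "(Re z)\<^sup>2 \<le> 1" using z by (simp add: closed_strip_def power_le_one)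
  then have "(Re z)\<^sup>2 - (Im z)\<^sup>2 - \<theta>\<^sup>2 \<le> 1"
    using zero_le_power2[of "Im z"] zero_le_power2[of \<theta>] by linarith
  ultimately have "exp ((Re z - c) * l) * exp ((Re z)\<^sup>2 - (Im z)\<^sup>2 - \<theta>\<^sup>2) \<le> 1 * exp 1"
    by (intro mult_mono) auto
  then show ?thesis unfolding cmod_strip_kernel by simp
qed

text \<open>
  The derivative contains the unbounded factor \<open>\<lambda>\<close>.  At distance \<open>\<delta>\<close> from the boundary it is absorbed by
  \<open>exp (- \<delta> |\<lambda>|)\<close>.
\<close>

lemma strip_kernel'_le:
  assumes \<delta>: "0 < \<delta>" and z: "\<delta> \<le> Re z" "Re z \<le> 1 - \<delta>" and c: "c = 0 \<and> l \<le> 0 \<or> c = 1 \<and> 0 < l"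
  shows "cmod (strip_kernel' \<theta> c z l) \<le> (1/\<delta> + 2 * cmod z) * exp 1"
proof -
  have 1: "(Re z - c) * l \<le> - (\<delta> * \<bar>l\<bar>)"
    using c
  proof
    assume "c = 0 \<and> l \<le> 0"
    then show ?thesis using mult_right_mono_neg[OF z(1), of l] by simp
  next
    assume "c = 1 \<and> 0 < l"
    then show ?thesis using mult_right_mono[OF z(2), of l] by (simp add: algebra_simps)
  qed
  have "(Re z)\<^sup>2 \<le> 1" using z \<delta> by (intro power_le_one) auto
  then have 2: "(Re z)\<^sup>2 - (Im z)\<^sup>2 - \<theta>\<^sup>2 \<le> 1"
    using zero_le_power2[of "Im z"] zero_le_power2[of \<theta>] by linarith
  have 3: "\<bar>l\<bar> * exp (- (\<delta> * \<bar>l\<bar>)) \<le> 1/\<delta>"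
  proof -
    have "\<delta> * \<bar>l\<bar> \<le> exp (\<delta> * \<bar>l\<bar>)" using exp_ge_add_one_self[of "\<delta> * \<bar>l\<bar>"] by linarith
    then have "\<delta> * \<bar>l\<bar> * exp (- (\<delta> * \<bar>l\<bar>)) \<le> exp (\<delta> * \<bar>l\<bar>) * exp (- (\<delta> * \<bar>l\<bar>))"
      by (rule mult_right_mono) simp
    also have "\<dots> = 1" by (simp flip: exp_add)
    finally show ?thesis using \<delta> by (simp add: field_simps)
  qed
  have "cmod (strip_kernel' \<theta> c z l)
      = cmod (of_real l + 2 * z) * exp ((Re z - c) * l) * exp ((Re z)\<^sup>2 - (Im z)\<^sup>2 - \<theta>\<^sup>2)"
    by (simp add: strip_kernel'_def norm_mult cmod_strip_kernel)
  also have "\<dots> \<le> (\<bar>l\<bar> + 2 * cmod z) * exp (- (\<delta> * \<bar>l\<bar>)) * exp 1"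
    using norm_triangle_ineq[of "complex_of_real l" "2 * z"] 1 2
    by (intro mult_mono) (auto simp: norm_mult)
  also have "\<dots> \<le> (1/\<delta> + 2 * cmod z) * exp 1"
  proof (rule mult_right_mono)
    have "2 * cmod z * exp (- (\<delta> * \<bar>l\<bar>)) \<le> 2 * cmod z * 1"
      using \<delta> by (intro mult_left_mono) auto
    then show "(\<bar>l\<bar> + 2 * cmod z) * exp (- (\<delta> * \<bar>l\<bar>)) \<le> 1/\<delta> + 2 * cmod z"
      using 3 by (simp add: distrib_right)
  qed simp
  finally show ?thesis .
qed

text \<open>
  The size of the multiplier \<open>m\<close> relative to the weight that the line \<open>Re z = c\<close> carries on a piece with
  parameter \<open>l\<close>.
\<close>

definition kernel_weight :: "real \<Rightarrow> real \<Rightarrow> (real \<Rightarrow> complex) \<Rightarrow> real \<Rightarrow> real" where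
  "kernel_weight \<theta> c m l = exp ((\<theta> - c) * l) * cmod (m l)"

lemma kernel_weight_nonneg: "0 \<le> kernel_weight \<theta> c m l"
  by (simp add: kernel_weight_def)

lemma kernel_weight_eq: "kernel_weight \<theta> c m l = cmod (of_real (exp ((\<theta> - c) * l)) * m l)"
  by (simp add: kernel_weight_def norm_mult)

lemma kernel_weight_kernel:
  "kernel_weight \<theta> c (strip_kernel \<theta> \<theta> z) l = cmod (strip_kernel \<theta> c z l)"
  "kernel_weight \<theta> c (strip_kernel' \<theta> \<theta> z) l = cmod (strip_kernel' \<theta> c z l)"
  unfolding kernel_weight_eq strip_kernel_shift[of \<theta> c z l \<theta>] strip_kernel'_shift[of \<theta> c z l \<theta>] by auto

lemma kernel_weight_difference:
  "kernel_weight \<theta> c (\<lambda>l. strip_kernel \<theta> \<theta> w l - strip_kernel \<theta> \<theta> z l) l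
    = cmod (strip_kernel \<theta> c w l - strip_kernel \<theta> c z l)"
  unfolding kernel_weight_eq strip_kernel_shift[of \<theta> c w l \<theta>] strip_kernel_shift[of \<theta> c z l \<theta>]
  by (simp add: algebra_simps)

lemma kernel_weight_quotient:
  "kernel_weight \<theta> c (\<lambda>l. (strip_kernel \<theta> \<theta> w l - strip_kernel \<theta> \<theta> z l) / (w - z) - strip_kernel' \<theta> \<theta> z l) l
    = cmod ((strip_kernel \<theta> c w l - strip_kernel \<theta> c z l) / (w - z) - strip_kernel' \<theta> c z l)"
  unfolding kernel_weight_eq strip_kernel_shift[of \<theta> c w l \<theta>] strip_kernel_shift[of \<theta> c z l \<theta>]
    strip_kernel'_shift[of \<theta> c z l \<theta>]
  by (simp add: algebra_simps diff_divide_distrib)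

lemma boundary_kernel:
  assumes "c = 0 \<or> c = 1"
  shows "cmod (strip_kernel \<theta> c (Complex c t) l) \<le> exp (1 - t\<^sup>2)"
  using assms by (auto simp: cmod_strip_kernel intro: order_trans[of _ 0])

lemma boundary_kernel_1:
  assumes "c = 0 \<or> c = 1"
  shows "cmod (strip_kernel \<theta> c (Complex c t) l) \<le> exp 1"
  using boundary_kernel[OF assms, of \<theta> t l] by (rule order_trans) simp

lemma boundary_kernel_tendsto:
  "((\<lambda>t. strip_kernel \<theta> c (Complex c t) l) \<longlongrightarrow> strip_kernel \<theta> c (Complex c s) l) (at s)"
  unfolding strip_kernel_def by (intro tendsto_intros)

lemma exp_minus_sq_tendsto: "((\<lambda>t::real. exp (1 - t\<^sup>2)) \<longlongrightarrow> 0) at_infinity"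
proof (rule Lim_null_comparison)
  show "eventually (\<lambda>t::real. norm (exp (1 - t\<^sup>2)) \<le> exp 1 * inverse (norm t)) at_infinity"
    unfolding eventually_at_infinity
  proof (intro exI[of _ 1] allI impI)
    fix t :: real assume t: "1 \<le> norm t"
    have "\<bar>t\<bar> * 1 \<le> \<bar>t\<bar> * \<bar>t\<bar>" using t by (intro mult_left_mono) auto
    then have "\<bar>t\<bar> \<le> t\<^sup>2" by (simp add: power2_eq_square)
    also have "\<dots> \<le> exp (t\<^sup>2)" using exp_ge_add_one_self[of "t\<^sup>2"] by linarith
    finally have "inverse (exp (t\<^sup>2)) \<le> inverse \<bar>t\<bar>" using t by (intro le_imp_inverse_le) auto
    then have "exp 1 * inverse (exp (t\<^sup>2)) \<le> exp 1 * inverse \<bar>t\<bar>" by (intro mult_left_mono) auto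
    then show "norm (exp (1 - t\<^sup>2)) \<le> exp 1 * inverse (norm t)"
      by (simp add: exp_diff divide_inverse)
  qed
  have "((\<lambda>t::real. exp 1 * norm (inverse t)) \<longlongrightarrow> exp 1 * 0) at_infinity"
    by (intro tendsto_mult_left tendsto_norm_zero tendsto_inverse_0)
  then show "((\<lambda>t::real. exp 1 * inverse (norm t)) \<longlongrightarrow> 0) at_infinity"
    by (simp add: norm_inverse)
qed

text \<open>
  Used with radius \<open>2\<close> because the factorization of the outer sequence provides this radius.
\<close>

lemma mixed_ball_bounded_factor:
  fixes \<beta>' :: "int \<Rightarrow> real" and \<tau>' \<omega> :: "int \<Rightarrow> int \<Rightarrow> real"
  assumes \<beta>: "ell_ball \<kappa>' {-1..} 2 \<beta>'" and \<tau>: "\<And>k. k \<ge> -1 \<Longrightarrow> ell_ball \<rho>' UNIV 1 (\<tau>' k)"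
    and le: "\<And>k n. 0 \<le> \<omega> k n" "\<And>k n. \<omega> k n \<le> C"
  shows "mixed_ball \<kappa>' \<rho>' {-1..} (2 * C) (\<lambda>k n. \<beta>' k * \<tau>' k n * \<omega> k n)"
proof -
  have C: "0 \<le> C" using le[of 0 0] by simp
  have "mixed_ball \<kappa>' \<rho>' {-1..} (C * 2) (\<lambda>k n. C * (\<beta>' k * \<tau>' k n))"
    by (intro mixed_ball_scale mixed_ball_prod \<beta> \<tau> C) auto
  then show ?thesis
  proof (rule mixed_ball_mono)
    fix k :: int and n assume "k \<in> {-1..}"
    then have nn: "0 \<le> \<beta>' k" "0 \<le> \<tau>' k n"
      using ell_ballD(2)[OF \<beta>] ell_ballD(2)[OF \<tau>, of k n] by auto
    then show "0 \<le> \<beta>' k * \<tau>' k n * \<omega> k n" using le by simp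
    have "\<beta>' k * \<tau>' k n * \<omega> k n \<le> \<beta>' k * \<tau>' k n * C" using nn le by (intro mult_left_mono) auto
    then show "\<beta>' k * \<tau>' k n * \<omega> k n \<le> C * (\<beta>' k * \<tau>' k n)" by (simp add: mult_ac)
  qed simp
qed

lemma tendsto_zeroI:
  fixes g :: "'b \<Rightarrow> real"
  assumes U: "0 \<le> U" and nn: "eventually (\<lambda>w. 0 \<le> g w) G"
    and le: "\<And>\<epsilon>. \<epsilon> > 0 \<Longrightarrow> eventually (\<lambda>w. g w \<le> U * \<epsilon>) G"
  shows "(g \<longlongrightarrow> 0) G"
proof (rule tendstoI)
  fix e :: real assume e: "e > 0"
  have small: "U * (e / (U + 1)) < e" using U e by (simp add: field_simps)
  have "eventually (\<lambda>w. g w \<le> U * (e / (U + 1))) G" using U e by (intro le) auto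
  then show "eventually (\<lambda>w. dist (g w) 0 < e) G"
    using nn by eventually_elim (use small in auto)
qed

lemma boundary_difference:
  assumes c: "c = 0 \<or> c = 1"
  shows "cmod (strip_kernel \<theta> c (Complex c t) l - strip_kernel \<theta> c (Complex c s) l) \<le> 2 * exp 1"
    "((\<lambda>t. cmod (strip_kernel \<theta> c (Complex c t) l - strip_kernel \<theta> c (Complex c s) l)) \<longlongrightarrow> 0) (at s)"
proof -
  show "cmod (strip_kernel \<theta> c (Complex c t) l - strip_kernel \<theta> c (Complex c s) l) \<le> 2 * exp 1"
    using norm_triangle_ineq4[of "strip_kernel \<theta> c (Complex c t) l" "strip_kernel \<theta> c (Complex c s) l"]
      boundary_kernel_1[OF c, of \<theta> t l] boundary_kernel_1[OF c, of \<theta> s l] by linarith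
  show "((\<lambda>t. cmod (strip_kernel \<theta> c (Complex c t) l - strip_kernel \<theta> c (Complex c s) l)) \<longlongrightarrow> 0) (at s)"
    using boundary_kernel_tendsto[of \<theta> c l s]
    by (intro tendsto_norm_zero) (rule Lim_null[THEN iffD1])
qed

text \<open>
  One endpoint of the construction of an analytic family through \<open>h\<close>.  The sets \<open>F k n\<close> are the pieces, with
  parameter \<open>lam k n\<close>; on a piece, \<open>h\<close> rescaled by the value of the family on the line \<open>Re z = c\<close> is dominated
  by an atom of height given by the order continuous sequence \<open>\<beta> \<cdot> \<tau>\<close>.  The sets \<open>Z k\<close> are
  exceptional null sets, on which no such domination is available.
\<close>

locale HL_endpoint =
  fixes \<Omega> :: "'a::euclidean_space set" and \<theta> c p r a :: real and q :: ennreal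
    and h :: "'a \<Rightarrow> complex" and Y :: real and F :: "int \<Rightarrow> int \<Rightarrow> 'a set" and Z :: "int \<Rightarrow> 'a set"
    and \<Lambda> :: "'a \<Rightarrow> real" and lam :: "int \<Rightarrow> int \<Rightarrow> real"
    and \<beta> :: "int \<Rightarrow> real" and \<tau> :: "int \<Rightarrow> int \<Rightarrow> real"
  assumes \<Omega>: "\<Omega> \<in> sets lebesgue" and c: "c = 0 \<or> c = 1"
    and p: "0 < p" and r: "1 \<le> r" and q: "1 \<le> q"
    and h: "h \<in> borel_measurable (lebesgue_on \<Omega>)" and Y: "0 \<le> Y"
    and F: "\<And>k n. F k n \<in> sets lebesgue" "\<And>k n. k \<ge> -1 \<Longrightarrow> emeasure lebesgue (F k n) \<le> ennreal (2 powr real_of_int (n + 1))"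
    and Z: "\<And>k. k \<ge> -1 \<Longrightarrow> Z k \<in> null_sets lebesgue"
    and \<Lambda>: "\<Lambda> \<in> borel_measurable (lebesgue_on \<Omega>)"
    and cover: "\<And>k x. k \<ge> -1 \<Longrightarrow> x \<in> dyadic_shell \<Omega> k \<Longrightarrow> x \<notin> Z k \<Longrightarrow> h x \<noteq> 0 \<Longrightarrow>
        \<exists>n. x \<in> F k n \<and> \<Lambda> x = lam k n \<and> cmod (h x) * exp ((c - \<theta>) * lam k n)
            \<le> 2 powr (- (of_int k * a)) * 2 powr (- (real_of_int n / p)) * (Y * (\<beta> k * \<tau> k n))"
    and \<beta>: "ell_ball (enn2real (1/q)) {-1..} 2 \<beta>" "ell_tail_small (enn2real (1/q)) {-1..} \<beta>"
    and \<tau>: "\<And>k. k \<ge> -1 \<Longrightarrow> ell_ball (1/r) UNIV 1 (\<tau> k)"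
begin

abbreviation "E \<equiv> HL \<Omega> p r a q"
abbreviation "T \<equiv> multiplied h \<Lambda>"
abbreviation "wt \<equiv> kernel_weight \<theta> c"

definition bound :: real where "bound = lorentz_upper_const p r * Y"

lemma bound_nonneg: "0 \<le> bound"
  using lorentz_upper_const_nonneg Y by (auto simp: bound_def)

lemma T_mixed:
  assumes m: "m \<in> borel_measurable borel"
    and B: "mixed_ball (enn2real (1/q)) (1/r) {-1..} B (\<lambda>k n. \<beta> k * \<tau> k n * wt m (lam k n))"
  shows "T m \<in> carr E" "nrm E (T m) \<le> bound * B"
proof -
  have r0: "0 < r" using r by simp
  have meas: "T m \<in> borel_measurable (lebesgue_on \<Omega>)"
    unfolding multiplied_def by (intro borel_measurable_times h measurable_compose[OF \<Lambda> m])
  have s: "mixed_ball (enn2real (1/q)) (1/r) {-1..} (Y * B)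
      (\<lambda>k n. Y * (\<beta> k * \<tau> k n * wt m (lam k n)))"
    by (rule mixed_ball_scale[OF B Y])
  have "\<exists>n. x \<in> F k n \<and> cmod (T m x) \<le> 2 powr (- (of_int k * a)) * 2 powr (- (real_of_int n / p)) *
      (Y * (\<beta> k * \<tau> k n * wt m (lam k n)))"
    if k: "k \<ge> -1" and x: "x \<in> dyadic_shell \<Omega> k" "x \<notin> Z k" "T m x \<noteq> 0" for k x
  proof -
    have "h x \<noteq> 0" using x(3) by (auto simp: multiplied_def)
    then obtain n where n: "x \<in> F k n" "\<Lambda> x = lam k n"
      "cmod (h x) * exp ((c - \<theta>) * lam k n) \<le> 2 powr (- (of_int k * a)) * 2 powr (- (real_of_int n / p)) * (Y * (\<beta> k * \<tau> k n))"
      using cover[OF k x(1,2)] by blast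
    have "exp ((c - \<theta>) * lam k n) * exp ((\<theta> - c) * lam k n) = 1"
      by (simp add: algebra_simps flip: exp_add)
    then have "cmod (T m x) = (cmod (h x) * exp ((c - \<theta>) * lam k n)) * wt m (lam k n)"
      by (simp add: multiplied_def n(2) norm_mult kernel_weight_def)
    also have "\<dots> \<le> (2 powr (- (of_int k * a)) * 2 powr (- (real_of_int n / p)) * (Y * (\<beta> k * \<tau> k n))) * wt m (lam k n)"
      by (intro mult_right_mono n(3) kernel_weight_nonneg)
    finally show ?thesis using n(1) by (intro exI[of _ n]) (simp add: mult_ac)
  qed
  from HL_atomic[OF \<Omega> meas p r0 q refl F Z this s]
  show "T m \<in> carr E" "nrm E (T m) \<le> bound * B" by (auto simp: bound_def mult_ac)
qed

lemma T_bounded: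
  assumes "m \<in> borel_measurable borel" "\<And>l. wt m l \<le> C"
  shows "T m \<in> carr E" "nrm E (T m) \<le> bound * (2 * C)"
  using T_mixed[OF assms(1) mixed_ball_bounded_factor[OF \<beta>(1) \<tau> kernel_weight_nonneg assms(2)]] by auto

text \<open>
  Continuity at the endpoint needs the order continuity of \<open>\<beta>\<close>: the multipliers converge at each
  parameter, but not uniformly in the parameter.
\<close>

lemma T_tendsto:
  assumes m: "\<And>w. m w \<in> borel_measurable borel"
    and C: "eventually (\<lambda>w. \<forall>l. wt (m w) l \<le> C) G"
    and lim: "\<And>l. ((\<lambda>w. wt (m w) l) \<longlongrightarrow> 0) G"
  shows "((\<lambda>w. nrm E (T (m w))) \<longlongrightarrow> 0) G"
proof (rule tendsto_zeroI[OF bound_nonneg])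
  fix \<epsilon> :: real assume \<epsilon>: "\<epsilon> > 0"
  have "eventually (\<lambda>w. mixed_ball (enn2real (1/q)) (1/r) {-1..} \<epsilon> (\<lambda>k n. \<beta> k * \<tau> k n * wt (m w) (lam k n))) G"
  proof (rule mixed_ball_dominated[OF \<beta>(2)])
    show "eventually (\<lambda>w. \<forall>k\<in>{-1..}. \<forall>n. 0 \<le> wt (m w) (lam k n) \<and> wt (m w) (lam k n) \<le> C) G"
      using C by eventually_elim (auto simp: kernel_weight_nonneg)
  qed (use ell_ballD(2)[OF \<beta>(1)] \<tau> exponent_cases[OF q refl] r lim \<epsilon> in auto)
  then show "eventually (\<lambda>w. nrm E (T (m w)) \<le> bound * \<epsilon>) G"
    by eventually_elim (rule T_mixed(2)[OF m])
qed simp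

abbreviation "line t \<equiv> T (strip_kernel \<theta> \<theta> (Complex c t))"

lemma line_bound:
  shows "line t \<in> carr E" "nrm E (line t) \<le> bound * (2 * exp (1 - t\<^sup>2))"
  using T_bounded[OF strip_kernel_measurable(1)[of \<theta> \<theta> "Complex c t"], of "exp (1 - t\<^sup>2)"] boundary_kernel[OF c, of \<theta> t]
  by (simp_all add: kernel_weight_kernel)

lemma line_bound_uniform: "nrm E (line t) \<le> bound * (2 * exp 1)"
proof -
  have "exp (1 - t\<^sup>2) \<le> exp (1::real)" by simp
  then have "bound * (2 * exp (1 - t\<^sup>2)) \<le> bound * (2 * exp 1)"
    using bound_nonneg by (intro mult_left_mono) auto
  with line_bound(2) show ?thesis by (rule order_trans)
qed

lemma line_admissible: "boundary_admissible E line"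
  unfolding boundary_admissible_def fspace_continuous_on_def
proof (intro conjI ballI line_bound(1))
  fix s :: real
  have eq: "(\<lambda>u. line t u - line s u)
      = T (\<lambda>l. strip_kernel \<theta> \<theta> (Complex c t) l - strip_kernel \<theta> \<theta> (Complex c s) l)" for t
    by (simp add: multiplied_def algebra_simps fun_eq_iff)
  show "((\<lambda>t. nrm E (\<lambda>u. line t u - line s u)) \<longlongrightarrow> 0) (at s)"
    unfolding eq
    by (rule T_tendsto[where C = "2 * exp 1"], unfold kernel_weight_difference)
      (auto intro!: borel_measurable_diff strip_kernel_measurable boundary_difference[OF c] always_eventually)
next
  have "((\<lambda>t. bound * (2 * exp (1 - t\<^sup>2))) \<longlongrightarrow> bound * (2 * 0)) at_infinity"
    by (intro tendsto_mult_left exp_minus_sq_tendsto)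
  then have lim: "((\<lambda>t. bound * (2 * exp (1 - t\<^sup>2))) \<longlongrightarrow> 0) at_infinity" by simp
  show "((\<lambda>t. nrm E (line t)) \<longlongrightarrow> 0) at_infinity"
    by (rule Lim_null_comparison[OF _ lim]) (use line_bound(2) in \<open>auto intro!: always_eventually\<close>)
qed

end

section \<open>Analytic families in the sum space\<close>

text \<open>
  A multiplier is split according to the sign of the parameter: the part with \<open>l \<le> 0\<close> is estimated in
  \<open>A\<^sub>0\<close> and the part with \<open>l > 0\<close> in \<open>A\<^sub>1\<close>.
\<close>

definition lower_part :: "(real \<Rightarrow> complex) \<Rightarrow> real \<Rightarrow> complex" where
  "lower_part m = (\<lambda>l. if l \<le> 0 then m l else 0)"

definition upper_part :: "(real \<Rightarrow> complex) \<Rightarrow> real \<Rightarrow> complex" where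
  "upper_part m = (\<lambda>l. if l \<le> 0 then 0 else m l)"

lemma parts_measurable:
  assumes "m \<in> borel_measurable borel"
  shows "lower_part m \<in> borel_measurable borel" "upper_part m \<in> borel_measurable borel"
  unfolding lower_part_def upper_part_def using assms by measurable

lemma kernel_weight_parts:
  "kernel_weight \<theta> c (lower_part m) l = (if l \<le> 0 then kernel_weight \<theta> c m l else 0)"
  "kernel_weight \<theta> c (upper_part m) l = (if l \<le> 0 then 0 else kernel_weight \<theta> c m l)"
  by (auto simp: kernel_weight_def lower_part_def upper_part_def)

lemma multiplied_split:
  "multiplied h \<Lambda> m = (\<lambda>x. multiplied h \<Lambda> (lower_part m) x + multiplied h \<Lambda> (upper_part m) x)"
  by (auto simp: multiplied_def lower_part_def upper_part_def)

locale HL_resolution = HL_couple +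
  fixes h :: "'a \<Rightarrow> complex" and Y :: real and F :: "int \<Rightarrow> int \<Rightarrow> 'a set" and Z :: "int \<Rightarrow> 'a set"
    and \<Lambda> :: "'a \<Rightarrow> real" and lam :: "int \<Rightarrow> int \<Rightarrow> real"
    and \<beta>\<^sub>0 \<beta>\<^sub>1 :: "int \<Rightarrow> real" and \<tau>\<^sub>0 \<tau>\<^sub>1 :: "int \<Rightarrow> int \<Rightarrow> real"
  assumes left: "HL_endpoint \<Omega> \<theta> 0 p\<^sub>0 r\<^sub>0 a\<^sub>0 q\<^sub>0 h Y F Z \<Lambda> lam \<beta>\<^sub>0 \<tau>\<^sub>0"
    and right: "HL_endpoint \<Omega> \<theta> 1 p\<^sub>1 r\<^sub>1 a\<^sub>1 q\<^sub>1 h Y F Z \<Lambda> lam \<beta>\<^sub>1 \<tau>\<^sub>1"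
begin

sublocale E0: HL_endpoint \<Omega> \<theta> 0 p\<^sub>0 r\<^sub>0 a\<^sub>0 q\<^sub>0 h Y F Z \<Lambda> lam \<beta>\<^sub>0 \<tau>\<^sub>0 by (rule left)
sublocale E1: HL_endpoint \<Omega> \<theta> 1 p\<^sub>1 r\<^sub>1 a\<^sub>1 q\<^sub>1 h Y F Z \<Lambda> lam \<beta>\<^sub>1 \<tau>\<^sub>1 by (rule right)

abbreviation "T \<equiv> multiplied h \<Lambda>"
abbreviation "wt \<equiv> kernel_weight \<theta>"
abbreviation "ker \<equiv> strip_kernel \<theta> \<theta>"
abbreviation "ker' \<equiv> strip_kernel' \<theta> \<theta>"
abbreviation "fam z \<equiv> T (ker z)"

lemma T_parts:
  assumes m: "m \<in> borel_measurable borel"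
    and C: "\<And>l. l \<le> 0 \<Longrightarrow> wt 0 m l \<le> C" "\<And>l. 0 < l \<Longrightarrow> wt 1 m l \<le> C"
  shows "T (lower_part m) \<in> carr A\<^sub>0" "nrm A\<^sub>0 (T (lower_part m)) \<le> E0.bound * (2 * C)"
    "T (upper_part m) \<in> carr A\<^sub>1" "nrm A\<^sub>1 (T (upper_part m)) \<le> E1.bound * (2 * C)"
proof -
  have C0: "0 \<le> C" using C(1)[of 0] kernel_weight_nonneg[of \<theta> 0 m 0] by simp
  have lo: "wt 0 (lower_part m) l \<le> C" and hi: "wt 1 (upper_part m) l \<le> C" for l
    using C[of l] C0 by (auto simp: kernel_weight_parts)
  show "T (lower_part m) \<in> carr A\<^sub>0" "nrm A\<^sub>0 (T (lower_part m)) \<le> E0.bound * (2 * C)"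
    "T (upper_part m) \<in> carr A\<^sub>1" "nrm A\<^sub>1 (T (upper_part m)) \<le> E1.bound * (2 * C)"
    using E0.T_bounded[OF parts_measurable(1)[OF m] lo] E1.T_bounded[OF parts_measurable(2)[OF m] hi] by auto
qed

lemma T_sum:
  assumes m: "m \<in> borel_measurable borel"
    and C: "\<And>l. l \<le> 0 \<Longrightarrow> wt 0 m l \<le> C" "\<And>l. 0 < l \<Longrightarrow> wt 1 m l \<le> C"
  shows "T m \<in> carr S" "nrm S (T m) \<le> nrm A\<^sub>0 (T (lower_part m)) + nrm A\<^sub>1 (T (upper_part m))"
    "nrm S (T m) \<le> (E0.bound + E1.bound) * (2 * C)"
proof -
  note lh = T_parts[OF assms]
  show "T m \<in> carr S"
    unfolding carr_sum by (rule bexI[OF _ lh(1)], rule bexI[OF _ lh(3)], rule multiplied_split)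
  show 1: "nrm S (T m) \<le> nrm A\<^sub>0 (T (lower_part m)) + nrm A\<^sub>1 (T (upper_part m))"
    by (subst multiplied_split) (rule nrm_sum_le[OF lh(1,3)])
  have "\<dots> \<le> (E0.bound + E1.bound) * (2 * C)" using lh(2,4) by (simp add: algebra_simps)
  with 1 show "nrm S (T m) \<le> (E0.bound + E1.bound) * (2 * C)" by (rule order_trans)
qed

text \<open>
  Only the half-line on which a kernel is bounded has to be controlled in each of the two spaces.
\<close>

lemma T_sum_tendsto:
  assumes m: "\<And>w. m w \<in> borel_measurable borel"
    and C: "eventually (\<lambda>w. \<forall>l. (l \<le> 0 \<longrightarrow> wt 0 (m w) l \<le> C) \<and> (0 < l \<longrightarrow> wt 1 (m w) l \<le> C)) G"
    and lim: "\<And>l. ((\<lambda>w. wt 0 (m w) l) \<longlongrightarrow> 0) G" "\<And>l. ((\<lambda>w. wt 1 (m w) l) \<longlongrightarrow> 0) G"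
  shows "((\<lambda>w. nrm S (T (m w))) \<longlongrightarrow> 0) G"
proof -
  have 0: "((\<lambda>w. nrm A\<^sub>0 (T (lower_part (m w)))) \<longlongrightarrow> 0) G"
  proof (rule E0.T_tendsto[OF parts_measurable(1)[OF m]])
    show "eventually (\<lambda>w. \<forall>l. wt 0 (lower_part (m w)) l \<le> C) G"
      using C
    proof eventually_elim
      case (elim w)
      then have "0 \<le> C" using kernel_weight_nonneg[of \<theta> 0 "m w" 0] order_trans by blast
      then show ?case using elim by (auto simp: kernel_weight_parts)
    qed
    show "((\<lambda>w. wt 0 (lower_part (m w)) l) \<longlongrightarrow> 0) G" for l
      using lim(1)[of l] by (cases "l \<le> 0") (auto simp: kernel_weight_parts)
  qed
  have 1: "((\<lambda>w. nrm A\<^sub>1 (T (upper_part (m w)))) \<longlongrightarrow> 0) G"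
  proof (rule E1.T_tendsto[OF parts_measurable(2)[OF m]])
    show "eventually (\<lambda>w. \<forall>l. wt 1 (upper_part (m w)) l \<le> C) G"
      using C
    proof eventually_elim
      case (elim w)
      then have "0 \<le> C" using kernel_weight_nonneg[of \<theta> 0 "m w" 0] order_trans by blast
      then show ?case using elim by (auto simp: kernel_weight_parts)
    qed
    show "((\<lambda>w. wt 1 (upper_part (m w)) l) \<longlongrightarrow> 0) G" for l
      using lim(2)[of l] by (cases "l \<le> 0") (auto simp: kernel_weight_parts)
  qed
  have sum: "((\<lambda>w. nrm A\<^sub>0 (T (lower_part (m w))) + nrm A\<^sub>1 (T (upper_part (m w)))) \<longlongrightarrow> 0) G"
    using tendsto_add[OF 0 1] by simp
  show ?thesis
  proof (rule Lim_null_comparison[OF _ sum])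
    show "eventually (\<lambda>w. norm (nrm S (T (m w))) \<le> nrm A\<^sub>0 (T (lower_part (m w))) + nrm A\<^sub>1 (T (upper_part (m w)))) G"
      using C
    proof eventually_elim
      case (elim w)
      then have e: "\<And>l. l \<le> 0 \<Longrightarrow> wt 0 (m w) l \<le> C" "\<And>l. 0 < l \<Longrightarrow> wt 1 (m w) l \<le> C" by auto
      show ?case
        using nrm_sum_nonneg[OF T_sum(1)[OF m e]] T_sum(2)[OF m e] by simp
    qed
  qed
qed

lemma fam_diff: "(\<lambda>u. fam w u - fam z u) = T (\<lambda>l. ker w l - ker z l)"
  by (auto simp: multiplied_def algebra_simps)

lemma fam_quot: "(\<lambda>u. (fam w u - fam z u) / (w - z) - T (ker' z) u) = T (\<lambda>l. (ker w l - ker z l) / (w - z) - ker' z l)"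
  by (auto simp: multiplied_def algebra_simps diff_divide_distrib)

lemma fam_at_theta: "fam (of_real \<theta>) = h"
  by (auto simp: multiplied_def strip_kernel_def)

lemma fam_sum:
  assumes "z \<in> closed_strip"
  shows "fam z \<in> carr S" "nrm S (fam z) \<le> (E0.bound + E1.bound) * (2 * exp 1)"
proof -
  have "l \<le> 0 \<Longrightarrow> wt 0 (ker z) l \<le> exp 1" "0 < l \<Longrightarrow> wt 1 (ker z) l \<le> exp 1" for l
    unfolding kernel_weight_kernel by (rule strip_kernel_le[OF assms]; simp)+
  from T_sum(1,3)[OF strip_kernel_measurable(1) this]
  show "fam z \<in> carr S" "nrm S (fam z) \<le> (E0.bound + E1.bound) * (2 * exp 1)" by auto
qed

lemma fam_continuous: "fspace_continuous_on S closed_strip fam"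
  unfolding fspace_continuous_on_def
proof (intro conjI ballI fam_sum)
  fix z assume z: "z \<in> closed_strip"
  show "((\<lambda>w. nrm S (\<lambda>u. fam w u - fam z u)) \<longlongrightarrow> 0) (at z within closed_strip)"
    unfolding fam_diff
  proof (rule T_sum_tendsto[where C = "exp 1 + exp 1"])
    show "(\<lambda>l. ker w l - ker z l) \<in> borel_measurable borel" for w
      by (intro borel_measurable_diff strip_kernel_measurable)
    show "eventually (\<lambda>w. \<forall>l. (l \<le> 0 \<longrightarrow> wt 0 (\<lambda>l. ker w l - ker z l) l \<le> exp 1 + exp 1) \<and>
        (0 < l \<longrightarrow> wt 1 (\<lambda>l. ker w l - ker z l) l \<le> exp 1 + exp 1)) (at z within closed_strip)"
      unfolding eventually_at_filter
    proof (intro always_eventually allI impI conjI)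
      fix w l assume w: "w \<in> closed_strip"
      have *: "cmod (strip_kernel \<theta> c w l - strip_kernel \<theta> c z l) \<le> exp 1 + exp 1"
        if "c = 0 \<and> l \<le> 0 \<or> c = 1 \<and> 0 < l" for c
        using norm_triangle_ineq4[of "strip_kernel \<theta> c w l" "strip_kernel \<theta> c z l"]
          strip_kernel_le[OF w that, of \<theta>] strip_kernel_le[OF z that, of \<theta>] by linarith
      show "l \<le> 0 \<Longrightarrow> wt 0 (\<lambda>l. ker w l - ker z l) l \<le> exp 1 + exp 1"
        "0 < l \<Longrightarrow> wt 1 (\<lambda>l. ker w l - ker z l) l \<le> exp 1 + exp 1"
        unfolding kernel_weight_difference by (rule *; simp)+
    qed
    have "((\<lambda>w. wt c (\<lambda>l. ker w l - ker z l) l) \<longlongrightarrow> 0) (at z within closed_strip)" for c l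
      unfolding kernel_weight_difference
      using strip_kernel_tendsto[of \<theta> c l z closed_strip]
      by (intro tendsto_norm_zero) (rule Lim_null[THEN iffD1])
    then show "((\<lambda>w. wt 0 (\<lambda>l. ker w l - ker z l) l) \<longlongrightarrow> 0) (at z within closed_strip)"
      "((\<lambda>w. wt 1 (\<lambda>l. ker w l - ker z l) l) \<longlongrightarrow> 0) (at z within closed_strip)" for l by auto
  qed
qed

text \<open>
  The difference quotients of the kernel are bounded by its derivative near \<open>z\<close>, uniformly in the
  parameter, and converge at each parameter.
\<close>

lemma fam_analytic: "fspace_analytic_on S open_strip fam"
  unfolding fspace_analytic_on_def
proof (intro conjI ballI)
  fix z assume "z \<in> open_strip"
  then show "fam z \<in> carr S" by (intro fam_sum) (auto simp: open_strip_def closed_strip_def)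
next
  fix z assume z: "z \<in> open_strip"
  \<comment> \<open>A ball of this radius around \<open>z\<close> keeps the distance \<open>\<delta>\<close> from the boundary of the strip.\<close>
  define \<delta> where "\<delta> = min (Re z) (1 - Re z) / 2"
  have \<delta>: "0 < \<delta>" "2 * \<delta> \<le> Re z" "Re z \<le> 1 - 2 * \<delta>"
    using z by (auto simp: \<delta>_def open_strip_def)
  define C where "C = (1/\<delta> + 2 * (cmod z + \<delta>)) * exp 1"
  have kb: "cmod (strip_kernel' \<theta> c w l) \<le> C"
    if w: "w \<in> ball z \<delta>" and c: "c = 0 \<and> l \<le> 0 \<or> c = 1 \<and> 0 < l" for w c l
  proof -
    have d: "cmod (z - w) < \<delta>" using w by (simp add: dist_norm)
    then have "\<bar>Re z - Re w\<bar> < \<delta>" using abs_Re_le_cmod[of "z - w"] by simp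
    then have r: "\<delta> \<le> Re w" "Re w \<le> 1 - \<delta>" using \<delta> by auto
    have "cmod w \<le> cmod z + \<delta>" using norm_triangle_sub[of w z] d by (simp add: norm_minus_commute)
    then have "(1/\<delta> + 2 * cmod w) * exp 1 \<le> C" unfolding C_def by (intro mult_right_mono) auto
    with strip_kernel'_le[OF \<delta>(1) r c, of \<theta>] show ?thesis by (rule order_trans)
  qed
  have zb: "z \<in> ball z \<delta>" using \<delta> by simp
  have g: "T (ker' z) \<in> carr S"
  proof (rule T_sum(1)[OF strip_kernel_measurable(2)])
    show "l \<le> 0 \<Longrightarrow> wt 0 (ker' z) l \<le> C" "0 < l \<Longrightarrow> wt 1 (ker' z) l \<le> C" for l
      unfolding kernel_weight_kernel by (rule kb[OF zb]; simp)+
  qed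
  have "((\<lambda>w. nrm S (\<lambda>u. (fam w u - fam z u) / (w - z) - T (ker' z) u)) \<longlongrightarrow> 0) (at z within open_strip)"
    unfolding fam_quot
  proof (rule T_sum_tendsto[where C = "C + C"])
    show "(\<lambda>l. (ker w l - ker z l) / (w - z) - ker' z l) \<in> borel_measurable borel" for w
      by (intro borel_measurable_diff borel_measurable_divide strip_kernel_measurable borel_measurable_const)
    have qb: "cmod ((strip_kernel \<theta> c w l - strip_kernel \<theta> c z l) / (w - z) - strip_kernel' \<theta> c z l) \<le> C + C"
      if w: "w \<in> ball z \<delta>" "w \<noteq> z" and c: "c = 0 \<and> l \<le> 0 \<or> c = 1 \<and> 0 < l" for w c l
    proof -
      have "cmod (strip_kernel \<theta> c w l - strip_kernel \<theta> c z l) \<le> C * cmod (w - z)"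
        by (rule field_differentiable_bound[of "ball z \<delta>" "\<lambda>z. strip_kernel \<theta> c z l" "\<lambda>z. strip_kernel' \<theta> c z l"])
          (use w zb kb c in \<open>auto intro: strip_kernel_deriv\<close>)
      then have "cmod ((strip_kernel \<theta> c w l - strip_kernel \<theta> c z l) / (w - z)) \<le> C"
        using w(2) by (simp add: norm_divide pos_divide_le_eq)
      then show ?thesis
        using norm_triangle_ineq4[of "(strip_kernel \<theta> c w l - strip_kernel \<theta> c z l) / (w - z)" "strip_kernel' \<theta> c z l"]
          kb[OF zb c] by linarith
    qed
    have ev: "eventually (\<lambda>w. w \<in> ball z \<delta>) (at z within open_strip)"
      by (rule eventually_at_in_open'[OF open_ball zb, THEN filter_leD[OF at_le, rotated]]) simp
    have ev': "eventually (\<lambda>w. w \<noteq> z) (at z within open_strip)"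
      by (auto simp: eventually_at_filter)
    show "eventually (\<lambda>w. \<forall>l. (l \<le> 0 \<longrightarrow> wt 0 (\<lambda>l. (ker w l - ker z l) / (w - z) - ker' z l) l \<le> C + C) \<and>
        (0 < l \<longrightarrow> wt 1 (\<lambda>l. (ker w l - ker z l) / (w - z) - ker' z l) l \<le> C + C)) (at z within open_strip)"
      using ev ev'
    proof eventually_elim
      case (elim w)
      show ?case unfolding kernel_weight_quotient by (intro allI conjI impI; rule qb[OF elim]; simp)
    qed
    have "((\<lambda>w. wt c (\<lambda>l. (ker w l - ker z l) / (w - z) - ker' z l) l) \<longlongrightarrow> 0) (at z within open_strip)" for c l
      unfolding kernel_weight_quotient
      using strip_kernel_deriv[of \<theta> c l z open_strip, unfolded has_field_derivative_iff]
      by (intro tendsto_norm_zero) (rule Lim_null[THEN iffD1])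
    then show "((\<lambda>w. wt 0 (\<lambda>l. (ker w l - ker z l) / (w - z) - ker' z l) l) \<longlongrightarrow> 0) (at z within open_strip)"
      "((\<lambda>w. wt 1 (\<lambda>l. (ker w l - ker z l) / (w - z) - ker' z l) l) \<longlongrightarrow> 0) (at z within open_strip)" for l by auto
  qed
  then show "\<exists>g\<in>carr S. ((\<lambda>w. nrm S (\<lambda>u. (fam w u - fam z u) / (w - z) - g u)) \<longlongrightarrow> 0) (at z within open_strip)"
    using g by blast
qed

lemma fam_calderon: "fam \<in> calderon_F A\<^sub>0 A\<^sub>1"
  using fam_continuous fam_analytic E0.line_admissible E1.line_admissible fam_sum(2)
  unfolding calderon_F_def by blast

lemma fam_norm_le: "calderon_F_norm A\<^sub>0 A\<^sub>1 fam \<le> (lorentz_upper_const p\<^sub>0 r\<^sub>0 + lorentz_upper_const p\<^sub>1 r\<^sub>1) * (2 * exp 1) * Y"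
proof -
  have "calderon_F_norm A\<^sub>0 A\<^sub>1 fam \<le> max (E0.bound * (2 * exp 1)) (E1.bound * (2 * exp 1))"
    unfolding calderon_F_norm_def
    by (intro max.mono cSUP_least E0.line_bound_uniform E1.line_bound_uniform) auto
  also have "\<dots> \<le> E0.bound * (2 * exp 1) + E1.bound * (2 * exp 1)"
    using E0.bound_nonneg E1.bound_nonneg by simp
  finally show ?thesis by (simp add: E0.bound_def E1.bound_def algebra_simps)
qed

end

section \<open>HL is contained in the interpolation space\<close>

context HL_couple
begin

text \<open>
  The pieces are \<open>F k n = {h\<^sup>*(2\<^sup>n\<^sup>+\<^sup>1) < |h| \<le> h\<^sup>*(2\<^sup>n)}\<close> in the \<open>k\<close>-th shell.  The weighted values of \<open>h\<^sup>*\<close> form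
  a sequence \<open>y\<close> of norm at most \<open>Y\<close>, and \<open>y = Y e0\<^sup>1\<^sup>-\<^sup>\<theta> e1\<^sup>\<theta>\<close> with \<open>ei k n = \<beta>i k (y k n / b k) powr (r/ri)\<close>, where
  \<open>b k\<close> bounds the norm of \<open>h\<close> on the shell and \<open>\<beta>0\<close>, \<open>\<beta>1\<close> factor the sequence \<open>b/Y\<close>.  Undoing the weights turns
  \<open>e0\<close>, \<open>e1\<close> into heights \<open>g0\<close>, \<open>g1\<close> with \<open>g0\<^sup>1\<^sup>-\<^sup>\<theta> g1\<^sup>\<theta> = h\<^sup>*(2\<^sup>n)\<close>, and with \<open>lam = ln (g1/g0)\<close> the family multiplies the
  bound \<open>h\<^sup>*(2\<^sup>n)\<close> to \<open>g0\<close> on the left line and to \<open>g1\<close> on the right line.  The parameter \<open>Y > 0\<close> instead of the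
  norm itself covers functions of norm \<open>0\<close>.
\<close>

lemma HL_into_interpolation:
  assumes hA: "h \<in> carr A" and Y: "0 < Y" "lorentz_lower_const p r * nrm A h \<le> Y"
  shows "\<exists>f\<in>calderon_F A\<^sub>0 A\<^sub>1. f (of_real \<theta>) = h \<and>
    calderon_F_norm A\<^sub>0 A\<^sub>1 f \<le> (lorentz_upper_const p\<^sub>0 r\<^sub>0 + lorentz_upper_const p\<^sub>1 r\<^sub>1) * (2 * exp 1) * Y"
proof -
  define L where "L = lorentz_lower_const p r"
  have L: "0 < L" unfolding L_def by (rule lorentz_lower_const_pos)
  have hm: "h \<in> borel_measurable (lebesgue_on \<Omega>)" by (rule HL_D(1)[OF hA])
  note shell = dyadic_shell_sets[OF \<Omega>] and hk = measurable_on_shell[OF hm]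
  define b where "b = (\<lambda>k. 2 powr (of_int k * a) * (L * shell_norm \<Omega> p r h k))"
  have b: "ell_ball \<kappa> {-1..} Y b"
  proof (rule ell_ball_mono[OF ell_ball_scale[OF HL_ell_ball[OF hA q1 refl] less_imp_le[OF L]]])
    show "L * nrm A h \<le> Y" using Y by (simp add: L_def)
  qed (use L in \<open>auto simp: b_def\<close>)
  \<comment> \<open>Normalised, because \<open>ell_ball_factorization\<close> is stated for radius \<open>1\<close>.\<close>
  define X where "X = (\<lambda>k. (1 / Y) * b k)"
  have X: "ell_ball \<kappa> {-1..} 1 X"
    unfolding X_def using ell_ball_scale[OF b, of "1 / Y"] Y by simp
  obtain \<beta>\<^sub>0 \<beta>\<^sub>1 where \<beta>: "ell_ball \<kappa>\<^sub>0 {-1..} 2 \<beta>\<^sub>0" "ell_ball \<kappa>\<^sub>1 {-1..} 2 \<beta>\<^sub>1"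
    "ell_tail_small \<kappa>\<^sub>0 {-1..} \<beta>\<^sub>0" "ell_tail_small \<kappa>\<^sub>1 {-1..} \<beta>\<^sub>1"
    "\<And>k. k \<ge> -1 \<Longrightarrow> X k = \<beta>\<^sub>0 k powr (1 - \<theta>) * \<beta>\<^sub>1 k powr \<theta>"
    "\<And>k. k \<ge> -1 \<Longrightarrow> X k > 0 \<Longrightarrow> \<beta>\<^sub>0 k > 0 \<and> \<beta>\<^sub>1 k > 0"
    by (rule ell_ball_factorization[OF X \<theta> kappa01(1-4) kappa(1,2)]) blast
  define u where "u = (\<lambda>k n. enn2real (dyadic_dr (dyadic_shell \<Omega> k) h n))"
  define y where "y = (\<lambda>k n. 2 powr (of_int k * a) * (2 powr (real_of_int n / p) * u k n))"
  have u0: "0 \<le> u k n" and y0: "0 \<le> y k n" for k n by (auto simp: u_def y_def)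
  have du: "dyadic_dr (dyadic_shell \<Omega> k) h n = ennreal (u k n)" if k: "k \<ge> -1" for k n
    using lorentz_lower(2)[OF exps(3,6) shell_norm_nonneg, of "dyadic_shell \<Omega> k" h \<Omega> p r h k n] HL_D(2)[OF hA k]
    by (simp add: u_def)
  have y: "ell_ball (1/r) UNIV (b k) (y k)" if k: "k \<ge> -1" for k
  proof -
    have "ell_ball (1/r) UNIV (b k) (\<lambda>n. 2 powr (of_int k * a) * dyadic_seq (dyadic_shell \<Omega> k) p h n)"
      unfolding b_def L_def
      by (intro ell_ball_scale lorentz_lower(1) exps(3,6)) (auto simp: HL_D(2)[OF hA k])
    then show ?thesis by (simp add: y_def u_def dyadic_seq_def)
  qed
  have umono: "u k m \<le> u k n" if "n \<le> m" "k \<ge> -1" for k m n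
  proof -
    have "dyadic_dr (dyadic_shell \<Omega> k) h m \<le> dyadic_dr (dyadic_shell \<Omega> k) h n"
      using that by (intro dr_antimono) simp
    then show ?thesis using u0 by (simp add: du[OF that(2)])
  qed
  define \<tau> where "\<tau> = (\<lambda>s k n. (y k n / b k) powr (r / s))"
  have \<tau>: "ell_ball (1/s) UNIV 1 (\<tau> s k)" if s: "0 < s" and k: "k \<ge> -1" for s k
  proof (rule ell_ballI_sum)
    fix N :: "int set" assume N: "finite N" "N \<subseteq> UNIV"
    have b0: "0 \<le> b k" using ell_ballD(1)[OF y[OF k]] .
    have "(\<Sum>n\<in>N. \<tau> s k n powr (1/(1/s))) = (\<Sum>n\<in>N. y k n powr (1/(1/r))) / b k powr (1/(1/r))"
      unfolding sum_divide_distrib using s b0 y0 by (intro sum.cong) (auto simp: \<tau>_def powr_powr powr_divide)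
    also have "\<dots> \<le> 1"
      using ell_ballD(4)[OF y[OF k] _ N] exps by (auto simp: divide_le_eq_1)
    finally show "(\<Sum>n\<in>N. \<tau> s k n powr (1/(1/s))) \<le> 1 powr (1/(1/s))" by simp
  qed (use s in \<open>auto simp: \<tau>_def\<close>)
  define g0 where "g0 = (\<lambda>k n. 2 powr (- (of_int k * a\<^sub>0)) * 2 powr (- (real_of_int n / p\<^sub>0)) * (Y * (\<beta>\<^sub>0 k * \<tau> r\<^sub>0 k n)))"
  define g1 where "g1 = (\<lambda>k n. 2 powr (- (of_int k * a\<^sub>1)) * 2 powr (- (real_of_int n / p\<^sub>1)) * (Y * (\<beta>\<^sub>1 k * \<tau> r\<^sub>1 k n)))"
  define lam where "lam = (\<lambda>k n. ln (g1 k n / g0 k n))"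
  have lam: "u k n * exp (- (\<theta> * lam k n)) = g0 k n" "u k n * exp ((1 - \<theta>) * lam k n) = g1 k n"
    if k: "k \<ge> -1" and un: "0 < u k n" for k n
  proof -
    have yp: "0 < y k n" using un by (simp add: y_def)
    then have bp: "0 < b k" using ell_ballD(3)[OF y[OF k], of n] by simp
    then have Xp: "0 < X k" using Y by (simp add: X_def)
    have \<beta>p: "0 < \<beta>\<^sub>0 k" "0 < \<beta>\<^sub>1 k" using \<beta>(6)[OF k Xp] by auto
    have \<tau>p: "0 < \<tau> s k n" for s using yp bp by (simp add: \<tau>_def)
    have gp: "0 < g0 k n" "0 < g1 k n" using \<beta>p \<tau>p Y by (auto simp: g0_def g1_def)
    have u_eq: "g0 k n powr (1 - \<theta>) * g1 k n powr \<theta> = u k n"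
    proof -
      have ex: "r / r\<^sub>0 * (1 - \<theta>) + r / r\<^sub>1 * \<theta> = 1"
      proof -
        have "r / r\<^sub>0 * (1 - \<theta>) + r / r\<^sub>1 * \<theta> = r * (1 / r)"
          unfolding r_eq by (simp add: algebra_simps)
        then show ?thesis using exps by simp
      qed
      have t: "\<tau> r\<^sub>0 k n powr (1 - \<theta>) * \<tau> r\<^sub>1 k n powr \<theta> = y k n / b k"
        unfolding \<tau>_def powr_powr powr_add[symmetric] ex using yp bp by simp
      have Yt: "Y powr (1 - \<theta>) * Y powr \<theta> = Y" using Y by (simp flip: powr_add)
      have "g0 k n powr (1 - \<theta>) * g1 k n powr \<theta> =
         ((2 powr (- of_int k * a\<^sub>0)) powr (1 - \<theta>) * (2 powr (- of_int k * a\<^sub>1)) powr \<theta>) *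
         ((2 powr (- real_of_int n / p\<^sub>0)) powr (1 - \<theta>) * (2 powr (- real_of_int n / p\<^sub>1)) powr \<theta>) *
         ((Y powr (1 - \<theta>) * Y powr \<theta>) * ((\<beta>\<^sub>0 k powr (1 - \<theta>) * \<beta>\<^sub>1 k powr \<theta>) *
         (\<tau> r\<^sub>0 k n powr (1 - \<theta>) * \<tau> r\<^sub>1 k n powr \<theta>)))"
        unfolding g0_def g1_def powr_mult by (simp add: mult_ac)
      also have "\<dots> = 2 powr (- of_int k * a) * 2 powr (- real_of_int n / p) * (Y * (X k * (y k n / b k)))"
        unfolding weight_interpolation t Yt \<beta>(5)[OF k, symmetric] ..
      also have "\<dots> = 2 powr (- of_int k * a) * 2 powr (- real_of_int n / p) * y k n"
        using Y bp by (simp add: X_def)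
      also have "\<dots> = u k n" by (simp add: y_def powr_minus field_simps)
      finally show ?thesis .
    qed
    have e: "exp (c * lam k n) = g1 k n powr c / g0 k n powr c" for c
      using gp by (simp add: lam_def powr_def ln_div algebra_simps flip: exp_diff)
    have "u k n * exp (- \<theta> * lam k n) = g0 k n powr (1 - \<theta>) * g1 k n powr \<theta> * (g1 k n powr (- \<theta>) / g0 k n powr (- \<theta>))"
      unfolding e u_eq ..
    also have "\<dots> = g0 k n powr (1 - \<theta>) * g0 k n powr \<theta>" using gp by (simp add: powr_minus field_simps)
    also have "\<dots> = g0 k n" using gp by (simp flip: powr_add)
    finally show "u k n * exp (- (\<theta> * lam k n)) = g0 k n" by simp
    have "u k n * exp ((1 - \<theta>) * lam k n) = g0 k n powr (1 - \<theta>) * g1 k n powr \<theta> * (g1 k n powr (1 - \<theta>) / g0 k n powr (1 - \<theta>))"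
      unfolding e u_eq ..
    also have "\<dots> = g1 k n powr \<theta> * g1 k n powr (1 - \<theta>)" using gp by simp
    also have "\<dots> = g1 k n" using gp by (simp flip: powr_add)
    finally show "u k n * exp ((1 - \<theta>) * lam k n) = g1 k n" .
  qed
  define F where "F = (\<lambda>k n. {x\<in>dyadic_shell \<Omega> k. u k (n + 1) < cmod (h x)} \<inter> {x\<in>dyadic_shell \<Omega> k. cmod (h x) \<le> u k n})"
  \<comment> \<open>On these null sets \<open>|h|\<close> exceeds its essential supremum.\<close>
  define Z where "Z = (\<lambda>k. \<Inter>n. {x\<in>dyadic_shell \<Omega> k. u k n < cmod (h x)})"
  have superlevel: "emeasure lebesgue {x\<in>dyadic_shell \<Omega> k. u k n < cmod (h x)} \<le> ennreal (2 powr real_of_int n)"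
    if k: "k \<ge> -1" for k n
    using dr_le_iff[OF shell[of k] hk[of k] u0[of k n], of "2 powr real_of_int n"] du[OF k, of n] by simp
  have Fm: "F k n \<in> sets lebesgue" for k n
    unfolding F_def by (intro sets.Int superlevel_sets shell hk)
  have Fe: "emeasure lebesgue (F k n) \<le> ennreal (2 powr real_of_int (n + 1))" if k: "k \<ge> -1" for k n
  proof -
    have "emeasure lebesgue (F k n) \<le> emeasure lebesgue {x\<in>dyadic_shell \<Omega> k. u k (n + 1) < cmod (h x)}"
      unfolding F_def by (intro emeasure_mono superlevel_sets shell hk) auto
    then show ?thesis using superlevel[OF k] by (rule order_trans)
  qed
  have Zn: "Z k \<in> null_sets lebesgue" if k: "k \<ge> -1" for k
  proof (rule null_setsI)
    show Zm: "Z k \<in> sets lebesgue"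
      unfolding Z_def using superlevel_sets(1)[OF shell hk, of k] by (intro sets.countable_INT) auto
    have "emeasure lebesgue (Z k) \<le> 0"
    proof (rule ennreal_le_epsilon)
      fix e :: real assume e: "0 < e"
      define n where "n = \<lfloor>log 2 e\<rfloor>"
      have "2 powr real_of_int n \<le> 2 powr (log 2 e)" unfolding n_def by (intro powr_mono) auto
      then have ne: "2 powr real_of_int n \<le> e" using e by simp
      have "emeasure lebesgue (Z k) \<le> emeasure lebesgue {x\<in>dyadic_shell \<Omega> k. u k n < cmod (h x)}"
        unfolding Z_def by (intro emeasure_mono superlevel_sets shell hk) auto
      also have "\<dots> \<le> ennreal (2 powr real_of_int n)" by (rule superlevel[OF k])
      also have "\<dots> \<le> ennreal e" using ne by (rule ennreal_leI)
      finally show "emeasure lebesgue (Z k) \<le> 0 + ennreal e" by simp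
    qed
    then show "emeasure lebesgue (Z k) = 0" by simp
  qed
  have Funique: "k = l \<and> n = m" if "x \<in> F k n" "x \<in> F l m" "k \<ge> -1" "l \<ge> -1" for x k l n m
  proof -
    have kl: "k = l" using that by (auto simp: F_def intro: dyadic_shell_unique)
    have x: "u k (n + 1) < cmod (h x)" "cmod (h x) \<le> u k n" "u k (m + 1) < cmod (h x)" "cmod (h x) \<le> u k m"
      using that kl by (auto simp: F_def)
    have "\<not> n + 1 \<le> m" using umono[of "n + 1" m k] x that by auto
    moreover have "\<not> m + 1 \<le> n" using umono[of "m + 1" n k] x that by auto
    ultimately show ?thesis using kl by simp
  qed
  \<comment> \<open>Off the pieces the parameter is \<open>0\<close>; there the family only has the Gaussian factor.\<close>
  define \<Lambda> where "\<Lambda> = (\<lambda>x. if \<exists>k n. k \<ge> -1 \<and> x \<in> F k n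
     then (case (SOME (k, n). k \<ge> -1 \<and> x \<in> F k n) of (k, n) \<Rightarrow> lam k n) else 0)"
  have \<Lambda>: "\<Lambda> x = lam k n" if "k \<ge> -1" "x \<in> F k n" for x k n
  proof -
    have "(SOME (k, n). k \<ge> -1 \<and> x \<in> F k n) = (k, n)"
      by (rule some_equality) (use that Funique in auto)
    then show ?thesis using that unfolding \<Lambda>_def by auto
  qed
  have \<Lambda>0: "\<Lambda> x = 0" if "\<And>k n. k \<ge> -1 \<Longrightarrow> x \<notin> F k n" for x
    using that by (auto simp: \<Lambda>_def)
  have F\<Omega>: "F k n \<subseteq> \<Omega>" for k n using dyadic_shell_subset by (auto simp: F_def)
  have \<Lambda>m: "\<Lambda> \<in> borel_measurable (lebesgue_on \<Omega>)"
  proof (rule measurableI)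
    fix B :: "real set" assume B: "B \<in> sets borel"
    define P where "P = {(k, n). k \<ge> -1 \<and> lam k n \<in> B}"
    define Q where "Q = {(k::int, n::int). k \<ge> -1}"
    have eq: "\<Lambda> -` B \<inter> space (lebesgue_on \<Omega>) =
       (\<Union>(k,n)\<in>P. F k n) \<union> (if 0 \<in> B then \<Omega> - (\<Union>(k,n)\<in>Q. F k n) else {})"
    proof (intro set_eqI iffI)
      fix x assume x: "x \<in> \<Lambda> -` B \<inter> space (lebesgue_on \<Omega>)"
      show "x \<in> (\<Union>(k,n)\<in>P. F k n) \<union> (if 0 \<in> B then \<Omega> - (\<Union>(k,n)\<in>Q. F k n) else {})"
      proof (cases "\<exists>k n. k \<ge> -1 \<and> x \<in> F k n")
        case True
        then obtain k n where kn: "k \<ge> -1" "x \<in> F k n" by blast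
        then have "(k, n) \<in> P" using \<Lambda>[OF kn] x by (auto simp: P_def)
        then show ?thesis using kn by blast
      next
        case False
        then have "\<Lambda> x = 0" by (intro \<Lambda>0) auto
        then show ?thesis using x False by (auto simp: Q_def)
      qed
    next
      fix x assume x: "x \<in> (\<Union>(k,n)\<in>P. F k n) \<union> (if 0 \<in> B then \<Omega> - (\<Union>(k,n)\<in>Q. F k n) else {})"
      show "x \<in> \<Lambda> -` B \<inter> space (lebesgue_on \<Omega>)"
      proof (cases "x \<in> (\<Union>(k,n)\<in>P. F k n)")
        case True
        then obtain k n where "(k, n) \<in> P" "x \<in> F k n" by blast
        then show ?thesis using \<Lambda>[of k x n] F\<Omega> by (auto simp: P_def)
      next
        case False
        then have "0 \<in> B" "x \<in> \<Omega>" "x \<notin> (\<Union>(k,n)\<in>Q. F k n)" using x by (auto split: if_splits)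
        then show ?thesis using \<Lambda>0[of x] by (auto simp: Q_def)
      qed
    qed
    have "(\<Union>(k,n)\<in>P. F k n) \<in> sets lebesgue" "(\<Union>(k,n)\<in>Q. F k n) \<in> sets lebesgue"
      using Fm by (intro sets.countable_UN'; auto)+
    then have "\<Lambda> -` B \<inter> space (lebesgue_on \<Omega>) \<in> sets lebesgue"
      unfolding eq using \<Omega> by auto
    then show "\<Lambda> -` B \<inter> space (lebesgue_on \<Omega>) \<in> sets (lebesgue_on \<Omega>)"
      using \<Omega> by (subst sets_restrict_space_iff) auto
  qed auto
  have cov: "\<exists>n. x \<in> F k n \<and> \<Lambda> x = lam k n \<and>
      cmod (h x) * exp (- (\<theta> * lam k n)) \<le> g0 k n \<and> cmod (h x) * exp ((1 - \<theta>) * lam k n) \<le> g1 k n"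
    if k: "k \<ge> -1" and x: "x \<in> dyadic_shell \<Omega> k" "x \<notin> Z k" "h x \<noteq> 0" for k x
  proof -
    obtain m where m: "cmod (h x) \<le> u k m" using x by (auto simp: Z_def not_less)
    have "\<exists>j::nat. u k (m + int j) < cmod (h x)"
    proof -
      define B where "B = 2 powr (- (of_int k * a)) * b k"
      have B0: "0 \<le> B" unfolding B_def using ell_ballD(1)[OF y[OF k]] by simp
      have uB: "u k n \<le> 2 powr (- (real_of_int n / p)) * B" for n
      proof -
        have "u k n = 2 powr (- (real_of_int n / p)) * (2 powr (- (of_int k * a)) * y k n)"
          by (simp add: y_def powr_minus field_simps)
        also have "\<dots> \<le> 2 powr (- (real_of_int n / p)) * B"
          unfolding B_def using ell_ballD(3)[OF y[OF k], of n] by (intro mult_left_mono) auto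
        finally show ?thesis .
      qed
      have c0: "0 < cmod (h x)" using x by simp
      define n where "n = max m \<lceil>p * log 2 ((B + 1) / cmod (h x))\<rceil>"
      have "p * log 2 ((B + 1) / cmod (h x)) \<le> real_of_int n" unfolding n_def by linarith
      then have "log 2 ((B + 1) / cmod (h x)) \<le> real_of_int n / p"
        using exps by (simp add: pos_le_divide_eq mult.commute)
      then have n: "(B + 1) / cmod (h x) \<le> 2 powr (real_of_int n / p)"
        using B0 c0 by (simp add: log_le_iff)
      have "u k n \<le> B / 2 powr (real_of_int n / p)" using uB[of n] by (simp add: powr_minus field_simps)
      also have "\<dots> < cmod (h x)"
        using n c0 B0 by (simp add: field_simps)
      finally have "u k n < cmod (h x)" .
      moreover have "n = m + int (nat (n - m))" by (simp add: n_def)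
      ultimately show ?thesis by metis
    qed
    \<comment> \<open>The least \<open>j\<close> gives the largest index \<open>n\<close> with \<open>|h x| \<le> h\<^sup>*(2\<^sup>n)\<close>.\<close>
    then obtain j where j: "u k (m + int j) < cmod (h x)" "\<And>i. i < j \<Longrightarrow> \<not> u k (m + int i) < cmod (h x)"
      using exists_least_iff[of "\<lambda>j. u k (m + int j) < cmod (h x)"] by blast
    have "j \<noteq> 0"
    proof
      assume "j = 0"
      then show False using j(1) m by simp
    qed
    then obtain i where i: "j = Suc i" using not0_implies_Suc by blast
    define n where "n = m + int i"
    have xF: "x \<in> F k n"
      using j(1) j(2)[of i] x i by (simp add: F_def n_def add.assoc add.commute[of 1])
    have hu: "cmod (h x) \<le> u k n" using xF by (simp add: F_def)
    then have un: "0 < u k n" using x(3) by (smt (verit) zero_less_norm_iff)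
    have "cmod (h x) * exp (- (\<theta> * lam k n)) \<le> u k n * exp (- (\<theta> * lam k n))"
      "cmod (h x) * exp ((1 - \<theta>) * lam k n) \<le> u k n * exp ((1 - \<theta>) * lam k n)"
      using hu by (auto intro: mult_right_mono)
    then show ?thesis using xF \<Lambda>[OF k xF] unfolding lam[OF k un] by blast
  qed
  have left: "HL_endpoint \<Omega> \<theta> 0 p\<^sub>0 r\<^sub>0 a\<^sub>0 q\<^sub>0 h Y F Z \<Lambda> lam \<beta>\<^sub>0 (\<tau> r\<^sub>0)"
  proof
    show "\<exists>n. x \<in> F k n \<and> \<Lambda> x = lam k n \<and> cmod (h x) * exp ((0 - \<theta>) * lam k n)
        \<le> 2 powr (- (of_int k * a\<^sub>0)) * 2 powr (- (real_of_int n / p\<^sub>0)) * (Y * (\<beta>\<^sub>0 k * \<tau> r\<^sub>0 k n))"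
      if "k \<ge> -1" "x \<in> dyadic_shell \<Omega> k" "x \<notin> Z k" "h x \<noteq> 0" for k x
      using cov[OF that] by (auto simp: g0_def)
  qed (use \<Omega> hm Y Fm Fe Zn \<Lambda>m \<beta>(1-4) \<tau> exps q01 in auto)
  have right: "HL_endpoint \<Omega> \<theta> 1 p\<^sub>1 r\<^sub>1 a\<^sub>1 q\<^sub>1 h Y F Z \<Lambda> lam \<beta>\<^sub>1 (\<tau> r\<^sub>1)"
  proof
    show "\<exists>n. x \<in> F k n \<and> \<Lambda> x = lam k n \<and> cmod (h x) * exp ((1 - \<theta>) * lam k n)
        \<le> 2 powr (- (of_int k * a\<^sub>1)) * 2 powr (- (real_of_int n / p\<^sub>1)) * (Y * (\<beta>\<^sub>1 k * \<tau> r\<^sub>1 k n))"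
      if "k \<ge> -1" "x \<in> dyadic_shell \<Omega> k" "x \<notin> Z k" "h x \<noteq> 0" for k x
      using cov[OF that] by (auto simp: g1_def)
  qed (use \<Omega> hm Y Fm Fe Zn \<Lambda>m \<beta>(1-4) \<tau> exps q01 in auto)
  interpret HL_resolution \<Omega> \<theta> p\<^sub>0 p\<^sub>1 r\<^sub>0 r\<^sub>1 a\<^sub>0 a\<^sub>1 p r a q\<^sub>0 q\<^sub>1 q h Y F Z \<Lambda> lam \<beta>\<^sub>0 \<beta>\<^sub>1 "\<tau> r\<^sub>0" "\<tau> r\<^sub>1"
    by (rule HL_resolution.intro[OF HL_couple_axioms HL_resolution_axioms.intro[OF left right]])
  show ?thesis by (intro bexI[of _ fam] conjI fam_at_theta fam_norm_le fam_calderon)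
qed

text \<open>
  The auxiliary parameter \<open>Y\<close> is the norm up to a constant plus an arbitrarily small \<open>e\<close>.
\<close>

theorem interpolation_eq_HL: "equivalent_fspaces (complex_interpolation A\<^sub>0 A\<^sub>1 \<theta>) A"
proof -
  define L where "L = lorentz_lower_const p r"
  define D where "D = (lorentz_upper_const p\<^sub>0 r\<^sub>0 + lorentz_upper_const p\<^sub>1 r\<^sub>1) * (2 * exp 1)"
  have L: "0 < L" unfolding L_def by (rule lorentz_lower_const_pos)
  have D: "0 \<le> D" unfolding D_def using lorentz_upper_const_nonneg by (simp add: add_nonneg_nonneg)
  have U: "0 \<le> upper_const" unfolding upper_const_def
    using dual_const lorentz_upper_const_nonneg by simp
  have ex: "\<exists>f\<in>calderon_F A\<^sub>0 A\<^sub>1. f (of_real \<theta>) = x \<and> calderon_F_norm A\<^sub>0 A\<^sub>1 f \<le> D * (L * nrm A x + e)"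
    if x: "x \<in> carr A" and e: "0 < e" for x e
    unfolding D_def
    by (rule HL_into_interpolation[OF x]) (use e L in \<open>auto simp: L_def add_nonneg_pos\<close>)
  have carr: "carr (complex_interpolation A\<^sub>0 A\<^sub>1 \<theta>) = carr A"
  proof
    show "carr (complex_interpolation A\<^sub>0 A\<^sub>1 \<theta>) \<subseteq> carr A"
      using interpolation_into_HL(1) by (auto simp: complex_interpolation_def)
    show "carr A \<subseteq> carr (complex_interpolation A\<^sub>0 A\<^sub>1 \<theta>)"
      using ex[OF _ zero_less_one] by (fastforce simp: complex_interpolation_def)
  qed
  define N where "N = (\<lambda>x. {calderon_F_norm A\<^sub>0 A\<^sub>1 f | f. f \<in> calderon_F A\<^sub>0 A\<^sub>1 \<and> f (of_real \<theta>) = x})"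
  have nrm_eq: "nrm (complex_interpolation A\<^sub>0 A\<^sub>1 \<theta>) x = Inf (N x)" for x
    by (simp add: complex_interpolation_def N_def)
  have bdd: "bdd_below (N x)" for x
    by (rule bdd_belowI[of _ 0]) (auto simp: N_def calderon_F_norm_nonneg)
  have up: "Inf (N x) \<le> D * L * nrm A x" if x: "x \<in> carr A" for x
  proof (rule field_le_epsilon)
    fix e :: real assume e: "0 < e"
    obtain f where f: "f \<in> calderon_F A\<^sub>0 A\<^sub>1" "f (of_real \<theta>) = x"
      "calderon_F_norm A\<^sub>0 A\<^sub>1 f \<le> D * (L * nrm A x + e / (D + 1))"
      using ex[OF x, of "e / (D + 1)"] e D by auto
    have "Inf (N x) \<le> calderon_F_norm A\<^sub>0 A\<^sub>1 f"
      using f by (intro cInf_lower bdd) (auto simp: N_def)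
    also have "\<dots> \<le> D * (L * nrm A x + e / (D + 1))" by (rule f(3))
    also have "\<dots> \<le> D * L * nrm A x + e"
    proof -
      have "D * (e / (D + 1)) \<le> e" using D e by (simp add: field_simps)
      then show ?thesis by (simp add: algebra_simps)
    qed
    finally show "Inf (N x) \<le> D * L * nrm A x + e" .
  qed
  have low: "nrm A x \<le> (upper_const + 1) * Inf (N x)" if x: "x \<in> carr A" for x
  proof -
    have "nrm A x / (upper_const + 1) \<le> Inf (N x)"
    proof (rule cInf_greatest)
      show "N x \<noteq> {}" using ex[OF x zero_less_one] by (auto simp: N_def)
      fix c assume "c \<in> N x"
      then obtain f where f: "f \<in> calderon_F A\<^sub>0 A\<^sub>1" "f (of_real \<theta>) = x" "c = calderon_F_norm A\<^sub>0 A\<^sub>1 f"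
        by (auto simp: N_def)
      have "nrm A x \<le> upper_const * c" using interpolation_into_HL(2)[OF f(1)] f by simp
      also have "\<dots> \<le> (upper_const + 1) * c"
        using calderon_F_norm_nonneg[OF f(1)] f(3) by (simp add: algebra_simps)
      finally show "nrm A x / (upper_const + 1) \<le> c" using U by (simp add: pos_divide_le_eq mult.commute)
    qed
    then show ?thesis using U by (simp add: pos_divide_le_eq mult.commute)
  qed
  define C where "C = D * L + upper_const + 1"
  have C: "0 < C" "D * L \<le> C" "upper_const + 1 \<le> C" using D L U by (auto simp: C_def add_nonneg_pos)
  have "nrm (complex_interpolation A\<^sub>0 A\<^sub>1 \<theta>) x \<le> C * nrm A x \<and>
      nrm A x \<le> C * nrm (complex_interpolation A\<^sub>0 A\<^sub>1 \<theta>) x" if x: "x \<in> carr A" for x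
  proof
    have "D * L * nrm A x \<le> C * nrm A x" using C by (intro mult_right_mono) auto
    then show "nrm (complex_interpolation A\<^sub>0 A\<^sub>1 \<theta>) x \<le> C * nrm A x"
      unfolding nrm_eq using up[OF x] by simp
    have "0 \<le> (upper_const + 1) * Inf (N x)" using low[OF x] HL_nrm_nonneg order_trans by blast
    then have "0 \<le> Inf (N x)" using U by (simp add: zero_le_mult_iff)
    then have "(upper_const + 1) * Inf (N x) \<le> C * Inf (N x)" using C by (intro mult_right_mono) auto
    then show "nrm A x \<le> C * nrm (complex_interpolation A\<^sub>0 A\<^sub>1 \<theta>) x"
      unfolding nrm_eq using low[OF x] by simp
  qed
  then show ?thesis unfolding equivalent_fspaces_def carr using C(1) by blast
qed

end

theorem theorem3p1p1p9:
  fixes \<Omega> :: "'a::euclidean_space set"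
    and \<theta> p\<^sub>0 p\<^sub>1 r\<^sub>0 r\<^sub>1 a\<^sub>0 a\<^sub>1 p r a :: real
    and q\<^sub>0 q\<^sub>1 q :: ennreal
  assumes "\<Omega> \<in> sets lebesgue"
    and "0 < \<theta>" "\<theta> < 1"
    and "1 < r\<^sub>0" "r\<^sub>0 \<le> p\<^sub>0"
    and "1 < r\<^sub>1" "r\<^sub>1 \<le> p\<^sub>1"
    and "1 \<le> q\<^sub>0" "1 \<le> q\<^sub>1" "\<not> (q\<^sub>0 = \<infinity> \<and> q\<^sub>1 = \<infinity>)"
    and "1 / p = (1 - \<theta>) / p\<^sub>0 + \<theta> / p\<^sub>1"
    and "1 / q = ennreal (1 - \<theta>) / q\<^sub>0 + ennreal \<theta> / q\<^sub>1"
    and "1 / r = (1 - \<theta>) / r\<^sub>0 + \<theta> / r\<^sub>1"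
    and "a = (1 - \<theta>) * a\<^sub>0 + \<theta> * a\<^sub>1"
  shows "equivalent_fspaces
           (complex_interpolation (HL \<Omega> p\<^sub>0 r\<^sub>0 a\<^sub>0 q\<^sub>0) (HL \<Omega> p\<^sub>1 r\<^sub>1 a\<^sub>1 q\<^sub>1) \<theta>)
           (HL \<Omega> p r a q)"
proof -
  interpret HL_couple \<Omega> \<theta> p\<^sub>0 p\<^sub>1 r\<^sub>0 r\<^sub>1 a\<^sub>0 a\<^sub>1 p r a q\<^sub>0 q\<^sub>1 q
    by unfold_locales (fact assms)+
  show ?thesis by (rule interpolation_eq_HL)
qed

end
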